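(* Let $\pi:\mathbb{R}\to\mathbb{T}$, $\pi(r)=e^{2\pi i r}$, be the universal covering of $\mathbb{T}$, let $A=C^{\infty}(\mathbb{T}^2)$, and let $\mathbb{Z}$ act on $A$ by $\gamma:\mathbb{Z}\to\operatorname{Aut}(A)$, $(\gamma(n).f)(z_1,z_2)=f(z_1,z_1^nz_2)$. Let $$q:\mathbb{A}:=\mathbb{R}\times_{\gamma}A\to\mathbb{T},\quad [r,f]\mapsto\pi(r),$$ be the associated algebra bundle with fibre $A$. Then the space $\Gamma\mathbb{A}$ of smooth sections carries the structure of a non-trivial noncommutative principal $\mathbb{T}$-bundle; that is, there is a homomorphism $\beta:\mathbb{T}\to\operatorname{Aut}(\Gamma\mathbb{A})$ such that $(\Gamma\mathbb{A},\mathbb{T},\beta)$ is a dynamical system which is a noncommutative principal $\mathbb{T}$-bundle but not a trivial noncommutative principal $\mathbb{T}$-bundle.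
   Context: $\mathbb{R}\times_\gamma A$ is the orbit space of $\mathbb{R}\times A$ under the $\mathbb{Z}$-action $(r,f).n=(r+n,\gamma(-n).f)$; $[r,f]$ is the class of $(r,f)$. All algebras are complex and associative; $C^\infty(\mathbb{T}^2)$ denotes complex-valued smooth functions. A locally convex algebra is a (Hausdorff) locally convex space with a jointly continuous bilinear associative multiplication. $\operatorname{Aut}(A)$ is the group of automorphisms of $A$ as a (unital) locally convex algebra. $\Gamma_A$ is the set of nonzero algebra homomorphisms $A\to\mathbb{C}$ with the topology of pointwise convergence. A dynamical system $(A,G,\alpha)$ consists of a unital locally convex algebra $A$, a topological group $G$ and a homomorphism $\alpha:G\to\operatorname{Aut}(A)$ such that $G\times A\to A$, $(g,a)\mapsto\alpha(g)a$, is continuous. For a manifold $M$ and a locally convex space $E$, $C^\infty(M,E)$ carries the smooth compact open topology: the initial topology for $f\mapsto T^kf\in C(T^kM,T^kE)$, $k\in\mathbb{N}_0$ ($T^k$ the iterated tangent functor), with compact open topologies. An algebra bundle $(\mathbb{A},M,A,q)$ with fibre $A$ is a smooth map $q:\mathbb{A}\to M$ from a (possibly infinite-dimensional) manifold, whose fibres are algebras, such that $M$ is covered by open sets $U$ with diffeomorphisms (bundle charts) $\varphi_U:U\times A\to q^{-1}(U)$ over $U$ that are fibrewise algebra isomorphisms. $\Gamma\mathbb{A}=\{s\in C^\infty(M,\mathbb{A}):q\circ s=\mathrm{id}_M\}$ with pointwise operations; its topology is the initial topology for the maps $\Gamma\mathbb{A}\to C^\infty(U_i,A)$, $s\mapsto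 \mathrm{pr}_A\circ\varphi_i^{-1}\circ s|_{U_i}$, for a bundle atlas $(\varphi_i,U_i)_{i\in I}$. Trivial bundles: a dynamical system $(A,\mathbb{T}^n,\alpha)$ is a trivial noncommutative principal $\mathbb{T}^n$-bundle if for each ${\bf k}\in\mathbb{Z}^n$ the isotypic component $A_{\bf k}:=\{a\in A:\alpha(t)a=t^{\bf k}a\ \forall t\in\mathbb{T}^n\}$ contains an invertible element of $A$. Localization: for a dynamical system $(A,G,\alpha)$ let $Z:=C_A^G$ be the fixed point algebra of the $G$-action on the center $C_A$ of $A$. For $z\in Z$ let $A_{\{z\}}:=C^\infty(\mathbb{R},A)/I_z$, where $I_z$ is the closure of the two-sided ideal generated by $t\mapsto 1_A-tz$. Then $\alpha_{\{z\}}(g)[f]:=[\alpha(g)\circ f]$ makes $(A_{\{z\}},G,\alpha_{\{z\}})$ a dynamical system. A dynamical system $(A,\mathbb{T}^n,\alpha)$ is a noncommutative principal $\mathbb{T}^n$-bundle if for each $\chi\in\Gamma_Z$ there is an element $z\in Z$ with $\chi(z)\neq0$ such that $(A_{\{z\}},\mathbb{T}^n,\alpha_{\{z\}})$ is a trivial noncommutative principal $\mathbb{T}^n$-bundle. *)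

theory Defs
  imports
    "HOL-Analysis.Analysis"
    "HOL-Algebra.Bij"
    "HOL-Algebra.QuotRing"
    "HOL-Algebra.Module"
begin

section \<open>Locally convex algebras\<close>

record 'a top_algebra = "(complex, 'a) module" +
  topol :: "'a topology"

definition complex_algebra :: "complex top_algebra" where
  "complex_algebra =
     \<lparr>carrier = UNIV, mult = (*), one = 1, zero = 0, add = (+), smult = (*),
      topol = euclidean\<rparr>"

definition convex_in :: "('a, 'm) top_algebra_scheme \<Rightarrow> 'a set \<Rightarrow> bool" where
  "convex_in A W \<longleftrightarrow>
     W \<subseteq> carrier A \<and>
     (\<forall>x\<in>W. \<forall>y\<in>W. \<forall>t::real. 0 \<le> t \<longrightarrow> t \<le> 1 \<longrightarrow>
        (complex_of_real (1 - t) \<odot>\<^bsub>A\<^esub> x) \<oplus>\<^bsub>A\<^esub> (complex_of_real t \<odot>\<^bsub>A\<^esub> y) \<in> W)"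

text \<open>
  Unital complex locally convex algebras. The locale \<open>algebra\<close> of HOL-Algebra is not used
  because it only covers commutative algebras.
\<close>

definition lc_algebra :: "('a, 'm) top_algebra_scheme \<Rightarrow> bool" where
  "lc_algebra A \<longleftrightarrow>
     ring A \<and> module complex_algebra A \<and>
     (\<forall>c. \<forall>x\<in>carrier A. \<forall>y\<in>carrier A.
        (c \<odot>\<^bsub>A\<^esub> x) \<otimes>\<^bsub>A\<^esub> y = c \<odot>\<^bsub>A\<^esub> (x \<otimes>\<^bsub>A\<^esub> y) \<and>
        x \<otimes>\<^bsub>A\<^esub> (c \<odot>\<^bsub>A\<^esub> y) = c \<odot>\<^bsub>A\<^esub> (x \<otimes>\<^bsub>A\<^esub> y)) \<and>
     topspace (topol A) = carrier A \<and>
     Hausdorff_space (topol A) \<and>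
     continuous_map (prod_topology (topol A) (topol A)) (topol A) (\<lambda>(x, y). x \<oplus>\<^bsub>A\<^esub> y) \<and>
     continuous_map (prod_topology euclidean (topol A)) (topol A) (\<lambda>(c, x). c \<odot>\<^bsub>A\<^esub> x) \<and>
     continuous_map (prod_topology (topol A) (topol A)) (topol A) (\<lambda>(x, y). x \<otimes>\<^bsub>A\<^esub> y) \<and>
     (\<forall>U. openin (topol A) U \<and> \<zero>\<^bsub>A\<^esub> \<in> U \<longrightarrow>
        (\<exists>W. openin (topol A) W \<and> \<zero>\<^bsub>A\<^esub> \<in> W \<and> W \<subseteq> U \<and> convex_in A W))"

definition alg_hom ::
  "('a, 'm) top_algebra_scheme \<Rightarrow> ('b, 'n) top_algebra_scheme \<Rightarrow> ('a \<Rightarrow> 'b) set" where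
  "alg_hom A B =
     {h \<in> carrier A \<rightarrow> carrier B.
        (\<forall>x\<in>carrier A. \<forall>y\<in>carrier A.
           h (x \<oplus>\<^bsub>A\<^esub> y) = h x \<oplus>\<^bsub>B\<^esub> h y \<and> h (x \<otimes>\<^bsub>A\<^esub> y) = h x \<otimes>\<^bsub>B\<^esub> h y) \<and>
        (\<forall>c. \<forall>x\<in>carrier A. h (c \<odot>\<^bsub>A\<^esub> x) = c \<odot>\<^bsub>B\<^esub> h x)}"

definition lc_aut :: "('a, 'm) top_algebra_scheme \<Rightarrow> ('a \<Rightarrow> 'a) set" where
  "lc_aut A =
     {h \<in> Bij (carrier A). h \<in> alg_hom A A \<and> h \<one>\<^bsub>A\<^esub> = \<one>\<^bsub>A\<^esub> \<and>
        homeomorphic_map (topol A) (topol A) h}"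

definition lc_aut_group :: "('a, 'm) top_algebra_scheme \<Rightarrow> ('a \<Rightarrow> 'a) monoid" where
  "lc_aut_group A = BijGroup (carrier A) \<lparr>carrier := lc_aut A\<rparr>"

text \<open>The elements of \<open>\<Gamma>\<^sub>A\<close>; note that no continuity is required.\<close>

definition characters :: "('a, 'm) top_algebra_scheme \<Rightarrow> ('a \<Rightarrow> complex) set" where
  "characters A = {h \<in> alg_hom A complex_algebra. \<exists>a\<in>carrier A. h a \<noteq> 0}"


section \<open>Dynamical systems\<close>

definition topological_group :: "('g, 'm) monoid_scheme \<Rightarrow> 'g topology \<Rightarrow> bool" where
  "topological_group G T \<longleftrightarrow>
     group G \<and> topspace T = carrier G \<and>
     continuous_map (prod_topology T T) T (\<lambda>(g, h). g \<otimes>\<^bsub>G\<^esub> h) \<and>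
     continuous_map T T (\<lambda>g. inv\<^bsub>G\<^esub> g)"

definition dynamical_system ::
  "('a, 'm) top_algebra_scheme \<Rightarrow> ('g, 'n) monoid_scheme \<Rightarrow> 'g topology \<Rightarrow> ('g \<Rightarrow> 'a \<Rightarrow> 'a) \<Rightarrow> bool"
where
  "dynamical_system A G T \<alpha> \<longleftrightarrow>
     lc_algebra A \<and> topological_group G T \<and> \<alpha> \<in> hom G (lc_aut_group A) \<and>
     continuous_map (prod_topology T (topol A)) (topol A) (\<lambda>(g, a). \<alpha> g a)"

definition center :: "('a, 'm) top_algebra_scheme \<Rightarrow> 'a set" where
  "center A = {a \<in> carrier A. \<forall>b\<in>carrier A. a \<otimes>\<^bsub>A\<^esub> b = b \<otimes>\<^bsub>A\<^esub> a}"

definition fixed_center ::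
  "('a, 'm) top_algebra_scheme \<Rightarrow> ('g, 'n) monoid_scheme \<Rightarrow> ('g \<Rightarrow> 'a \<Rightarrow> 'a) \<Rightarrow>
   ('a, 'm) top_algebra_scheme" where
  "fixed_center A G \<alpha> =
     A \<lparr>carrier := {a \<in> center A. \<forall>g\<in>carrier G. \<alpha> g a = a}\<rparr>"


section \<open>Smooth maps with values in a locally convex space\<close>

definition initial_topology ::
  "'a set \<Rightarrow> 'i set \<Rightarrow> ('i \<Rightarrow> 'a \<Rightarrow> 'b) \<Rightarrow> ('i \<Rightarrow> 'b topology) \<Rightarrow> 'a topology" where
  "initial_topology S I F T =
     topology_generated_by
       (insert S {F i -` U \<inter> S | i U. i \<in> I \<and> openin (T i) U})"

text \<open>\<open>C(X, Y)\<close> consists of the continuous maps that are extensional on the space \<open>X\<close>.\<close>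

definition compact_open :: "'a topology \<Rightarrow> 'b topology \<Rightarrow> ('a \<Rightarrow> 'b) topology" where
  "compact_open X Y =
     topology_generated_by
       {{f \<in> extensional (topspace X). continuous_map X Y f \<and> f ` K \<subseteq> W} | K W.
          compactin X K \<and> openin Y W}"

text \<open>
  For \<open>V\<close> open in a Euclidean space, \<open>T\<^sup>k V\<close> is \<open>V\<close> times \<open>2\<^sup>k - 1\<close> copies of that space.
  A point of it is a family \<open>w\<close> indexed by \<open>{..<2 ^ k}\<close> with \<open>w 0 \<in> V\<close>; the splitting
  \<open>T\<^sup>k\<^sup>+\<^sup>1 V = T\<^sup>k V \<times> (model space of T\<^sup>k V)\<close> takes the indices below \<open>2 ^ k\<close> as the
  base point and the remaining ones, shifted by \<open>2 ^ k\<close>, as the tangent vector.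
  Similarly \<open>T\<^sup>k E\<close> is the product of \<open>2\<^sup>k\<close> copies of \<open>E\<close>.
\<close>

definition tangent_dom :: "nat \<Rightarrow> 'v::euclidean_space set \<Rightarrow> (nat \<Rightarrow> 'v) topology" where
  "tangent_dom k V =
     subtopology (product_topology (\<lambda>_. euclidean) {..<2 ^ k}) {w. w 0 \<in> V}"

definition tangent_cod :: "nat \<Rightarrow> ('a, 'm) top_algebra_scheme \<Rightarrow> (nat \<Rightarrow> 'a) topology" where
  "tangent_cod k E = product_topology (\<lambda>_. topol E) {..<2 ^ k}"

definition has_dir_deriv ::
  "('a, 'm) top_algebra_scheme \<Rightarrow> ((nat \<Rightarrow> 'v::euclidean_space) \<Rightarrow> 'a) \<Rightarrow>
   (nat \<Rightarrow> 'v) \<Rightarrow> (nat \<Rightarrow> 'v) \<Rightarrow> 'a \<Rightarrow> bool" where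
  "has_dir_deriv E F x v l \<longleftrightarrow>
     limitin (topol E)
       (\<lambda>t::real. complex_of_real (1 / t) \<odot>\<^bsub>E\<^esub> (F (\<lambda>j. x j + t *\<^sub>R v j) \<ominus>\<^bsub>E\<^esub> F x))
       l (at 0)"

text \<open>
  The iterated tangent map: \<open>tangent_map E k f w i\<close> is the component with index \<open>i < 2 ^ k\<close>
  of \<open>T\<^sup>k f w\<close>, where \<open>T F (x, v) = (F x, dF x v)\<close>. It depends only on the
  values \<open>w j\<close> with \<open>j < 2 ^ k\<close>.
\<close>

primrec tangent_map ::
  "('a, 'm) top_algebra_scheme \<Rightarrow> nat \<Rightarrow> ('v::euclidean_space \<Rightarrow> 'a) \<Rightarrow> (nat \<Rightarrow> 'v) \<Rightarrow> nat \<Rightarrow> 'a"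
where
  "tangent_map E 0 f = (\<lambda>w i. f (w 0))"
| "tangent_map E (Suc k) f =
     (\<lambda>w i. if i < 2 ^ k then tangent_map E k f w i
            else (THE l. has_dir_deriv E (\<lambda>x. tangent_map E k f x (i - 2 ^ k))
                           w (\<lambda>j. w (j + 2 ^ k)) l))"

definition tangent_map_ext ::
  "('a, 'm) top_algebra_scheme \<Rightarrow> nat \<Rightarrow> 'v::euclidean_space set \<Rightarrow> ('v \<Rightarrow> 'a) \<Rightarrow>
   (nat \<Rightarrow> 'v) \<Rightarrow> nat \<Rightarrow> 'a" where
  "tangent_map_ext E k V f =
     (\<lambda>w\<in>topspace (tangent_dom k V). \<lambda>i\<in>{..<2 ^ k}. tangent_map E k f w i)"

text \<open>
  Smoothness in the sense of Michal and Bastiani: all iterated tangent maps exist, as limits of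
  difference quotients, and are continuous.
\<close>

definition smooth_into ::
  "('a, 'm) top_algebra_scheme \<Rightarrow> 'v::euclidean_space set \<Rightarrow> ('v \<Rightarrow> 'a) \<Rightarrow> bool" where
  "smooth_into E V f \<longleftrightarrow>
     f \<in> V \<rightarrow> carrier E \<and>
     (\<forall>k. \<forall>w\<in>topspace (tangent_dom (Suc k) V). \<forall>i<2 ^ k.
        \<exists>l. has_dir_deriv E (\<lambda>x. tangent_map E k f x i) w (\<lambda>j. w (j + 2 ^ k)) l) \<and>
     (\<forall>k. continuous_map (tangent_dom k V) (tangent_cod k E) (tangent_map_ext E k V f))"

text \<open>
  A finite-dimensional manifold is given by an atlas of parametrizations \<open>(V, \<psi>)\<close>:
  \<open>V\<close> is open in the Euclidean model space and \<open>\<psi>\<close> maps it diffeomorphically onto an open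
  subset. As \<open>T\<^sup>k M\<close> is glued from the open subsets \<open>T\<^sup>k \<psi> (T\<^sup>k V)\<close>, the smooth compact open
  topology is initial for the maps \<open>f \<mapsto> T\<^sup>k (f \<circ> \<psi>) \<in> C(T\<^sup>k V, T\<^sup>k E)\<close>.
\<close>

type_synonym ('v, 'x) atlas = "('v set \<times> ('v \<Rightarrow> 'x)) set"

definition points :: "('v, 'x) atlas \<Rightarrow> 'x set" where
  "points M = (\<Union>(V, \<psi>)\<in>M. \<psi> ` V)"

definition smooth_maps ::
  "('v::euclidean_space, 'x) atlas \<Rightarrow> ('a, 'm) top_algebra_scheme \<Rightarrow> ('x \<Rightarrow> 'a) set" where
  "smooth_maps M E =
     {f \<in> points M \<rightarrow>\<^sub>E carrier E. \<forall>(V, \<psi>)\<in>M. smooth_into E V (f \<circ> \<psi>)}"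

definition smooth_algebra ::
  "('v::euclidean_space, 'x) atlas \<Rightarrow> ('a, 'm) top_algebra_scheme \<Rightarrow> ('x \<Rightarrow> 'a) top_algebra" where
  "smooth_algebra M E =
     \<lparr>carrier = smooth_maps M E,
      mult = (\<lambda>f g. \<lambda>x\<in>points M. f x \<otimes>\<^bsub>E\<^esub> g x),
      one = (\<lambda>x\<in>points M. \<one>\<^bsub>E\<^esub>),
      zero = (\<lambda>x\<in>points M. \<zero>\<^bsub>E\<^esub>),
      add = (\<lambda>f g. \<lambda>x\<in>points M. f x \<oplus>\<^bsub>E\<^esub> g x),
      smult = (\<lambda>c f. \<lambda>x\<in>points M. c \<odot>\<^bsub>E\<^esub> f x),
      topol = initial_topology (smooth_maps M E) (UNIV \<times> M)
                (\<lambda>(k, V, \<psi>) f. tangent_map_ext E k V (f \<circ> \<psi>))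
                (\<lambda>(k, V, \<psi>). compact_open (tangent_dom k V) (tangent_cod k E))\<rparr>"

definition real_line :: "(real, real) atlas" where
  "real_line = {(UNIV, \<lambda>r. r)}"


section \<open>Localization and noncommutative principal circle bundles\<close>

definition loc_ideal :: "('a, 'm) top_algebra_scheme \<Rightarrow> 'a \<Rightarrow> (real \<Rightarrow> 'a) set" where
  "loc_ideal A z =
     topol (smooth_algebra real_line A) closure_of
       (Idl\<^bsub>smooth_algebra real_line A\<^esub> {\<lambda>t. \<one>\<^bsub>A\<^esub> \<ominus>\<^bsub>A\<^esub> (complex_of_real t \<odot>\<^bsub>A\<^esub> z)})"

text \<open>
  For a set \<open>U\<close> of cosets, \<open>\<Union>U\<close> is its preimage under the projection,
  so the topology given below is the quotient topology.
\<close>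

definition quotient_algebra ::
  "('a, 'm) top_algebra_scheme \<Rightarrow> 'a set \<Rightarrow> 'a set top_algebra" where
  "quotient_algebra B I =
     \<lparr>carrier = carrier (B Quot I), mult = mult (B Quot I), one = one (B Quot I),
      zero = zero (B Quot I), add = add (B Quot I),
      smult = (\<lambda>c X. \<Union>x\<in>X. I +>\<^bsub>B\<^esub> (c \<odot>\<^bsub>B\<^esub> x)),
      topol = topology (\<lambda>U. U \<subseteq> carrier (B Quot I) \<and> openin (topol B) (\<Union>U))\<rparr>"

definition localization ::
  "('a, 'm) top_algebra_scheme \<Rightarrow> 'a \<Rightarrow> (real \<Rightarrow> 'a) set top_algebra" where
  "localization A z = quotient_algebra (smooth_algebra real_line A) (loc_ideal A z)"

definition loc_action ::
  "('a, 'm) top_algebra_scheme \<Rightarrow> 'a \<Rightarrow> ('g \<Rightarrow> 'a \<Rightarrow> 'a) \<Rightarrow>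
   'g \<Rightarrow> (real \<Rightarrow> 'a) set \<Rightarrow> (real \<Rightarrow> 'a) set" where
  "loc_action A z \<alpha> g =
     (\<lambda>X\<in>carrier (localization A z).
        \<Union>f\<in>X. loc_ideal A z +>\<^bsub>smooth_algebra real_line A\<^esub> (\<lambda>t. \<alpha> g (f t)))"

definition circle :: "complex set" where
  "circle = sphere 0 1"

definition circle_group :: "complex monoid" where
  "circle_group = \<lparr>carrier = circle, mult = (*), one = 1\<rparr>"

definition circle_top :: "complex topology" where
  "circle_top = top_of_set circle"

definition isotypic ::
  "('a, 'm) top_algebra_scheme \<Rightarrow> (complex \<Rightarrow> 'a \<Rightarrow> 'a) \<Rightarrow> int \<Rightarrow> 'a set" where
  "isotypic A \<alpha> k = {a \<in> carrier A. \<forall>t\<in>circle. \<alpha> t a = (t powi k) \<odot>\<^bsub>A\<^esub> a}"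

text \<open>The notions for the torus of dimension n are only needed for n = 1.\<close>

definition trivial_nc_principal_bundle ::
  "('a, 'm) top_algebra_scheme \<Rightarrow> (complex \<Rightarrow> 'a \<Rightarrow> 'a) \<Rightarrow> bool" where
  "trivial_nc_principal_bundle A \<alpha> \<longleftrightarrow>
     dynamical_system A circle_group circle_top \<alpha> \<and>
     (\<forall>k. isotypic A \<alpha> k \<inter> Units A \<noteq> {})"

definition nc_principal_bundle ::
  "('a, 'm) top_algebra_scheme \<Rightarrow> (complex \<Rightarrow> 'a \<Rightarrow> 'a) \<Rightarrow> bool" where
  "nc_principal_bundle A \<alpha> \<longleftrightarrow>
     dynamical_system A circle_group circle_top \<alpha> \<and>
     (\<forall>h\<in>characters (fixed_center A circle_group \<alpha>).
        \<exists>z\<in>carrier (fixed_center A circle_group \<alpha>).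
          h z \<noteq> 0 \<and> trivial_nc_principal_bundle (localization A z) (loc_action A z \<alpha>))"


section \<open>The algebra bundle over the circle and its sections\<close>

definition circle_cover :: "real \<Rightarrow> complex" where
  "circle_cover r = exp (2 * complex_of_real pi * \<i> * complex_of_real r)"

text \<open>The parametrizations of an open subset \<open>U\<close> of the circle.\<close>

definition circle_atlas :: "complex set \<Rightarrow> (real, complex) atlas" where
  "circle_atlas U =
     {(V, circle_cover) | V. open V \<and> inj_on circle_cover V \<and> circle_cover ` V \<subseteq> U}"

definition torus :: "(complex \<times> complex) set" where
  "torus = circle \<times> circle"

definition torus_atlas :: "(real \<times> real, complex \<times> complex) atlas" where
  "torus_atlas =
     {(V \<times> W, map_prod circle_cover circle_cover) | V W.
        open V \<and> open W \<and> inj_on circle_cover V \<and> inj_on circle_cover W}"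

definition torus_algebra :: "(complex \<times> complex \<Rightarrow> complex) top_algebra" where
  "torus_algebra = smooth_algebra torus_atlas complex_algebra"

definition gamma ::
  "int \<Rightarrow> (complex \<times> complex \<Rightarrow> complex) \<Rightarrow> complex \<times> complex \<Rightarrow> complex" where
  "gamma n f = (\<lambda>(z1, z2)\<in>torus. f (z1, (z1 powi n) * z2))"

text \<open>
  The bundle \<open>\<real> \<times>\<^sub>\<gamma> A\<close> for a \<open>\<int>\<close>-action \<open>\<gamma>\<close> on \<open>A\<close> by automorphisms;
  \<open>orbit_class \<gamma> r f\<close> is \<open>[r, f]\<close>.
\<close>

definition orbit_class :: "(int \<Rightarrow> 'a \<Rightarrow> 'a) \<Rightarrow> real \<Rightarrow> 'a \<Rightarrow> (real \<times> 'a) set" where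
  "orbit_class \<gamma> r f = {(r + of_int n, \<gamma> (- n) f) | n. True}"

definition total_space ::
  "('a, 'm) top_algebra_scheme \<Rightarrow> (int \<Rightarrow> 'a \<Rightarrow> 'a) \<Rightarrow> (real \<times> 'a) set set" where
  "total_space A \<gamma> = {orbit_class \<gamma> r f | r f. f \<in> carrier A}"

definition bundle_proj :: "(real \<times> 'a) set \<Rightarrow> complex" where
  "bundle_proj c = (THE z. \<exists>(r, f)\<in>c. z = circle_cover r)"

text \<open>The well-defined fibrewise operations \<open>[r, f] \<mapsto> [r, h f]\<close> and
  \<open>([r, f], [r, g]) \<mapsto> [r, h f g]\<close>.\<close>

definition fibre_lift1 ::
  "('a, 'm) top_algebra_scheme \<Rightarrow> (int \<Rightarrow> 'a \<Rightarrow> 'a) \<Rightarrow> ('a \<Rightarrow> 'a) \<Rightarrow>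
   (real \<times> 'a) set \<Rightarrow> (real \<times> 'a) set" where
  "fibre_lift1 A \<gamma> h c =
     (THE e. \<exists>r. \<exists>f\<in>carrier A. c = orbit_class \<gamma> r f \<and> e = orbit_class \<gamma> r (h f))"

definition fibre_lift2 ::
  "('a, 'm) top_algebra_scheme \<Rightarrow> (int \<Rightarrow> 'a \<Rightarrow> 'a) \<Rightarrow> ('a \<Rightarrow> 'a \<Rightarrow> 'a) \<Rightarrow>
   (real \<times> 'a) set \<Rightarrow> (real \<times> 'a) set \<Rightarrow> (real \<times> 'a) set" where
  "fibre_lift2 A \<gamma> h c d =
     (THE e. \<exists>r. \<exists>f\<in>carrier A. \<exists>g\<in>carrier A.
        c = orbit_class \<gamma> r f \<and> d = orbit_class \<gamma> r g \<and> e = orbit_class \<gamma> r (h f g))"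

text \<open>The class \<open>[r, a]\<close> in the fibre over \<open>\<pi>(r) = z\<close>, for an element \<open>a\<close> fixed by \<open>\<gamma>\<close>.\<close>

definition fibre_const ::
  "(int \<Rightarrow> 'a \<Rightarrow> 'a) \<Rightarrow> 'a \<Rightarrow> complex \<Rightarrow> (real \<times> 'a) set" where
  "fibre_const \<gamma> a z = (THE e. \<exists>r. circle_cover r = z \<and> e = orbit_class \<gamma> r a)"

text \<open>
  The bundle charts \<open>\<phi>\<^sub>V : \<pi>(V) \<times> A \<rightarrow> q\<^sup>-\<^sup>1(\<pi>(V))\<close>, \<open>\<phi>\<^sub>V (\<pi>(r), f) = [r, f]\<close> for \<open>r \<in> V\<close>,
  where \<open>V\<close> is open and mapped injectively to the circle. They define the manifold structure
  of the total space.
\<close>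

definition chart_domains :: "real set set" where
  "chart_domains = {V. open V \<and> inj_on circle_cover V}"

definition bundle_chart ::
  "(int \<Rightarrow> 'a \<Rightarrow> 'a) \<Rightarrow> real set \<Rightarrow> complex \<times> 'a \<Rightarrow> (real \<times> 'a) set" where
  "bundle_chart \<gamma> V = (\<lambda>(z, f). orbit_class \<gamma> (the_inv_into V circle_cover z) f)"

text \<open>The local representative \<open>pr\<^sub>A \<circ> \<phi>\<^sub>V\<^sup>-\<^sup>1 \<circ> s\<close> on \<open>\<pi>(V)\<close>.\<close>

definition local_rep ::
  "('a, 'm) top_algebra_scheme \<Rightarrow> (int \<Rightarrow> 'a \<Rightarrow> 'a) \<Rightarrow> real set \<Rightarrow>
   (complex \<Rightarrow> (real \<times> 'a) set) \<Rightarrow> complex \<Rightarrow> 'a" where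
  "local_rep A \<gamma> V s =
     (\<lambda>z\<in>circle_cover ` V.
        snd (the_inv_into (circle_cover ` V \<times> carrier A) (bundle_chart \<gamma> V) (s z)))"

text \<open>
  A map \<open>s\<close> with \<open>q \<circ> s = id\<close> is carried by \<open>\<phi>\<^sub>V\<close> to the map
  \<open>z \<mapsto> (z, local_rep A \<gamma> V s z)\<close>, so it is smooth as a map into the total space
  iff all its local representatives are smooth.
\<close>

definition smooth_sections ::
  "('a, 'm) top_algebra_scheme \<Rightarrow> (int \<Rightarrow> 'a \<Rightarrow> 'a) \<Rightarrow> (complex \<Rightarrow> (real \<times> 'a) set) set" where
  "smooth_sections A \<gamma> =
     {s \<in> circle \<rightarrow>\<^sub>E total_space A \<gamma>.
        (\<forall>z\<in>circle. bundle_proj (s z) = z) \<and>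
        (\<forall>V\<in>chart_domains.
           local_rep A \<gamma> V s \<in> smooth_maps (circle_atlas (circle_cover ` V)) A)}"

definition section_algebra ::
  "('a, 'm) top_algebra_scheme \<Rightarrow> (int \<Rightarrow> 'a \<Rightarrow> 'a) \<Rightarrow>
   (complex \<Rightarrow> (real \<times> 'a) set) top_algebra" where
  "section_algebra A \<gamma> =
     \<lparr>carrier = smooth_sections A \<gamma>,
      mult = (\<lambda>s u. \<lambda>z\<in>circle. fibre_lift2 A \<gamma> (mult A) (s z) (u z)),
      one = (\<lambda>z\<in>circle. fibre_const \<gamma> \<one>\<^bsub>A\<^esub> z),
      zero = (\<lambda>z\<in>circle. fibre_const \<gamma> \<zero>\<^bsub>A\<^esub> z),
      add = (\<lambda>s u. \<lambda>z\<in>circle. fibre_lift2 A \<gamma> (add A) (s z) (u z)),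
      smult = (\<lambda>c s. \<lambda>z\<in>circle. fibre_lift1 A \<gamma> (\<lambda>f. c \<odot>\<^bsub>A\<^esub> f) (s z)),
      topol = initial_topology (smooth_sections A \<gamma>) chart_domains
                (local_rep A \<gamma>)
                (\<lambda>V. topol (smooth_algebra (circle_atlas (circle_cover ` V)) A))\<rparr>"

end

theory Submission
  imports Defs
begin

text \<open>
  A section of \<open>\<real> \<times>\<^sub>\<gamma> A\<close> is the same as a smooth map \<open>F : \<real> \<rightarrow> A\<close> with \<open>F (r + n) = \<gamma>(-n) (F r)\<close>. Since
  rotations of the second variable commute with \<open>\<gamma>\<close>, they act on the sections; this is \<open>\<beta>\<close>.

  The circle is covered by the complements of two points, over each of which the bundle is trivial. Let
  \<open>w\<^sub>k\<close> be the local section \<open>z\<^sub>2\<^sup>k\<close> times a function that vanishes to infinite order at the missing point.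
  Then \<open>w\<^sub>k w\<^sub>-\<^sub>k = w\<^sub>0\<^sup>2\<close>, so \<open>(t w\<^sub>k) (t w\<^sub>-\<^sub>k) = 1 - (1 - t w\<^sub>0) (1 + t w\<^sub>0)\<close>, and the class of \<open>t w\<^sub>k\<close> is an
  invertible element of weight \<open>k\<close> in the localization at \<open>w\<^sub>0\<close>. The sum of the two functions \<open>w\<^sub>0\<close> is
  invertible in the fixed point algebra, so a character cannot vanish on both.

  An invertible section of weight 1 would be a nowhere vanishing section of a line bundle of
  nonzero degree over the torus.
\<close>

section \<open>Initial and compact-open topologies\<close>

text \<open>Most of the work lies in the topologies. Sections carry an initial topology over
  \<open>smooth_algebra\<close> of \<open>\<A>\<close>, which is itself a
  \<open>smooth_algebra\<close>, and the localization adds a third such layer followed by a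
  quotient. At each layer a locally convex algebra with a jointly continuous action has to be
  exhibited. The topological part is therefore proved once, for arbitrary operations that are
  compatible with a family of maps into compact-open spaces. The cutoff has to be flat because the
  local section jumps by a power of \<open>gamma\<close> at the missing point: the product is smooth
  there only if all derivatives of the cutoff vanish. Such a cutoff is not invertible, and this is
  what localization repairs: modulo 1 - t z the variable t is an inverse of z, so the class of t
  times a weight section plays the role of its quotient by z. The two missing points are half a
  period apart, whence the constant 1/2. Rotations move points out of every fixed chart of the
  torus. Their continuity is therefore proved on the universal covering, where they become
  translations of the plane.\<close>

lemma topspace_initial_topology [simp]: "topspace (initial_topology S I F T) = S"
  unfolding initial_topology_def by auto

lemma continuous_map_initial_topology:
  assumes "i \<in> I" "F i \<in> S \<rightarrow> topspace (T i)"
  shows "continuous_map (initial_topology S I F T) (T i) (F i)"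
proof -
  have "openin (initial_topology S I F T) {x \<in> S. F i x \<in> U}" if "openin (T i) U" for U
  proof -
    have "{x \<in> S. F i x \<in> U} = F i -` U \<inter> S" by auto
    then show ?thesis
      unfolding initial_topology_def using that assms(1)
      by (intro topology_generated_by_Basis) blast
  qed
  then show ?thesis
    using assms(2) by (auto simp: continuous_map)
qed

text \<open>The universal property of the initial topology. It reduces every continuity claim into
  \<open>smooth_algebra\<close> or \<open>section_algebra\<close> to one about single tangent maps
  or local representatives.\<close>

lemma continuous_map_into_initial_topology:
  assumes "g \<in> topspace Z \<rightarrow> S" "\<And>i. i \<in> I \<Longrightarrow> continuous_map Z (T i) (\<lambda>z. F i (g z))"
  shows "continuous_map Z (initial_topology S I F T) g"
  unfolding initial_topology_def
proof (rule continuous_on_generated_topo)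
  fix U assume "U \<in> insert S {F i -` U \<inter> S |i U. i \<in> I \<and> openin (T i) U}"
  then consider "U = S" | i V where "i \<in> I" "openin (T i) V" "U = F i -` V \<inter> S" by auto
  then show "openin Z (g -` U \<inter> topspace Z)"
  proof cases
    case 1
    then have "g -` U \<inter> topspace Z = topspace Z" using assms(1) by auto
    then show ?thesis by simp
  next
    case 2
    then have "g -` U \<inter> topspace Z = {z \<in> topspace Z. F i (g z) \<in> V}" using assms(1) by auto
    then show ?thesis
      using openin_continuous_map_preimage[OF assms(2)[OF 2(1)] 2(2)] by simp
  qed
next
  show "g ` topspace Z \<subseteq> \<Union> (insert S {F i -` U \<inter> S |i U. i \<in> I \<and> openin (T i) U})"
    using assms(1) by auto
qed

definition cont_maps :: "'a topology \<Rightarrow> 'b topology \<Rightarrow> ('a \<Rightarrow> 'b) set" where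
  "cont_maps X Y = {f \<in> extensional (topspace X). continuous_map X Y f}"

lemma topspace_compact_open [simp]: "topspace (compact_open X Y) = cont_maps X Y"
proof -
  \<comment> \<open>Taking \<open>K = {}\<close> makes the subbasic set all of C(X, Y), so the
    generated topology has exactly these maps as its points.\<close>
  have "cont_maps X Y \<in> {{f \<in> extensional (topspace X). continuous_map X Y f \<and> f ` K \<subseteq> W} | K W.
          compactin X K \<and> openin Y W}"
    unfolding cont_maps_def by (rule CollectI, rule exI[of _ "{}"], rule exI[of _ "{}"]) auto
  then show ?thesis
    unfolding compact_open_def topology_generated_by_topspace cont_maps_def by blast
qed

lemma openin_compact_open:
  assumes "compactin X K" "openin Y W"
  shows "openin (compact_open X Y) {f \<in> cont_maps X Y. f ` K \<subseteq> W}"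
  unfolding compact_open_def cont_maps_def
  by (rule topology_generated_by_Basis) (use assms in auto)

lemma continuous_map_into_compact_open:
  assumes "g \<in> topspace Z \<rightarrow> cont_maps X Y"
    and "\<And>K W. compactin X K \<Longrightarrow> openin Y W \<Longrightarrow> openin Z {z \<in> topspace Z. g z ` K \<subseteq> W}"
  shows "continuous_map Z (compact_open X Y) g"
  unfolding compact_open_def
proof (rule continuous_on_generated_topo)
  fix U assume "U \<in> {{f \<in> extensional (topspace X). continuous_map X Y f \<and> f ` K \<subseteq> W} |K W.
      compactin X K \<and> openin Y W}"
  then obtain K W where KW: "compactin X K" "openin Y W"
    "U = {f \<in> extensional (topspace X). continuous_map X Y f \<and> f ` K \<subseteq> W}" by blast
  then have "g -` U \<inter> topspace Z = {z \<in> topspace Z. g z ` K \<subseteq> W}"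
    using assms(1) by (auto simp: cont_maps_def)
  then show "openin Z (g -` U \<inter> topspace Z)" using assms(2) KW by simp
next
  show "g ` topspace Z \<subseteq> \<Union> {{f \<in> extensional (topspace X). continuous_map X Y f \<and> f ` K \<subseteq> W} |K W.
          compactin X K \<and> openin Y W}"
    using assms(1) topspace_compact_open[of X Y]
    unfolding compact_open_def topology_generated_by_topspace by auto
qed

lemma openin_preimage_compact_open:
  assumes "continuous_map Z (compact_open X Y) g" "compactin X K" "openin Y W"
  shows "openin Z {z \<in> topspace Z. g z ` K \<subseteq> W}"
proof -
  have "{z \<in> topspace Z. g z ` K \<subseteq> W} = {z \<in> topspace Z. g z \<in> {f \<in> cont_maps X Y. f ` K \<subseteq> W}}"
    using continuous_map_image_subset_topspace[OF assms(1)] by auto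
  then show ?thesis
    using openin_continuous_map_preimage[OF assms(1) openin_compact_open[OF assms(2,3)]] by simp
qed

lemma Hausdorff_compact_open:
  assumes "Hausdorff_space Y"
  shows "Hausdorff_space (compact_open X Y)"
  unfolding Hausdorff_space_def
proof (intro allI impI)
  fix f g assume "f \<in> topspace (compact_open X Y) \<and> g \<in> topspace (compact_open X Y) \<and> f \<noteq> g"
  then have fg: "f \<in> cont_maps X Y" "g \<in> cont_maps X Y" "f \<noteq> g" by auto
  then obtain x where x: "x \<in> topspace X" "f x \<noteq> g x"
    by (metis (mono_tags, lifting) cont_maps_def extensionalityI mem_Collect_eq)
  have "f x \<in> topspace Y" "g x \<in> topspace Y"
    using fg x unfolding cont_maps_def continuous_map_def by auto
  then obtain U V where UV: "openin Y U" "openin Y V" "f x \<in> U" "g x \<in> V" "disjnt U V"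
    using assms x unfolding Hausdorff_space_def by blast
  \<comment> \<open>Singletons are compact, so evaluation at \<open>x\<close> already separates
    \<open>f\<close> and \<open>g\<close>.\<close>
  show "\<exists>U V. openin (compact_open X Y) U \<and> openin (compact_open X Y) V \<and> f \<in> U \<and> g \<in> V \<and> disjnt U V"
    using UV fg x
    by (intro exI[of _ "{f \<in> cont_maps X Y. f ` {x} \<subseteq> U}"] exI[of _ "{f \<in> cont_maps X Y. f ` {x} \<subseteq> V}"]
        conjI openin_compact_open) (auto simp: disjnt_iff)
qed

text \<open>A compact Hausdorff space is regular, so every point of \<open>K\<close> has a closed
  neighbourhood in \<open>K\<close> inside its open set, and finitely many of these cover. Closed
  pieces of \<open>K\<close> are compact, which lets a finite intersection of subbasic sets of the
  compact-open topology use different open sets on different pieces.\<close>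

lemma compact_cover_refine:
  assumes X: "Hausdorff_space X" and K: "compactin X K"
    and U: "\<And>x. x \<in> K \<Longrightarrow> openin X (U x) \<and> x \<in> U x"
  shows "\<exists>D C. finite D \<and> D \<subseteq> K \<and> (\<forall>x\<in>D. compactin X (C x) \<and> C x \<subseteq> U x \<inter> K) \<and> K = (\<Union>x\<in>D. C x)"
proof -
  let ?K = "subtopology X K"
  have KX: "K \<subseteq> topspace X" using K compactin_subset_topspace by blast
  have cK: "compact_space ?K" using K by (simp add: compact_space_subtopology)
  have reg: "regular_space ?K"
    using cK X by (simp add: Hausdorff_space_subtopology compact_Hausdorff_imp_regular_space)
  have "\<exists>V C. openin ?K V \<and> closedin ?K C \<and> x \<in> V \<and> V \<subseteq> C \<and> C \<subseteq> U x \<inter> K" if "x \<in> K" for x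
  proof -
    have "openin ?K (U x \<inter> K)" "x \<in> U x \<inter> K"
      using U[OF that] that by (auto simp: openin_subtopology)
    then show ?thesis
      using reg unfolding neighbourhood_base_of_closedin[symmetric] neighbourhood_base_of
      by blast
  qed
  then obtain V C where VC: "\<And>x. x \<in> K \<Longrightarrow> openin ?K (V x) \<and> closedin ?K (C x) \<and> x \<in> V x \<and> V x \<subseteq> C x \<and> C x \<subseteq> U x \<inter> K"
    by metis
  have "compactin ?K K" using cK KX by (simp add: compact_space_def Int_absorb1)
  moreover have "\<forall>W\<in>V ` K. openin ?K W" "K \<subseteq> \<Union>(V ` K)" using VC by auto
  ultimately obtain \<F> where F: "finite \<F>" "\<F> \<subseteq> V ` K" "K \<subseteq> \<Union>\<F>"
    unfolding compactin_def by meson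
  then obtain D where D: "D \<subseteq> K" "finite D" "\<F> = V ` D"
    by (meson finite_subset_image)
  show ?thesis
  proof (intro exI[of _ D] exI[of _ C] conjI ballI)
    show "finite D" "D \<subseteq> K" by fact+
    show "compactin X (C x)" "C x \<subseteq> U x \<inter> K" if "x \<in> D" for x
    proof -
      have "x \<in> K" using D that by auto
      then have "closedin ?K (C x)" using VC by auto
      then have "compactin ?K (C x)" using cK closedin_compact_space by blast
      then show "compactin X (C x)" "C x \<subseteq> U x \<inter> K"
        using VC[OF \<open>x \<in> K\<close>] by (simp_all add: compactin_subtopology)
    qed
    show "K = (\<Union>x\<in>D. C x)"
    proof
      show "K \<subseteq> (\<Union>x\<in>D. C x)"
        using F(3) D VC by (fastforce simp: subset_iff)
      show "(\<Union>x\<in>D. C x) \<subseteq> K" using D VC by auto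
    qed
  qed
qed

text \<open>Around each point of \<open>K\<close> the operation \<open>m\<close> maps a product of
  neighbourhoods \<open>A x\<close> and \<open>B x\<close> into \<open>W\<close>. Cutting
  \<open>K\<close> into compact pieces, each served by one such pair, leaves finitely many subbasic
  conditions on \<open>u z\<close> and \<open>v z\<close>.\<close>

lemma continuous_map_compact_open_comp2:
  assumes X: "Hausdorff_space X" and m: "continuous_map (prod_topology Y1 Y2) Y (\<lambda>(a, b). m a b)"
    and u: "continuous_map Z (compact_open X Y1) u" and v: "continuous_map Z (compact_open X Y2) v"
  shows "continuous_map Z (compact_open X Y) (\<lambda>z. \<lambda>x\<in>topspace X. m (u z x) (v z x))"
proof (rule continuous_map_into_compact_open)
  have uZ: "continuous_map X Y1 (u z)" and vZ: "continuous_map X Y2 (v z)" if "z \<in> topspace Z" for z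
    using continuous_map_image_subset_topspace[OF u] continuous_map_image_subset_topspace[OF v] that
    by (auto simp: cont_maps_def)
  show "(\<lambda>z. \<lambda>x\<in>topspace X. m (u z x) (v z x)) \<in> topspace Z \<rightarrow> cont_maps X Y"
  proof
    fix z assume z: "z \<in> topspace Z"
    have "continuous_map X (prod_topology Y1 Y2) (\<lambda>x. (u z x, v z x))"
      using uZ[OF z] vZ[OF z] by (rule continuous_map_pairedI)
    from continuous_map_compose[OF this m]
    have "continuous_map X Y (\<lambda>x. m (u z x) (v z x))" by (simp add: o_def)
    then show "(\<lambda>x\<in>topspace X. m (u z x) (v z x)) \<in> cont_maps X Y"
      unfolding cont_maps_def by (auto elim: continuous_map_eq)
  qed
  fix K W assume K: "compactin X K" and W: "openin Y W"
  have KX: "K \<subseteq> topspace X" using K compactin_subset_topspace by blast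
  show "openin Z {z \<in> topspace Z. (\<lambda>x\<in>topspace X. m (u z x) (v z x)) ` K \<subseteq> W}" (is "openin Z ?G")
  proof (subst openin_subopen, intro ballI)
    fix z0 assume z0G: "z0 \<in> ?G"
    then have z0: "z0 \<in> topspace Z" and mW: "\<And>x. x \<in> K \<Longrightarrow> m (u z0 x) (v z0 x) \<in> W"
      using KX by (auto simp: image_subset_iff subset_iff)
    have oP: "openin (prod_topology Y1 Y2) {p \<in> topspace (prod_topology Y1 Y2). (\<lambda>(a, b). m a b) p \<in> W}"
      using openin_continuous_map_preimage[OF m W] .
    have "\<exists>A B. openin Y1 A \<and> openin Y2 B \<and> u z0 x \<in> A \<and> v z0 x \<in> B \<and> (\<forall>a\<in>A. \<forall>b\<in>B. m a b \<in> W)"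
      if "x \<in> K" for x
    proof -
      have "u z0 x \<in> topspace Y1" "v z0 x \<in> topspace Y2"
        using uZ[OF z0] vZ[OF z0] that KX unfolding continuous_map_def by auto
      then have "(u z0 x, v z0 x) \<in> {p \<in> topspace (prod_topology Y1 Y2). (\<lambda>(a, b). m a b) p \<in> W}"
        using mW[OF that] by auto
      then show ?thesis
        using oP unfolding openin_prod_topology_alt by (fastforce simp: subset_iff)
    qed
    then obtain A B where AB: "\<And>x. x \<in> K \<Longrightarrow> openin Y1 (A x) \<and> openin Y2 (B x) \<and> u z0 x \<in> A x \<and> v z0 x \<in> B x
        \<and> (\<forall>a\<in>A x. \<forall>b\<in>B x. m a b \<in> W)" by metis
    let ?U = "\<lambda>x. {y \<in> topspace X. u z0 y \<in> A x} \<inter> {y \<in> topspace X. v z0 y \<in> B x}"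
    have Uo: "openin X (?U x) \<and> x \<in> ?U x" if "x \<in> K" for x
      using AB[OF that] that KX openin_continuous_map_preimage[OF uZ[OF z0]]
        openin_continuous_map_preimage[OF vZ[OF z0]] by (auto intro!: openin_Int)
    obtain D C where DC: "finite D \<and> D \<subseteq> K \<and> (\<forall>x\<in>D. compactin X (C x) \<and> C x \<subseteq> ?U x \<inter> K) \<and> K = (\<Union>x\<in>D. C x)"
      using compact_cover_refine[of X K ?U, OF X K Uo] by blast
    then have D: "finite D" "D \<subseteq> K" and C: "\<And>x. x \<in> D \<Longrightarrow> compactin X (C x) \<and> C x \<subseteq> ?U x \<inter> K"
      and KC: "K = (\<Union>x\<in>D. C x)" by blast+
    let ?T = "topspace Z \<inter> (\<Inter>x\<in>D. {z \<in> topspace Z. u z ` C x \<subseteq> A x} \<inter> {z \<in> topspace Z. v z ` C x \<subseteq> B x})"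
    have "openin Z ?T"
    \<comment> \<open>The intersection over an empty index set is the whole type, not an open set of
      \<open>Z\<close>; the factor \<open>topspace Z\<close> in \<open>?T\<close> covers that
      case.\<close>
    proof (cases "D = {}")
      case False
      then show ?thesis
        using D C AB openin_preimage_compact_open[OF u] openin_preimage_compact_open[OF v]
        by (intro openin_Int openin_INT2) (auto simp: subset_iff)
    qed simp
    moreover have "z0 \<in> ?T" using z0 C by fastforce
    moreover have "?T \<subseteq> ?G"
    proof
      fix z assume z: "z \<in> ?T"
      have "m (u z x) (v z x) \<in> W" if "x \<in> K" for x
      proof -
        obtain y where y: "y \<in> D" "x \<in> C y" using KC \<open>x \<in> K\<close> by blast
        then have "u z x \<in> A y" "v z x \<in> B y" using z by auto
        then show ?thesis using AB[of y] y D by blast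
      qed
      then show "z \<in> ?G" using z KX by auto
    qed
    ultimately show "\<exists>T. openin Z T \<and> z0 \<in> T \<and> T \<subseteq> ?G" by blast
  qed
qed

text \<open>Lets a parameter enter as a constant map: scalars and group elements then act on C(X, Y)
  through the pointwise lemma for two maps.\<close>

lemma continuous_map_compact_open_const:
  assumes "continuous_map Z P p"
  shows "continuous_map Z (compact_open X P) (\<lambda>z. \<lambda>x\<in>topspace X. p z)"
proof (rule continuous_map_into_compact_open)
  show "(\<lambda>z. \<lambda>x\<in>topspace X. p z) \<in> topspace Z \<rightarrow> cont_maps X P"
  proof
    fix z assume "z \<in> topspace Z"
    then have "continuous_map X P (\<lambda>x. p z)"
      using assms by (auto simp: continuous_map_def)
    then show "(\<lambda>x\<in>topspace X. p z) \<in> cont_maps X P"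
      unfolding cont_maps_def by (auto elim: continuous_map_eq)
  qed
  fix K W assume K: "compactin X K" and W: "openin P W"
  have "K \<subseteq> topspace X" using K compactin_subset_topspace by blast
  then have "{z \<in> topspace Z. (\<lambda>x\<in>topspace X. p z) ` K \<subseteq> W} = (if K = {} then topspace Z else {z \<in> topspace Z. p z \<in> W})"
    by (auto simp: image_subset_iff subset_iff)
  then show "openin Z {z \<in> topspace Z. (\<lambda>x\<in>topspace X. p z) ` K \<subseteq> W}"
    using openin_continuous_map_preimage[OF assms W] by simp
qed

text \<open>Joint continuity rests on a compact neighbourhood of the parameter. Since
  \<open>s\<close> ranges over a Euclidean space, a closed ball times \<open>K\<close> has a compact
  image \<open>?L\<close>, and asking that \<open>h\<close> maps \<open>?L\<close> into
  \<open>W\<close> controls all nearby parameters at once. It is applied to translations of the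
  plane.\<close>

lemma continuous_map_compact_open_precomp:
  fixes \<sigma> :: "'s::euclidean_space \<Rightarrow> 'x \<Rightarrow> 'y"
  assumes \<sigma>: "continuous_map (prod_topology euclidean X') X (\<lambda>(s, x). \<sigma> s x)"
  shows "continuous_map (prod_topology euclidean (compact_open X Y)) (compact_open X' Y)
           (\<lambda>(s, h). \<lambda>x\<in>topspace X'. h (\<sigma> s x))"
proof (rule continuous_map_into_compact_open)
  have \<sigma>s: "continuous_map X' X (\<sigma> s)" for s
  proof -
    have "continuous_map X' (prod_topology euclidean X') (\<lambda>x. (s, x))"
      by (intro continuous_map_pairedI) auto
    from continuous_map_compose[OF this \<sigma>] show ?thesis by (simp add: o_def)
  qed
  show "(\<lambda>(s, h). \<lambda>x\<in>topspace X'. h (\<sigma> s x))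
    \<in> topspace (prod_topology euclidean (compact_open X Y)) \<rightarrow> cont_maps X' Y"
    using continuous_map_compose[OF \<sigma>s]
    by (auto simp: cont_maps_def o_def elim!: continuous_map_eq)
  fix K W assume K: "compactin X' K" and W: "openin Y W"
  have KX: "K \<subseteq> topspace X'" using K compactin_subset_topspace by blast
  let ?Z = "prod_topology (euclidean::'s topology) (compact_open X Y)"
  show "openin ?Z {z \<in> topspace ?Z. (case z of (s, h) \<Rightarrow> \<lambda>x\<in>topspace X'. h (\<sigma> s x)) ` K \<subseteq> W}"
    (is "openin _ ?G")
    unfolding openin_prod_topology_alt
  proof (intro allI impI)
    fix s0 h0 assume sh: "(s0, h0) \<in> ?G"
    then have h0: "h0 \<in> cont_maps X Y" and hW: "\<And>x. x \<in> K \<Longrightarrow> h0 (\<sigma> s0 x) \<in> W"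
      using KX by (auto simp: image_subset_iff subset_iff)
    then have h0c: "continuous_map X Y h0" by (simp add: cont_maps_def)
    have c: "continuous_map (prod_topology euclidean X') Y (\<lambda>(s, x). h0 (\<sigma> s x))"
      using continuous_map_compose[OF \<sigma> h0c] by (simp add: o_def case_prod_unfold)
    have "openin (prod_topology euclidean X') {p \<in> topspace (prod_topology euclidean X'). (\<lambda>(s, x). h0 (\<sigma> s x)) p \<in> W}"
      (is "openin _ ?Q") using openin_continuous_map_preimage[OF c W] .
    note Q = this
    have Q': "{s0} \<times> K \<subseteq> ?Q" using hW KX by auto
    have Q'': "compactin euclidean {s0}" by simp
    \<comment> \<open>The tube lemma: a neighbourhood of the slice over \<open>s0\<close> contains a
      product neighbourhood of it.\<close>
    obtain U V where UV: "openin euclidean U" "openin X' V" "{s0} \<subseteq> U" "K \<subseteq> V" "U \<times> V \<subseteq> ?Q"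
      by (rule Wallace_theorem_prod_topology[OF Q'' K Q Q']) (rule that, blast+)
    then obtain e where e: "e > 0" "cball s0 e \<subseteq> U" using open_contains_cball[of U] by auto
    let ?L = "(\<lambda>(s, x). \<sigma> s x) ` (cball s0 e \<times> K)"
    have "compactin (prod_topology euclidean X') (cball s0 e \<times> K)"
      using K by (simp add: compactin_Times)
    then have L: "compactin X ?L" using image_compactin \<sigma> by blast
    let ?H = "{h \<in> cont_maps X Y. h ` ?L \<subseteq> W}"
    have "openin (compact_open X Y) ?H" using openin_compact_open[OF L W] .
    moreover have "h0 \<in> ?H" using h0 e UV by (auto simp: subset_iff)
    moreover have "ball s0 e \<times> ?H \<subseteq> ?G"
    proof
      fix q assume "q \<in> ball s0 e \<times> ?H"
      then obtain s h where q: "q = (s, h)" "s \<in> ball s0 e" "h \<in> cont_maps X Y" "h ` ?L \<subseteq> W" by auto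
      have "h (\<sigma> s x) \<in> W" if x: "x \<in> K" for x
      proof -
        have "(s, x) \<in> cball s0 e \<times> K" using q(2) x by auto
        then have "\<sigma> s x \<in> ?L" by force
        then show ?thesis using q(4) by blast
      qed
      then show "q \<in> ?G" using q KX by (auto simp: image_subset_iff)
    qed
    moreover have "s0 \<in> ball s0 e" "openin euclidean (ball s0 e)" using e by auto
    ultimately show "\<exists>U V. openin euclidean U \<and> openin (compact_open X Y) V \<and> s0 \<in> U \<and> h0 \<in> V \<and> U \<times> V \<subseteq> ?G"
      by blast
  qed
qed


section \<open>Locally convex structures on initial topologies\<close>

text \<open>\<open>convex_in\<close> without its carrier condition and without a record, so that it
  applies to the operations on tangent spaces and on spaces of maps.\<close>

definition convex_wrt :: "('b \<Rightarrow> 'b \<Rightarrow> 'b) \<Rightarrow> (complex \<Rightarrow> 'b \<Rightarrow> 'b) \<Rightarrow> 'b set \<Rightarrow> bool" where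
  "convex_wrt p s W \<longleftrightarrow> (\<forall>x\<in>W. \<forall>y\<in>W. \<forall>t::real. 0 \<le> t \<longrightarrow> t \<le> 1 \<longrightarrow>
     p (s (complex_of_real (1 - t)) x) (s (complex_of_real t) y) \<in> W)"

lemma convex_wrt_Int: "convex_wrt p s V \<Longrightarrow> convex_wrt p s W \<Longrightarrow> convex_wrt p s (V \<inter> W)"
  unfolding convex_wrt_def by auto

definition convex_base :: "'b topology \<Rightarrow> 'b \<Rightarrow> ('b \<Rightarrow> 'b \<Rightarrow> 'b) \<Rightarrow> (complex \<Rightarrow> 'b \<Rightarrow> 'b) \<Rightarrow> bool" where
  "convex_base Y z p s \<longleftrightarrow>
     (\<forall>U. openin Y U \<and> z \<in> U \<longrightarrow> (\<exists>W. openin Y W \<and> z \<in> W \<and> W \<subseteq> U \<and> convex_wrt p s W))"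

text \<open>Finite intersections of convex sets are convex, so it is enough to find convex
  neighbourhoods inside subbasic sets.\<close>

lemma convex_base_generated:
  assumes "\<And>U. U \<in> \<S> \<Longrightarrow> z \<in> U \<Longrightarrow>
      \<exists>W. openin (topology_generated_by \<S>) W \<and> z \<in> W \<and> W \<subseteq> U \<and> convex_wrt p s W"
  shows "convex_base (topology_generated_by \<S>) z p s"
  unfolding convex_base_def
proof (intro allI impI, elim conjE)
  fix U assume "openin (topology_generated_by \<S>) U" "z \<in> U"
  from openin_topology_generated_by[OF this(1)] this(2)
  show "\<exists>W. openin (topology_generated_by \<S>) W \<and> z \<in> W \<and> W \<subseteq> U \<and> convex_wrt p s W"
  proof induction
    case (Int a b)
    then obtain V W where "openin (topology_generated_by \<S>) V" "z \<in> V" "V \<subseteq> a" "convex_wrt p s V"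
      "openin (topology_generated_by \<S>) W" "z \<in> W" "W \<subseteq> b" "convex_wrt p s W" by auto
    then show ?case
      by (intro exI[of _ "V \<inter> W"]) (auto intro: convex_wrt_Int openin_Int)
  next
    case (UN K)
    then obtain k where k: "k \<in> K" "z \<in> k" by auto
    then show ?case using UN(2)[OF k] by blast
  qed (use assms in auto)
qed

text \<open>The purely topological part of \<open>lc_algebra\<close>, for operations that need not form a ring:
  the maps \<open>m\<close> arising on tangent spaces below are only used through their continuity.\<close>

definition lc_operations ::
  "'b topology \<Rightarrow> 'b \<Rightarrow> ('b \<Rightarrow> 'b \<Rightarrow> 'b) \<Rightarrow> (complex \<Rightarrow> 'b \<Rightarrow> 'b) \<Rightarrow> ('b \<Rightarrow> 'b \<Rightarrow> 'b) \<Rightarrow> bool" where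
  "lc_operations Y z p s m \<longleftrightarrow>
     z \<in> topspace Y \<and> Hausdorff_space Y \<and>
     continuous_map (prod_topology Y Y) Y (\<lambda>(x, y). p x y) \<and>
     continuous_map (prod_topology euclidean Y) Y (\<lambda>(c, x). s c x) \<and>
     continuous_map (prod_topology Y Y) Y (\<lambda>(x, y). m x y) \<and>
     convex_base Y z p s"

text \<open>Only the sum and the scalar multiplication are taken componentwise. The product
  \<open>m\<close> stays free because the product on iterated tangent spaces mixes the
  components.\<close>

lemma lc_operations_product:
  assumes Y: "lc_operations Y z p s m0" and I: "finite I"
    and m: "continuous_map (prod_topology (product_topology (\<lambda>_. Y) I) (product_topology (\<lambda>_. Y) I))
              (product_topology (\<lambda>_. Y) I) (\<lambda>(x, y). m x y)"
  shows "lc_operations (product_topology (\<lambda>_. Y) I) (\<lambda>i\<in>I. z) (\<lambda>f g. \<lambda>i\<in>I. p (f i) (g i))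
           (\<lambda>c f. \<lambda>i\<in>I. s c (f i)) m"
  unfolding lc_operations_def
proof (intro conjI m)
  let ?P = "product_topology (\<lambda>_. Y) I"
  note Y' = Y[unfolded lc_operations_def]
  show "(\<lambda>i\<in>I. z) \<in> topspace ?P" using Y' by auto
  show "Hausdorff_space ?P" using Y' by (simp add: Hausdorff_space_product_topology)
  have c1: "continuous_map (prod_topology ?P ?P) Y (\<lambda>x. fst x i)"
    and c2: "continuous_map (prod_topology ?P ?P) Y (\<lambda>x. snd x i)" if "i \<in> I" for i
    using that continuous_map_compose[OF continuous_map_fst continuous_map_product_projection[OF that, of "\<lambda>_. Y"]]
      continuous_map_compose[OF continuous_map_snd continuous_map_product_projection[OF that, of "\<lambda>_. Y"]]
    by (auto simp: o_def)
  have "continuous_map (prod_topology ?P ?P) Y (\<lambda>x. p (fst x i) (snd x i))" if "i \<in> I" for i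
    using continuous_map_compose[OF continuous_map_pairedI[OF c1 c2, OF that that], of Y "\<lambda>(x, y). p x y"] Y'
    by (simp add: o_def)
  then show "continuous_map (prod_topology ?P ?P) ?P (\<lambda>(x, y). \<lambda>i\<in>I. p (x i) (y i))"
    by (auto simp: continuous_map_componentwise case_prod_unfold)
  let ?E = "prod_topology (euclidean :: complex topology) ?P"
  have c3: "continuous_map ?E Y (\<lambda>x. snd x i)" if "i \<in> I" for i
    using continuous_map_compose[OF continuous_map_snd continuous_map_product_projection[OF that, of "\<lambda>_. Y"]]
    by (auto simp: o_def)
  have "continuous_map ?E Y (\<lambda>x. s (fst x) (snd x i))" if "i \<in> I" for i
    using continuous_map_compose[OF continuous_map_pairedI[OF continuous_map_fst c3, OF that], of Y "\<lambda>(x, y). s x y"] Y'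
    by (simp add: o_def)
  then show "continuous_map ?E ?P (\<lambda>(c, x). \<lambda>i\<in>I. s c (x i))"
    by (auto simp: continuous_map_componentwise case_prod_unfold)
  show "convex_base ?P (\<lambda>i\<in>I. z) (\<lambda>f g. \<lambda>i\<in>I. p (f i) (g i)) (\<lambda>c f. \<lambda>i\<in>I. s c (f i))"
    unfolding convex_base_def
  proof (intro allI impI, elim conjE)
    fix U assume U: "openin ?P U" "(\<lambda>i\<in>I. z) \<in> U"
    then obtain V where V: "\<forall>i\<in>I. openin Y (V i)" "(\<lambda>i\<in>I. z) \<in> Pi\<^sub>E I V" "Pi\<^sub>E I V \<subseteq> U"
      unfolding openin_product_topology_alt by meson
    have "\<forall>i\<in>I. \<exists>W. openin Y W \<and> z \<in> W \<and> W \<subseteq> V i \<and> convex_wrt p s W"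
      using Y' V unfolding convex_base_def by (auto simp: PiE_iff)
    then obtain W where W: "\<And>i. i \<in> I \<Longrightarrow> openin Y (W i) \<and> z \<in> W i \<and> W i \<subseteq> V i \<and> convex_wrt p s (W i)"
      by metis
    show "\<exists>W. openin ?P W \<and> (\<lambda>i\<in>I. z) \<in> W \<and> W \<subseteq> U \<and>
        convex_wrt (\<lambda>f g. \<lambda>i\<in>I. p (f i) (g i)) (\<lambda>c f. \<lambda>i\<in>I. s c (f i)) W"
    proof (intro exI[of _ "Pi\<^sub>E I W"] conjI)
      show "openin ?P (Pi\<^sub>E I W)" using W I by (simp add: openin_PiE_gen)
      show "(\<lambda>i\<in>I. z) \<in> Pi\<^sub>E I W" using W by auto
      show "Pi\<^sub>E I W \<subseteq> U" using W V(3) by (blast dest: PiE_mono)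
      show "convex_wrt (\<lambda>f g. \<lambda>i\<in>I. p (f i) (g i)) (\<lambda>c f. \<lambda>i\<in>I. s c (f i)) (Pi\<^sub>E I W)"
        using W unfolding convex_wrt_def by (auto simp: PiE_iff)
    qed
  qed
qed

lemma lc_operations_compact_open:
  assumes X: "Hausdorff_space X" and Y: "lc_operations Y z p s m"
  shows "lc_operations (compact_open X Y) (\<lambda>x\<in>topspace X. z) (\<lambda>f g. \<lambda>x\<in>topspace X. p (f x) (g x))
           (\<lambda>c f. \<lambda>x\<in>topspace X. s c (f x)) (\<lambda>f g. \<lambda>x\<in>topspace X. m (f x) (g x))"
  unfolding lc_operations_def
proof (intro conjI)
  let ?C = "compact_open X Y"
  note Y' = Y[unfolded lc_operations_def]
  have "continuous_map X Y (\<lambda>x. z)" using Y' by simp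
  then show z: "(\<lambda>x\<in>topspace X. z) \<in> topspace ?C"
    unfolding topspace_compact_open cont_maps_def by (auto elim: continuous_map_eq)
  show "Hausdorff_space ?C" using Y' Hausdorff_compact_open by blast
  show "continuous_map (prod_topology ?C ?C) ?C (\<lambda>(f, g). \<lambda>x\<in>topspace X. p (f x) (g x))"
    using continuous_map_compact_open_comp2[OF X _ continuous_map_fst continuous_map_snd] Y'
    unfolding case_prod_unfold by blast
  show "continuous_map (prod_topology ?C ?C) ?C (\<lambda>(f, g). \<lambda>x\<in>topspace X. m (f x) (g x))"
    using continuous_map_compact_open_comp2[OF X _ continuous_map_fst continuous_map_snd] Y'
    unfolding case_prod_unfold by blast
  have "continuous_map (prod_topology euclidean ?C) ?C
      (\<lambda>z. \<lambda>x\<in>topspace X. s ((\<lambda>x\<in>topspace X. fst z) x) (snd z x))"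
    by (rule continuous_map_compact_open_comp2[OF X _ continuous_map_compact_open_const[OF continuous_map_fst]
          continuous_map_snd]) (use Y' in auto)
  then show "continuous_map (prod_topology euclidean ?C) ?C (\<lambda>(c, f). \<lambda>x\<in>topspace X. s c (f x))"
    by (rule continuous_map_eq) auto
  show "convex_base ?C (\<lambda>x\<in>topspace X. z) (\<lambda>f g. \<lambda>x\<in>topspace X. p (f x) (g x))
     (\<lambda>c f. \<lambda>x\<in>topspace X. s c (f x))"
    unfolding compact_open_def
  proof (rule convex_base_generated, unfold compact_open_def[symmetric])
    let ?z = "\<lambda>x\<in>topspace X. z"
    fix U assume "U \<in> {{f \<in> extensional (topspace X). continuous_map X Y f \<and> f ` K \<subseteq> W} |K W.
      compactin X K \<and> openin Y W}" and zU: "?z \<in> U"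
    then obtain K W where KW: "compactin X K" "openin Y W" "U = {f \<in> cont_maps X Y. f ` K \<subseteq> W}"
      unfolding cont_maps_def by blast
    have KX: "K \<subseteq> topspace X" using KW compactin_subset_topspace by blast
    \<comment> \<open>For empty \<open>K\<close> the subbasic set says nothing about
      \<open>W\<close>, and \<open>W\<close> may fail to contain \<open>z\<close>; any convex
      neighbourhood of \<open>z\<close> then serves.\<close>
    obtain W' where W': "openin Y W'" "z \<in> W'" "K = {} \<or> W' \<subseteq> W" "convex_wrt p s W'"
    proof (cases "K = {}")
      case True
      then show ?thesis using that Y' unfolding convex_base_def by (metis openin_topspace)
    next
      case False
      then have "z \<in> W" using zU KX KW(3) by (auto simp: image_subset_iff subset_iff)
      then show ?thesis using that Y' KW unfolding convex_base_def by metis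
    qed
    have cl: "(\<lambda>x\<in>topspace X. p ((\<lambda>x\<in>topspace X. s a (f x)) x) ((\<lambda>x\<in>topspace X. s b (g x)) x)) \<in> cont_maps X Y"
      if "f \<in> cont_maps X Y" "g \<in> cont_maps X Y" for f g a b
    proof -
      have f: "continuous_map X Y f" "continuous_map X Y g" using that by (auto simp: cont_maps_def)
      have sc: "continuous_map X Y (\<lambda>x. s a (f x))" if "continuous_map X Y f" for f a
        using continuous_map_compose[OF continuous_map_pairedI[OF _ that], of euclidean "\<lambda>_. a" Y "\<lambda>(x, y). s x y"] Y'
        by (simp add: o_def)
      have "continuous_map X Y (\<lambda>x. p (s a (f x)) (s b (g x)))"
        using continuous_map_compose[OF continuous_map_pairedI[OF sc[OF f(1)] sc[OF f(2)]], of Y "\<lambda>(x, y). p x y"] Y'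
        by (simp add: o_def)
      then show ?thesis unfolding cont_maps_def by (auto elim: continuous_map_eq)
    qed
    show "\<exists>W. openin ?C W \<and> ?z \<in> W \<and> W \<subseteq> U \<and> convex_wrt (\<lambda>f g. \<lambda>x\<in>topspace X. p (f x) (g x))
     (\<lambda>c f. \<lambda>x\<in>topspace X. s c (f x)) W"
    proof (intro exI[of _ "{f \<in> cont_maps X Y. f ` K \<subseteq> W'}"] conjI)
      show "openin ?C {f \<in> cont_maps X Y. f ` K \<subseteq> W'}" using openin_compact_open KW W' by blast
      show "?z \<in> {f \<in> cont_maps X Y. f ` K \<subseteq> W'}" using z W' KX by auto
      show "{f \<in> cont_maps X Y. f ` K \<subseteq> W'} \<subseteq> U" using KW(3) W' by auto
      show "convex_wrt (\<lambda>f g. \<lambda>x\<in>topspace X. p (f x) (g x)) (\<lambda>c f. \<lambda>x\<in>topspace X. s c (f x))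
         {f \<in> cont_maps X Y. f ` K \<subseteq> W'}"
        unfolding convex_wrt_def
      proof (intro ballI allI impI CollectI conjI)
        fix f g and t :: real
        assume f: "f \<in> {f \<in> cont_maps X Y. f ` K \<subseteq> W'}" and g: "g \<in> {f \<in> cont_maps X Y. f ` K \<subseteq> W'}"
          and t: "0 \<le> t" "t \<le> 1"
        show "(\<lambda>x\<in>topspace X. p ((\<lambda>x\<in>topspace X. s (complex_of_real (1 - t)) (f x)) x)
                ((\<lambda>x\<in>topspace X. s (complex_of_real t) (g x)) x)) \<in> cont_maps X Y"
          using cl f g by simp
        show "(\<lambda>x\<in>topspace X. p ((\<lambda>x\<in>topspace X. s (complex_of_real (1 - t)) (f x)) x)
                ((\<lambda>x\<in>topspace X. s (complex_of_real t) (g x)) x)) ` K \<subseteq> W'"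
          using W'(4) f g t KX unfolding convex_wrt_def by (auto simp: subset_iff image_subset_iff)
      qed
    qed
  qed
qed

text \<open>Each \<open>F i\<close> is a homomorphism for the operations \<open>P i\<close>,
  \<open>Q i\<close> and \<open>M i\<close>, so continuity and convex neighbourhoods are pulled back
  from the spaces \<open>T i\<close>; joint injectivity of the family gives the Hausdorff
  property.\<close>

lemma lc_operations_initial:
  assumes Y: "\<And>i. i \<in> I \<Longrightarrow> lc_operations (T i) (F i z) (P i) (Q i) (M i)"
    and F: "\<And>i. i \<in> I \<Longrightarrow> F i \<in> S \<rightarrow> topspace (T i)"
    and inj: "\<And>x y. x \<in> S \<Longrightarrow> y \<in> S \<Longrightarrow> (\<And>i. i \<in> I \<Longrightarrow> F i x = F i y) \<Longrightarrow> x = y"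
    and z: "z \<in> S" and p: "\<And>x y. x \<in> S \<Longrightarrow> y \<in> S \<Longrightarrow> p x y \<in> S"
    and s: "\<And>c x. x \<in> S \<Longrightarrow> s c x \<in> S" and m: "\<And>x y. x \<in> S \<Longrightarrow> y \<in> S \<Longrightarrow> m x y \<in> S"
    and Fp: "\<And>i x y. i \<in> I \<Longrightarrow> x \<in> S \<Longrightarrow> y \<in> S \<Longrightarrow> F i (p x y) = P i (F i x) (F i y)"
    and Fs: "\<And>i c x. i \<in> I \<Longrightarrow> x \<in> S \<Longrightarrow> F i (s c x) = Q i c (F i x)"
    and Fm: "\<And>i x y. i \<in> I \<Longrightarrow> x \<in> S \<Longrightarrow> y \<in> S \<Longrightarrow> F i (m x y) = M i (F i x) (F i y)"
  shows "lc_operations (initial_topology S I F T) z p s m"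
  unfolding lc_operations_def
proof (intro conjI)
  let ?X = "initial_topology S I F T"
  have Fc: "continuous_map ?X (T i) (F i)" if "i \<in> I" for i
    using continuous_map_initial_topology[where F = F and i = i and S = S and T = T, OF that] F[OF that] by blast
  show "z \<in> topspace ?X" using z by simp
  show "Hausdorff_space ?X"
    unfolding Hausdorff_space_def
  proof (intro allI impI)
    fix x y assume "x \<in> topspace ?X \<and> y \<in> topspace ?X \<and> x \<noteq> y"
    then have xy: "x \<in> S" "y \<in> S" "x \<noteq> y" by auto
    then obtain i where i: "i \<in> I" "F i x \<noteq> F i y" using inj by blast
    then obtain U V where UV: "openin (T i) U" "openin (T i) V" "F i x \<in> U" "F i y \<in> V" "disjnt U V"
    proof -
      have "Hausdorff_space (T i)" using Y[OF i(1)] unfolding lc_operations_def by auto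
      moreover have "F i x \<in> topspace (T i)" "F i y \<in> topspace (T i)" using F[OF i(1)] xy by auto
      ultimately show ?thesis using that i(2) unfolding Hausdorff_space_def by blast
    qed
    show "\<exists>U V. openin ?X U \<and> openin ?X V \<and> x \<in> U \<and> y \<in> V \<and> disjnt U V"
      using openin_continuous_map_preimage[OF Fc[OF i(1)] UV(1)] openin_continuous_map_preimage[OF Fc[OF i(1)] UV(2)]
        UV xy by (intro exI[of _ "{x \<in> topspace ?X. F i x \<in> U}"] exI[of _ "{x \<in> topspace ?X. F i x \<in> V}"])
          (auto simp: disjnt_iff)
  qed
  have c1: "continuous_map (prod_topology ?X ?X) (prod_topology (T i) (T i)) (\<lambda>x. (F i (fst x), F i (snd x)))"
    if "i \<in> I" for i
    using continuous_map_compose[OF continuous_map_fst Fc[OF that]]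
      continuous_map_compose[OF continuous_map_snd Fc[OF that]]
    by (intro continuous_map_pairedI) (auto simp: o_def)
  have c2: "continuous_map (prod_topology euclidean ?X) (prod_topology euclidean (T i)) (\<lambda>x. (fst x, F i (snd x)))"
    if "i \<in> I" for i
    using continuous_map_compose[OF continuous_map_snd Fc[OF that]]
    by (intro continuous_map_pairedI continuous_map_fst) (auto simp: o_def)
  show "continuous_map (prod_topology ?X ?X) ?X (\<lambda>(x, y). p x y)"
  proof (rule continuous_map_into_initial_topology)
    fix i assume i: "i \<in> I"
    have "continuous_map (prod_topology (T i) (T i)) (T i) (\<lambda>(x, y). P i x y)"
      using Y[OF i] unfolding lc_operations_def by auto
    from continuous_map_compose[OF c1[OF i] this]
    show "continuous_map (prod_topology ?X ?X) (T i) (\<lambda>x. F i (case x of (x, y) \<Rightarrow> p x y))"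
      by (rule continuous_map_eq) (auto simp: Fp i)
  qed (use p in auto)
  show "continuous_map (prod_topology ?X ?X) ?X (\<lambda>(x, y). m x y)"
  proof (rule continuous_map_into_initial_topology)
    fix i assume i: "i \<in> I"
    have "continuous_map (prod_topology (T i) (T i)) (T i) (\<lambda>(x, y). M i x y)"
      using Y[OF i] unfolding lc_operations_def by auto
    from continuous_map_compose[OF c1[OF i] this]
    show "continuous_map (prod_topology ?X ?X) (T i) (\<lambda>x. F i (case x of (x, y) \<Rightarrow> m x y))"
      by (rule continuous_map_eq) (auto simp: Fm i)
  qed (use m in auto)
  show "continuous_map (prod_topology euclidean ?X) ?X (\<lambda>(c, x). s c x)"
  proof (rule continuous_map_into_initial_topology)
    fix i assume i: "i \<in> I"
    have "continuous_map (prod_topology euclidean (T i)) (T i) (\<lambda>(x, y). Q i x y)"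
      using Y[OF i] unfolding lc_operations_def by auto
    from continuous_map_compose[OF c2[OF i] this]
    show "continuous_map (prod_topology euclidean ?X) (T i) (\<lambda>x. F i (case x of (c, x) \<Rightarrow> s c x))"
      by (rule continuous_map_eq) (auto simp: Fs i)
  qed (use s in auto)
  show "convex_base ?X z p s"
    unfolding initial_topology_def
  proof (rule convex_base_generated, unfold initial_topology_def[symmetric])
    fix U assume "U \<in> insert S {F i -` U \<inter> S |i U. i \<in> I \<and> openin (T i) U}" and zU: "z \<in> U"
    then consider "U = S" | i V where "i \<in> I" "openin (T i) V" "U = F i -` V \<inter> S" by auto
    then show "\<exists>W. openin ?X W \<and> z \<in> W \<and> W \<subseteq> U \<and> convex_wrt p s W"
    proof cases
      case 1
      have "openin ?X S" using openin_topspace[of ?X] by simp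
      then show ?thesis using 1 z p s by (intro exI[of _ S]) (auto simp: convex_wrt_def)
    next
      case 2
      then obtain W where W: "openin (T i) W" "F i z \<in> W" "W \<subseteq> V" "convex_wrt (P i) (Q i) W"
        using Y[OF 2(1)] zU unfolding lc_operations_def convex_base_def by auto
      have "convex_wrt p s {x \<in> topspace ?X. F i x \<in> W}"
        using W(4) unfolding convex_wrt_def by (auto simp: p s Fp[OF 2(1)] Fs[OF 2(1)])
      then show ?thesis
        using openin_continuous_map_preimage[OF Fc[OF 2(1)] W(1)] W 2 z
        by (intro exI[of _ "{x \<in> topspace ?X. F i x \<in> W}"]) auto
    qed
  qed
qed

section \<open>Calculus in locally convex algebras\<close>

lemma continuous_map_comp2:
  assumes "continuous_map (prod_topology X Y) T (\<lambda>(x, y). m x y)" "continuous_map Z X u" "continuous_map Z Y v"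
  shows "continuous_map Z T (\<lambda>z. m (u z) (v z))"
  using continuous_map_compose[OF continuous_map_pairedI[OF assms(2,3)] assms(1)] by (simp add: o_def)

lemma limitin_continuous_compose:
  assumes "continuous_map X Y g" "limitin X f l F"
  shows "limitin Y (\<lambda>t. g (f t)) (g l) F"
  using continuous_map_limit[OF assms] by (simp add: o_def)

lemma limitin_comp2:
  assumes "continuous_map (prod_topology X Y) T (\<lambda>(x, y). m x y)" "limitin X f a F" "limitin Y g b F"
  shows "limitin T (\<lambda>t. m (f t) (g t)) (m a b) F"
  using limitin_continuous_compose[OF assms(1), of "\<lambda>t. (f t, g t)" "(a, b)"] assms(2,3)
  by (simp add: limitin_pairwise o_def)

text \<open>The derivative of a curve at 0. A directional derivative is one along a straight line,
  so all differentiation rules are proved for curves only.\<close>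

definition path_deriv :: "('a, 'm) top_algebra_scheme \<Rightarrow> (real \<Rightarrow> 'a) \<Rightarrow> 'a \<Rightarrow> bool" where
  "path_deriv E \<phi> l \<longleftrightarrow>
     limitin (topol E) (\<lambda>t. complex_of_real (1 / t) \<odot>\<^bsub>E\<^esub> (\<phi> t \<ominus>\<^bsub>E\<^esub> \<phi> 0)) l (at 0)"

lemma has_dir_deriv_path: "has_dir_deriv E F x v l \<longleftrightarrow> path_deriv E (\<lambda>t. F (\<lambda>j. x j + t *\<^sub>R v j)) l"
  by (simp add: has_dir_deriv_def path_deriv_def)

lemma eventually_nhds_0: "eventually P (nhds (0::real)) \<longleftrightarrow> P 0 \<and> eventually P (at 0)"
  by (auto simp: eventually_nhds_conv_at)

text \<open>The filter is \<open>nhds 0\<close> rather than \<open>at 0\<close> because the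
  difference quotient also involves the value at 0 itself.\<close>

lemma path_deriv_cong:
  assumes "eventually (\<lambda>t. \<phi> t = \<psi> t) (nhds 0)"
  shows "path_deriv E \<phi> l \<longleftrightarrow> path_deriv E \<psi> l"
proof -
  have "path_deriv E \<psi> l" if "path_deriv E \<phi> l" "eventually (\<lambda>t. \<phi> t = \<psi> t) (nhds 0)" for \<phi> \<psi>
  proof -
    have 0: "\<phi> 0 = \<psi> 0" and "\<forall>\<^sub>F t in at 0. \<phi> t = \<psi> t"
      using that(2) unfolding eventually_nhds_0 by blast+
    from this(2) have "\<forall>\<^sub>F t in at 0. complex_of_real (1 / t) \<odot>\<^bsub>E\<^esub> (\<phi> t \<ominus>\<^bsub>E\<^esub> \<phi> 0)
        = complex_of_real (1 / t) \<odot>\<^bsub>E\<^esub> (\<psi> t \<ominus>\<^bsub>E\<^esub> \<psi> 0)"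
      by eventually_elim (simp add: 0)
    from limitin_transform_eventually[OF this that(1)[unfolded path_deriv_def]]
    show ?thesis unfolding path_deriv_def .
  qed
  moreover have "eventually (\<lambda>t. \<psi> t = \<phi> t) (nhds 0)"
    using assms by eventually_elim simp
  ultimately show ?thesis using assms by blast
qed

lemma eventually_line_in_open:
  fixes a b :: "'v::euclidean_space"
  assumes "open V" "a \<in> V"
  shows "\<forall>\<^sub>F t in nhds 0. a + t *\<^sub>R b \<in> V"
proof -
  have "isCont (\<lambda>t. a + t *\<^sub>R b) 0" by (intro continuous_intros)
  then have "((\<lambda>t. a + t *\<^sub>R b) \<longlongrightarrow> a) (nhds 0)"
    using continuous_at_imp_continuous_at_within tendsto_nhds_iff[of "\<lambda>t. a + t *\<^sub>R b" _ 0]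
    by (auto simp: isCont_def)
  then show ?thesis using assms topological_tendstoD by blast
qed

lemma has_dir_deriv_cong:
  fixes x :: "nat \<Rightarrow> 'v::euclidean_space"
  assumes V: "open V" "x 0 \<in> V" and eq: "\<And>y. y 0 \<in> V \<Longrightarrow> F y = G y"
  shows "has_dir_deriv E F x v l \<longleftrightarrow> has_dir_deriv E G x v l"
  unfolding has_dir_deriv_path
proof (rule path_deriv_cong)
  show "\<forall>\<^sub>F t in nhds 0. F (\<lambda>j. x j + t *\<^sub>R v j) = G (\<lambda>j. x j + t *\<^sub>R v j)"
    using eventually_line_in_open[OF V, of "v 0"] by eventually_elim (simp add: eq)
qed

locale lc_alg =
  fixes E :: "('a, 'm) top_algebra_scheme" (structure)
  assumes lc: "lc_algebra E"
begin

sublocale ring E using lc unfolding lc_algebra_def by blast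

lemma module: "module complex_algebra E" using lc unfolding lc_algebra_def by blast

lemma smult_closed [simp]: "x \<in> carrier E \<Longrightarrow> c \<odot> x \<in> carrier E"
  using module.smult_closed[OF module, of c x] by (simp add: complex_algebra_def)

lemma smult_l_distr: "x \<in> carrier E \<Longrightarrow> (c + d) \<odot> x = c \<odot> x \<oplus> d \<odot> x"
  using module.smult_l_distr[OF module, of c d x] by (simp add: complex_algebra_def)

lemma smult_r_distr: "x \<in> carrier E \<Longrightarrow> y \<in> carrier E \<Longrightarrow> c \<odot> (x \<oplus> y) = c \<odot> x \<oplus> c \<odot> y"
  using module.smult_r_distr[OF module, of c x y] by (simp add: complex_algebra_def)

lemma smult_smult: "x \<in> carrier E \<Longrightarrow> c \<odot> (d \<odot> x) = (c * d) \<odot> x"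
  using module.smult_assoc1[OF module, of c d x] by (simp add: complex_algebra_def)

lemma smult_one [simp]: "x \<in> carrier E \<Longrightarrow> 1 \<odot> x = x"
  using module.smult_one[OF module, of x] by (simp add: complex_algebra_def)

lemma smult_l_null [simp]: "x \<in> carrier E \<Longrightarrow> 0 \<odot> x = \<zero>"
proof -
  assume x: "x \<in> carrier E"
  have "0 \<odot> x \<oplus> 0 \<odot> x = 0 \<odot> x" using smult_l_distr[OF x, of 0 0] by simp
  then show ?thesis using x add.l_cancel_one[of "0 \<odot> x" "0 \<odot> x"] by simp
qed

lemma smult_r_null [simp]: "c \<odot> \<zero> = \<zero>"
  by (metis smult_closed smult_l_null smult_smult zero_closed mult_zero_right)

lemma smult_minus_one: "x \<in> carrier E \<Longrightarrow> (- 1) \<odot> x = \<ominus> x"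
proof -
  assume x: "x \<in> carrier E"
  have "(- 1) \<odot> x \<oplus> x = \<zero>" using smult_l_distr[OF x, of "-1" 1] x by simp
  then show ?thesis using x by (metis minus_equality smult_closed)
qed

lemma smult_r_minus: "x \<in> carrier E \<Longrightarrow> y \<in> carrier E \<Longrightarrow> c \<odot> (x \<ominus> y) = c \<odot> x \<ominus> c \<odot> y"
  by (simp add: a_minus_def smult_r_distr smult_minus_one[symmetric] smult_smult)

lemma smult_mult: "x \<in> carrier E \<Longrightarrow> y \<in> carrier E \<Longrightarrow> (c \<odot> x) \<otimes> y = c \<odot> (x \<otimes> y)"
  "x \<in> carrier E \<Longrightarrow> y \<in> carrier E \<Longrightarrow> x \<otimes> (c \<odot> y) = c \<odot> (x \<otimes> y)"
  using lc unfolding lc_algebra_def by blast+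

lemma topspace_eq [simp]: "topspace (topol E) = carrier E"
  and Hausdorff: "Hausdorff_space (topol E)"
  and cont_add: "continuous_map (prod_topology (topol E) (topol E)) (topol E) (\<lambda>(x, y). x \<oplus> y)"
  and cont_smult: "continuous_map (prod_topology euclidean (topol E)) (topol E) (\<lambda>(c, x). c \<odot> x)"
  and cont_mult: "continuous_map (prod_topology (topol E) (topol E)) (topol E) (\<lambda>(x, y). x \<otimes> y)"
  using lc unfolding lc_algebra_def by blast+

lemma lc_operations: "lc_operations (topol E) \<zero> (add E) (smult E) (mult E)"
  unfolding lc_operations_def convex_base_def
proof (intro conjI allI impI Hausdorff cont_add cont_smult cont_mult)
  fix U assume "openin (topol E) U \<and> \<zero> \<in> U"
  then have "\<exists>W. openin (topol E) W \<and> \<zero> \<in> W \<and> W \<subseteq> U \<and> convex_in E W"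
    using lc unfolding lc_algebra_def by blast
  then obtain W where W: "openin (topol E) W" "\<zero> \<in> W" "W \<subseteq> U" "convex_in E W" by blast
  then have "convex_wrt (add E) (smult E) W" unfolding convex_in_def convex_wrt_def by blast
  then show "\<exists>W. openin (topol E) W \<and> \<zero> \<in> W \<and> W \<subseteq> U \<and> convex_wrt (add E) (smult E) W"
    using W by blast
qed simp

lemmas continuous_map_add = continuous_map_comp2[OF cont_add]
lemmas continuous_map_mult = continuous_map_comp2[OF cont_mult]
lemmas limitin_add = limitin_comp2[OF cont_add]
lemmas limitin_mult = limitin_comp2[OF cont_mult]
lemmas limitin_smult = limitin_comp2[OF cont_smult]

lemma continuous_map_smult:
  assumes "continuous_map Z (topol E) u"
  shows "continuous_map Z (topol E) (\<lambda>z. c \<odot> u z)"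
  using continuous_map_comp2[OF cont_smult, of Z "\<lambda>_. c"] assms by simp

lemma continuous_map_in_carrier: "continuous_map Z (topol E) u \<Longrightarrow> z \<in> topspace Z \<Longrightarrow> u z \<in> carrier E"
  by (auto simp: continuous_map_def)

lemma path_deriv_unique: "path_deriv E \<phi> l \<Longrightarrow> path_deriv E \<phi> l' \<Longrightarrow> l = l'"
  unfolding path_deriv_def using limitin_Hausdorff_unique[OF _ _ _ Hausdorff] by (metis at_neq_bot)

lemma path_deriv_closed: "path_deriv E \<phi> l \<Longrightarrow> l \<in> carrier E"
  unfolding path_deriv_def using limitin_topspace by force

lemma has_dir_deriv_unique: "has_dir_deriv E F x v l \<Longrightarrow> has_dir_deriv E F x v l' \<Longrightarrow> l = l'"
  unfolding has_dir_deriv_path by (rule path_deriv_unique)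

lemma has_dir_deriv_the: "has_dir_deriv E F x v l \<Longrightarrow> (THE l. has_dir_deriv E F x v l) = l"
  using has_dir_deriv_unique by blast

lemma path_deriv_const: "a \<in> carrier E \<Longrightarrow> path_deriv E (\<lambda>t. a) \<zero>"
  unfolding path_deriv_def by (simp add: r_neg a_minus_def)

lemma path_deriv_add:
  assumes f: "path_deriv E f a" "\<forall>\<^sub>F t in nhds 0. f t \<in> carrier E"
    and g: "path_deriv E g b" "\<forall>\<^sub>F t in nhds 0. g t \<in> carrier E"
  shows "path_deriv E (\<lambda>t. f t \<oplus> g t) (a \<oplus> b)"
  unfolding path_deriv_def
proof (rule limitin_transform_eventually[OF _ limitin_add[OF f(1)[unfolded path_deriv_def] g(1)[unfolded path_deriv_def]]])
  have 0: "f 0 \<in> carrier E" "g 0 \<in> carrier E" and "\<forall>\<^sub>F t in at 0. f t \<in> carrier E \<and> g t \<in> carrier E"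
    using f(2) g(2) unfolding eventually_nhds_0 by (auto intro: eventually_conj)
  then show "\<forall>\<^sub>F t in at 0. complex_of_real (1 / t) \<odot> (f t \<ominus> f 0) \<oplus> complex_of_real (1 / t) \<odot> (g t \<ominus> g 0)
      = complex_of_real (1 / t) \<odot> (f t \<oplus> g t \<ominus> (f 0 \<oplus> g 0))"
  proof (elim eventually_mono)
    fix t assume t: "f t \<in> carrier E \<and> g t \<in> carrier E"
    have "f t \<oplus> g t \<ominus> (f 0 \<oplus> g 0) = (f t \<ominus> f 0) \<oplus> (g t \<ominus> g 0)"
      using 0 t unfolding a_minus_def by (simp add: minus_add a_ac)
    then show "complex_of_real (1 / t) \<odot> (f t \<ominus> f 0) \<oplus> complex_of_real (1 / t) \<odot> (g t \<ominus> g 0)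
      = complex_of_real (1 / t) \<odot> (f t \<oplus> g t \<ominus> (f 0 \<oplus> g 0))"
      using 0 t by (simp add: smult_r_distr)
  qed
qed

text \<open>Multiplying the difference quotient by \<open>t\<close>, which tends to 0, recovers
  \<open>f t \<ominus> f 0\<close>.\<close>

lemma path_deriv_continuous:
  assumes f: "path_deriv E f a" "\<forall>\<^sub>F t in nhds 0. f t \<in> carrier E"
  shows "limitin (topol E) f (f 0) (at 0)"
proof -
  have f0: "f 0 \<in> carrier E" and ev: "\<forall>\<^sub>F t in at 0. f t \<in> carrier E"
    using f(2) unfolding eventually_nhds_0 by auto
  have "limitin euclidean (\<lambda>t::real. complex_of_real t) (complex_of_real 0) (at 0)"
    using tendsto_of_real[OF tendsto_ident_at[of 0 UNIV]] by simp
  from limitin_add[OF limitin_smult[OF this f(1)[unfolded path_deriv_def]], of "\<lambda>_. f 0" "f 0"]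
  have "limitin (topol E) (\<lambda>t. complex_of_real t \<odot> (complex_of_real (1 / t) \<odot> (f t \<ominus> f 0)) \<oplus> f 0) (f 0) (at 0)"
    using f0 path_deriv_closed[OF f(1)] by simp
  moreover have "\<forall>\<^sub>F t in at 0. complex_of_real t \<odot> (complex_of_real (1 / t) \<odot> (f t \<ominus> f 0)) \<oplus> f 0 = f t"
    using ev eventually_neq_at_within[of 0 0 UNIV]
  proof eventually_elim
    case (elim t)
    then have "complex_of_real t \<odot> (complex_of_real (1 / t) \<odot> (f t \<ominus> f 0)) = f t \<ominus> f 0"
      using f0 by (simp add: smult_smult flip: of_real_mult)
    then show ?case using elim f0 by (simp add: a_minus_def a_assoc l_neg)
  qed
  ultimately show ?thesis by (rule limitin_transform_eventually[rotated])
qed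

lemma path_deriv_mult:
  assumes f: "path_deriv E f a" "\<forall>\<^sub>F t in nhds 0. f t \<in> carrier E"
    and g: "path_deriv E g b" "\<forall>\<^sub>F t in nhds 0. g t \<in> carrier E"
  shows "path_deriv E (\<lambda>t. f t \<otimes> g t) (f 0 \<otimes> b \<oplus> a \<otimes> g 0)"
  unfolding path_deriv_def
proof (rule limitin_transform_eventually)
  have 0: "f 0 \<in> carrier E" "g 0 \<in> carrier E" and ev: "\<forall>\<^sub>F t in at 0. f t \<in> carrier E \<and> g t \<in> carrier E"
    using f(2) g(2) unfolding eventually_nhds_0 by (auto intro: eventually_conj)
  \<comment> \<open>The Leibniz splitting that keeps the order of the factors, since
    \<open>E\<close> need not be commutative; the factor \<open>g t\<close> converges because
    \<open>g\<close> is continuous at 0.\<close>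
  show "limitin (topol E) (\<lambda>t. f 0 \<otimes> (complex_of_real (1 / t) \<odot> (g t \<ominus> g 0)) \<oplus> (complex_of_real (1 / t) \<odot> (f t \<ominus> f 0)) \<otimes> g t)
      (f 0 \<otimes> b \<oplus> a \<otimes> g 0) (at 0)"
    using 0 f(1) g(1) path_deriv_continuous[OF g]
    by (intro limitin_add limitin_mult) (auto simp: path_deriv_def)
  show "\<forall>\<^sub>F t in at 0. f 0 \<otimes> (complex_of_real (1 / t) \<odot> (g t \<ominus> g 0)) \<oplus> (complex_of_real (1 / t) \<odot> (f t \<ominus> f 0)) \<otimes> g t
      = complex_of_real (1 / t) \<odot> (f t \<otimes> g t \<ominus> f 0 \<otimes> g 0)"
    using ev
  proof (elim eventually_mono)
    fix t assume t: "f t \<in> carrier E \<and> g t \<in> carrier E"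
    have c: "f 0 \<otimes> g t \<in> carrier E" "f 0 \<otimes> g 0 \<in> carrier E" "f t \<otimes> g t \<in> carrier E" using 0 t by auto
    have "f 0 \<otimes> (g t \<ominus> g 0) \<oplus> (f t \<ominus> f 0) \<otimes> g t = (f 0 \<otimes> g t \<oplus> \<ominus> (f 0 \<otimes> g 0)) \<oplus> (f t \<otimes> g t \<oplus> \<ominus> (f 0 \<otimes> g t))"
      using 0 t by (simp add: a_minus_def r_distr l_distr r_minus l_minus)
    also have "\<dots> = (f t \<otimes> g t \<oplus> \<ominus> (f 0 \<otimes> g 0)) \<oplus> (f 0 \<otimes> g t \<oplus> \<ominus> (f 0 \<otimes> g t))"
      using c by (simp only: a_ac a_inv_closed add.m_closed)
    also have "\<dots> = f t \<otimes> g t \<ominus> f 0 \<otimes> g 0"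
      using c by (simp add: r_neg a_minus_def)
    finally have "f 0 \<otimes> (g t \<ominus> g 0) \<oplus> (f t \<ominus> f 0) \<otimes> g t = f t \<otimes> g t \<ominus> f 0 \<otimes> g 0" .
    then show "f 0 \<otimes> (complex_of_real (1 / t) \<odot> (g t \<ominus> g 0)) \<oplus> (complex_of_real (1 / t) \<odot> (f t \<ominus> f 0)) \<otimes> g t
      = complex_of_real (1 / t) \<odot> (f t \<otimes> g t \<ominus> f 0 \<otimes> g 0)"
      using 0 t by (simp add: smult_mult smult_r_distr[symmetric])
  qed
qed

lemma path_deriv_linear:
  fixes E' :: "('b, 'n) top_algebra_scheme"
  assumes f: "path_deriv E f a" "\<forall>\<^sub>F t in nhds 0. f t \<in> carrier E"
    and L: "continuous_map (topol E) (topol E') L"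
      "\<And>x y. x \<in> carrier E \<Longrightarrow> y \<in> carrier E \<Longrightarrow> L (x \<ominus> y) = L x \<ominus>\<^bsub>E'\<^esub> L y"
      "\<And>c x. x \<in> carrier E \<Longrightarrow> L (c \<odot> x) = c \<odot>\<^bsub>E'\<^esub> L x"
  shows "path_deriv E' (\<lambda>t. L (f t)) (L a)"
  unfolding path_deriv_def
proof (rule limitin_transform_eventually[OF _ limitin_continuous_compose[OF L(1) f(1)[unfolded path_deriv_def]]])
  have 0: "f 0 \<in> carrier E" and "\<forall>\<^sub>F t in at 0. f t \<in> carrier E"
    using f(2) unfolding eventually_nhds_0 by auto
  then show "\<forall>\<^sub>F t in at 0. L (complex_of_real (1 / t) \<odot> (f t \<ominus> f 0)) = complex_of_real (1 / t) \<odot>\<^bsub>E'\<^esub> (L (f t) \<ominus>\<^bsub>E'\<^esub> L (f 0))"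
    by (elim eventually_mono) (simp add: L(2,3))
qed

lemma path_deriv_scalar:
  assumes c: "(c has_vector_derivative c') (at (0::real))" and a: "a \<in> carrier E"
  shows "path_deriv E (\<lambda>t. c t \<odot> a) (c' \<odot> a)"
  unfolding path_deriv_def
proof (rule limitin_transform_eventually)
  have "((\<lambda>t. norm (c t - c 0 - t *\<^sub>R c') / norm t) \<longlongrightarrow> 0) (at 0)"
    using c unfolding has_vector_derivative_def has_derivative_iff_norm by simp
  moreover have "\<forall>\<^sub>F t in at 0. norm (c t - c 0 - t *\<^sub>R c') / norm t = norm ((c t - c 0) /\<^sub>R t - c')"
    unfolding eventually_at_filter
  proof (intro always_eventually allI impI)
    fix t :: real assume "t \<noteq> 0"
    then have "(c t - c 0) /\<^sub>R t - c' = (c t - c 0 - t *\<^sub>R c') /\<^sub>R t"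
      by (simp add: scaleR_diff_right)
    then show "norm (c t - c 0 - t *\<^sub>R c') / norm t = norm ((c t - c 0) /\<^sub>R t - c')"
      by (simp only: norm_scaleR) (simp add: divide_inverse)
  qed
  ultimately have "((\<lambda>t. norm ((c t - c 0) /\<^sub>R t - c')) \<longlongrightarrow> 0) (at 0)"
    by (rule Lim_transform_eventually)
  then have "((\<lambda>t. (c t - c 0) /\<^sub>R t) \<longlongrightarrow> c') (at 0)"
    using tendsto_norm_zero_iff LIM_zero_iff by blast
  then show "limitin (topol E) (\<lambda>t. (complex_of_real (1 / t) * (c t - c 0)) \<odot> a) (c' \<odot> a) (at 0)"
    using a by (intro limitin_smult) (auto simp: scaleR_conv_of_real inverse_eq_divide)
  have "c t \<odot> a \<ominus> c 0 \<odot> a = (c t - c 0) \<odot> a" for t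
    using a smult_l_distr[OF a, of "c t" "- c 0"] smult_smult[OF a, of "-1" "c 0"]
    by (simp add: a_minus_def smult_minus_one)
  then show "\<forall>\<^sub>F t in at 0. (complex_of_real (1 / t) * (c t - c 0)) \<odot> a = complex_of_real (1 / t) \<odot> (c t \<odot> a \<ominus> c 0 \<odot> a)"
    using a by (simp add: smult_smult)
qed

end

section \<open>Iterated tangent maps and smoothness\<close>

lemma topspace_tangent_dom: "topspace (tangent_dom k V) = {w \<in> extensional {..<2 ^ k}. w 0 \<in> V}"
  by (auto simp: tangent_dom_def PiE_def)

lemma Hausdorff_tangent_dom: "Hausdorff_space (tangent_dom k V)"
  unfolding tangent_dom_def
  by (intro Hausdorff_space_subtopology) (simp add: Hausdorff_space_product_topology)

lemma continuous_map_tangent_dom_component: "continuous_map (tangent_dom k V) euclidean (\<lambda>w. w j)"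
proof (cases "j < 2 ^ k")
  case True
  then show ?thesis unfolding tangent_dom_def
    by (intro continuous_map_from_subtopology continuous_map_product_projection[where X = "\<lambda>_. euclidean"]) auto
next
  case False
  \<comment> \<open>Points of the domain are extensional, so a coordinate outside the index range is
    the constant \<open>undefined\<close>.\<close>
  then have "continuous_map (tangent_dom k V) euclidean (\<lambda>w. undefined :: 'a)" by simp
  then show ?thesis
    by (rule continuous_map_eq) (use False in \<open>auto simp: topspace_tangent_dom extensional_def\<close>)
qed

lemma continuous_map_into_tangent_dom:
  assumes "\<And>j. j < 2 ^ k \<Longrightarrow> continuous_map Z euclidean (\<lambda>z. u z j)" "\<And>z. z \<in> topspace Z \<Longrightarrow> u z 0 \<in> V"
  shows "continuous_map Z (tangent_dom k V) (\<lambda>z. \<lambda>j\<in>{..<2 ^ k}. u z j)"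
  unfolding tangent_dom_def
  by (rule continuous_map_into_subtopology) (use assms in \<open>auto simp: continuous_map_componentwise\<close>)

lemma openin_tangent_dom:
  assumes "open U"
  shows "openin (tangent_dom k V) {w \<in> topspace (tangent_dom k V). w 0 \<in> U}"
  using openin_continuous_map_preimage[OF continuous_map_tangent_dom_component] assms by auto

lemma tangent_dom_subset: "U \<subseteq> V \<Longrightarrow> tangent_dom k U = subtopology (tangent_dom k V) {w. w 0 \<in> U}"
  unfolding tangent_dom_def subtopology_subtopology by (rule arg_cong[where f = "subtopology _"]) auto

text \<open>Restricting a point to its \<open>2 ^ k\<close> coordinates must not change anything:
  points of \<open>tangent_dom\<close> are extensional, whereas the recursion evaluates level
  \<open>k\<close> at points carrying \<open>2 ^ Suc k\<close> coordinates and along lines through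
  them.\<close>

lemma tangent_map_cong:
  assumes "\<And>j. j < 2 ^ k \<Longrightarrow> w j = w' j" "i < 2 ^ k"
  shows "tangent_map E k f w i = tangent_map E k f w' i"
  using assms
proof (induction k arbitrary: w w' i)
  case (Suc k)
  show ?case
  proof (cases "i < 2 ^ k")
    case True
    have "tangent_map E k f w i = tangent_map E k f w' i"
      by (rule Suc.IH) (use Suc.prems True in auto)
    then show ?thesis using True by simp
  next
    case False
    then have i: "i - 2 ^ k < 2 ^ k" using Suc.prems(2) by auto
    have e1: "tangent_map E k f w (i - 2 ^ k) = tangent_map E k f w' (i - 2 ^ k)"
      by (rule Suc.IH) (use Suc.prems i in auto)
    have e2: "tangent_map E k f (\<lambda>j. w j + t *\<^sub>R w (j + 2 ^ k)) (i - 2 ^ k)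
      = tangent_map E k f (\<lambda>j. w' j + t *\<^sub>R w' (j + 2 ^ k)) (i - 2 ^ k)" for t
      by (rule Suc.IH) (use Suc.prems i in auto)
    have "has_dir_deriv E (\<lambda>x. tangent_map E k f x (i - 2 ^ k)) w (\<lambda>j. w (j + 2 ^ k)) =
      has_dir_deriv E (\<lambda>x. tangent_map E k f x (i - 2 ^ k)) w' (\<lambda>j. w' (j + 2 ^ k))"
      by (rule ext) (simp add: has_dir_deriv_def e1 e2)
    then show ?thesis using False by simp
  qed
qed simp

lemma has_dir_deriv_tangent_map_cong:
  assumes "\<And>j. j < 2 ^ Suc k \<Longrightarrow> w j = w' j" "i < 2 ^ k"
  shows "has_dir_deriv E (\<lambda>x. tangent_map E k f x i) w (\<lambda>j. w (j + 2 ^ k)) l \<longleftrightarrow>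
    has_dir_deriv E (\<lambda>x. tangent_map E k f x i) w' (\<lambda>j. w' (j + 2 ^ k)) l"
proof -
  have e1: "tangent_map E k f w i = tangent_map E k f w' i"
    by (rule tangent_map_cong) (use assms in auto)
  have e2: "tangent_map E k f (\<lambda>j. w j + t *\<^sub>R w (j + 2 ^ k)) i
      = tangent_map E k f (\<lambda>j. w' j + t *\<^sub>R w' (j + 2 ^ k)) i" for t
    by (rule tangent_map_cong) (use assms in auto)
  show ?thesis by (simp add: has_dir_deriv_def e1 e2)
qed

lemma continuous_map_tangent_map_ext:
  "continuous_map (tangent_dom k V) (tangent_cod k E) (tangent_map_ext E k V f) \<longleftrightarrow>
    (\<forall>i<2 ^ k. continuous_map (tangent_dom k V) (topol E) (\<lambda>w. tangent_map E k f w i))"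
proof -
  have "continuous_map (tangent_dom k V) (topol E) (\<lambda>w. tangent_map_ext E k V f w i) \<longleftrightarrow>
     continuous_map (tangent_dom k V) (topol E) (\<lambda>w. tangent_map E k f w i)" if "i < 2 ^ k" for i
    using that by (intro iffI; elim continuous_map_eq) (auto simp: tangent_map_ext_def)
  then show ?thesis
    unfolding tangent_cod_def continuous_map_componentwise
    by (auto simp: tangent_map_ext_def image_subset_iff)
qed

context lc_alg
begin

text \<open>Limits are unique, so the \<open>THE\<close> in the recursion must return the value that
  a proposed family \<open>H\<close> supplies. A closed formula for all tangent maps is thus
  verified by one differentiation rule.\<close>

lemma tangent_map_eqI:
  fixes V :: "'v::euclidean_space set" and H :: "nat \<Rightarrow> (nat \<Rightarrow> 'v) \<Rightarrow> nat \<Rightarrow> 'a"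
  assumes V: "open V"
    and H0: "\<And>w. w 0 \<in> V \<Longrightarrow> f (w 0) = H 0 w 0"
    and HS: "\<And>k w i. w 0 \<in> V \<Longrightarrow> i < 2 ^ k \<Longrightarrow> H (Suc k) w i = H k w i"
    and HD: "\<And>k w i. w 0 \<in> V \<Longrightarrow> i < 2 ^ k \<Longrightarrow>
      has_dir_deriv E (\<lambda>x. H k x i) w (\<lambda>j. w (j + 2 ^ k)) (H (Suc k) w (i + 2 ^ k))"
    and w: "w 0 \<in> V" and i: "i < 2 ^ k"
  shows "tangent_map E k f w i = H k w i"
  using w i
proof (induction k arbitrary: w i)
  case 0
  then show ?case using H0 by simp
next
  case (Suc k)
  show ?case
  proof (cases "i < 2 ^ k")
    case True
    then show ?thesis using Suc HS by simp
  next
    case False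
    then have i: "i - 2 ^ k < 2 ^ k" "i - 2 ^ k + 2 ^ k = i" using Suc.prems(2) by auto
    have "has_dir_deriv E (\<lambda>x. H k x (i - 2 ^ k)) w (\<lambda>j. w (j + 2 ^ k)) (H (Suc k) w i)"
      using HD[of w, OF Suc.prems(1) i(1)] i(2) by simp
    then have "has_dir_deriv E (\<lambda>x. tangent_map E k f x (i - 2 ^ k)) w (\<lambda>j. w (j + 2 ^ k)) (H (Suc k) w i)"
      using has_dir_deriv_cong[of V w, OF V Suc.prems(1), of "\<lambda>x. tangent_map E k f x (i - 2 ^ k)" "\<lambda>x. H k x (i - 2 ^ k)"] Suc.IH i(1) by auto
    then show ?thesis using False has_dir_deriv_the by simp
  qed
qed

lemma smooth_intoI:
  fixes V :: "'v::euclidean_space set" and H :: "nat \<Rightarrow> (nat \<Rightarrow> 'v) \<Rightarrow> nat \<Rightarrow> 'a"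
  assumes V: "open V"
    and H0: "\<And>w. w 0 \<in> V \<Longrightarrow> f (w 0) = H 0 w 0"
    and HS: "\<And>k w i. w 0 \<in> V \<Longrightarrow> i < 2 ^ k \<Longrightarrow> H (Suc k) w i = H k w i"
    and HD: "\<And>k w i. w 0 \<in> V \<Longrightarrow> i < 2 ^ k \<Longrightarrow>
      has_dir_deriv E (\<lambda>x. H k x i) w (\<lambda>j. w (j + 2 ^ k)) (H (Suc k) w (i + 2 ^ k))"
    and HC: "\<And>k i. i < 2 ^ k \<Longrightarrow> continuous_map (tangent_dom k V) (topol E) (\<lambda>w. H k w i)"
  shows "smooth_into E V f"
  unfolding smooth_into_def
proof (intro conjI allI ballI impI)
  note T = tangent_map_eqI[OF V H0 HS HD]
  show "f \<in> V \<rightarrow> carrier E"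
  proof
    fix x assume x: "x \<in> V"
    have "(\<lambda>j\<in>{..<2 ^ 0}. x) \<in> topspace (tangent_dom 0 V)" using x by (auto simp: topspace_tangent_dom)
    then have "H 0 (\<lambda>j\<in>{..<2 ^ 0}. x) 0 \<in> carrier E"
      using continuous_map_in_carrier[OF HC[of 0 0]] by simp
    then show "f x \<in> carrier E" using H0[of "\<lambda>j\<in>{..<2 ^ 0}. x"] x by simp
  qed
  fix k
  show "\<exists>l. has_dir_deriv E (\<lambda>x. tangent_map E k f x i) w (\<lambda>j. w (j + 2 ^ k)) l"
    if w: "w \<in> topspace (tangent_dom (Suc k) V)" and i: "i < 2 ^ k" for w i
  proof -
    have w0: "w 0 \<in> V" using w by (simp add: topspace_tangent_dom)
    have "has_dir_deriv E (\<lambda>x. tangent_map E k f x i) w (\<lambda>j. w (j + 2 ^ k)) (H (Suc k) w (i + 2 ^ k))"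
      using has_dir_deriv_cong[of V w, OF V w0, of "\<lambda>x. tangent_map E k f x i" "\<lambda>x. H k x i"] T i HD[of w, OF w0 i] by auto
    then show ?thesis by blast
  qed
  show "continuous_map (tangent_dom k V) (tangent_cod k E) (tangent_map_ext E k V f)"
    unfolding continuous_map_tangent_map_ext
  proof (intro allI impI)
    fix i :: nat assume i: "i < 2 ^ k"
    show "continuous_map (tangent_dom k V) (topol E) (\<lambda>w. tangent_map E k f w i)"
      by (rule continuous_map_eq[OF HC[OF i]]) (use T i in \<open>auto simp: topspace_tangent_dom\<close>)
  qed
qed

text \<open>The existence clause of \<open>smooth_into\<close> speaks of extensional points only.
  Restricting to the relevant coordinates extends it to every \<open>w\<close> with
  \<open>w 0 \<in> V\<close>, in particular to the points of a line.\<close>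

lemma
  fixes V :: "'v::euclidean_space set"
  assumes f: "smooth_into E V f"
  shows smooth_into_closed: "x \<in> V \<Longrightarrow> f x \<in> carrier E"
    and smooth_into_cont: "i < 2 ^ k \<Longrightarrow> continuous_map (tangent_dom k V) (topol E) (\<lambda>w. tangent_map E k f w i)"
    and tangent_map_closed: "w 0 \<in> V \<Longrightarrow> i < 2 ^ k \<Longrightarrow> tangent_map E k f w i \<in> carrier E"
    and smooth_into_deriv: "w 0 \<in> V \<Longrightarrow> i < 2 ^ k \<Longrightarrow>
      has_dir_deriv E (\<lambda>x. tangent_map E k f x i) w (\<lambda>j. w (j + 2 ^ k)) (tangent_map E (Suc k) f w (i + 2 ^ k))"
proof -
  show "x \<in> V \<Longrightarrow> f x \<in> carrier E" using f by (auto simp: smooth_into_def)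
  show c: "continuous_map (tangent_dom k V) (topol E) (\<lambda>w. tangent_map E k f w i)" if "i < 2 ^ k" for i k
    using f that unfolding smooth_into_def continuous_map_tangent_map_ext by blast
  show "tangent_map E k f w i \<in> carrier E" if w: "w 0 \<in> V" and i: "i < 2 ^ k" for w
  proof -
    let ?w = "\<lambda>j\<in>{..<2 ^ k}. w j"
    have "?w \<in> topspace (tangent_dom k V)" using w by (auto simp: topspace_tangent_dom)
    from continuous_map_in_carrier[OF c[OF i] this] show ?thesis
      using tangent_map_cong[of k w ?w i E f] i by simp
  qed
  show "has_dir_deriv E (\<lambda>x. tangent_map E k f x i) w (\<lambda>j. w (j + 2 ^ k)) (tangent_map E (Suc k) f w (i + 2 ^ k))"
    if w: "w 0 \<in> V" and i: "i < 2 ^ k" for w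
  proof -
    let ?w = "\<lambda>j\<in>{..<2 ^ Suc k}. w j"
    have "?w \<in> topspace (tangent_dom (Suc k) V)" using w by (auto simp: topspace_tangent_dom)
    then obtain l where "has_dir_deriv E (\<lambda>x. tangent_map E k f x i) ?w (\<lambda>j. ?w (j + 2 ^ k)) l"
      using f i unfolding smooth_into_def by blast
    then have l: "has_dir_deriv E (\<lambda>x. tangent_map E k f x i) w (\<lambda>j. w (j + 2 ^ k)) l"
      using has_dir_deriv_tangent_map_cong[of k w ?w i E f l] i by simp
    then have "tangent_map E (Suc k) f w (i + 2 ^ k) = l" using has_dir_deriv_the by simp
    then show ?thesis using l by simp
  qed
qed

lemma tangent_map_eventually_closed:
  fixes V :: "'v::euclidean_space set"
  assumes "open V" "smooth_into E V f" "w 0 \<in> V" "i < 2 ^ k"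
  shows "\<forall>\<^sub>F t in nhds 0. tangent_map E k f (\<lambda>j. w j + t *\<^sub>R v j) i \<in> carrier E"
  using eventually_line_in_open[OF assms(1,3), of "v 0"]
  by eventually_elim (rule tangent_map_closed[OF assms(2)], use assms in auto)

text \<open>The tangent maps of \<open>f\<close> are themselves a valid family \<open>H\<close> for
  \<open>g\<close>, since only level 0 mentions the function.\<close>

lemma
  fixes V :: "'v::euclidean_space set"
  assumes V: "open V" and f: "smooth_into E V f" and fg: "\<And>x. x \<in> V \<Longrightarrow> f x = g x"
  shows smooth_into_cong: "smooth_into E V g"
    and tangent_map_cong_on: "w 0 \<in> V \<Longrightarrow> i < 2 ^ k \<Longrightarrow> tangent_map E k g w i = tangent_map E k f w i"
proof -
  show "smooth_into E V g"
    by (rule smooth_intoI[OF V, where H = "\<lambda>k. tangent_map E k f"])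
      (use fg smooth_into_deriv[OF f] smooth_into_cont[OF f] in auto)
  show "tangent_map E k g w i = tangent_map E k f w i" if "w 0 \<in> V" "i < 2 ^ k"
    by (rule tangent_map_eqI[OF V, where H = "\<lambda>k. tangent_map E k f"])
      (use that fg smooth_into_deriv[OF f] in auto)
qed

end

section \<open>Rules for iterated tangent maps\<close>

context lc_alg
begin

lemma smooth_into_tangentI:
  fixes V :: "'v::euclidean_space set" and H :: "nat \<Rightarrow> (nat \<Rightarrow> 'v) \<Rightarrow> nat \<Rightarrow> 'a"
  assumes "open V"
    and "\<And>w. w 0 \<in> V \<Longrightarrow> f (w 0) = H 0 w 0"
    and "\<And>k w i. w 0 \<in> V \<Longrightarrow> i < 2 ^ k \<Longrightarrow> H (Suc k) w i = H k w i"
    and "\<And>k w i. w 0 \<in> V \<Longrightarrow> i < 2 ^ k \<Longrightarrow>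
      has_dir_deriv E (\<lambda>x. H k x i) w (\<lambda>j. w (j + 2 ^ k)) (H (Suc k) w (i + 2 ^ k))"
    and "\<And>k i. i < 2 ^ k \<Longrightarrow> continuous_map (tangent_dom k V) (topol E) (\<lambda>w. H k w i)"
  shows "smooth_into E V f \<and> (\<forall>k w i. w 0 \<in> V \<longrightarrow> i < 2 ^ k \<longrightarrow> tangent_map E k f w i = H k w i)"
  using smooth_intoI[where V = V and f = f and H = H] tangent_map_eqI[where V = V and f = f and H = H] assms
  by blast

lemma
  fixes V :: "'v::euclidean_space set"
  assumes V: "open V" and a: "a \<in> carrier E"
  shows smooth_into_const: "smooth_into E V (\<lambda>x. a)"
    and tangent_map_const: "w 0 \<in> V \<Longrightarrow> i < 2 ^ k \<Longrightarrow> tangent_map E k (\<lambda>x. a) w i = (if i = 0 then a else \<zero>)"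
proof -
  have "smooth_into E V (\<lambda>x. a) \<and> (\<forall>k w i. w 0 \<in> V \<longrightarrow> i < 2 ^ k \<longrightarrow> tangent_map E k (\<lambda>x. a) w i
      = (\<lambda>k w i. if i = 0 then a else \<zero>) k w i)"
    by (rule smooth_into_tangentI[OF V]) (auto simp: a has_dir_deriv_path path_deriv_const)
  then show "smooth_into E V (\<lambda>x. a)"
    "w 0 \<in> V \<Longrightarrow> i < 2 ^ k \<Longrightarrow> tangent_map E k (\<lambda>x. a) w i = (if i = 0 then a else \<zero>)" by auto
qed

lemma
  fixes V :: "'v::euclidean_space set"
  assumes V: "open V" and f: "smooth_into E V f" and g: "smooth_into E V g"
  shows smooth_into_add: "smooth_into E V (\<lambda>x. f x \<oplus> g x)"
    and tangent_map_add: "w 0 \<in> V \<Longrightarrow> i < 2 ^ k \<Longrightarrow>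
      tangent_map E k (\<lambda>x. f x \<oplus> g x) w i = tangent_map E k f w i \<oplus> tangent_map E k g w i"
proof -
  have "smooth_into E V (\<lambda>x. f x \<oplus> g x) \<and> (\<forall>k w i. w 0 \<in> V \<longrightarrow> i < 2 ^ k \<longrightarrow>
    tangent_map E k (\<lambda>x. f x \<oplus> g x) w i = (\<lambda>k w i. tangent_map E k f w i \<oplus> tangent_map E k g w i) k w i)"
  proof (rule smooth_into_tangentI[OF V])
    fix k i :: nat assume i: "i < 2 ^ k"
    show "has_dir_deriv E (\<lambda>x. tangent_map E k f x i \<oplus> tangent_map E k g x i) w (\<lambda>j. w (j + 2 ^ k))
        (tangent_map E (Suc k) f w (i + 2 ^ k) \<oplus> tangent_map E (Suc k) g w (i + 2 ^ k))" if w: "w 0 \<in> V" for w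
      unfolding has_dir_deriv_path
      by (rule path_deriv_add[OF smooth_into_deriv[of V f w i k, OF f w i, unfolded has_dir_deriv_path]
            tangent_map_eventually_closed[of V f w i k, OF V f w i] smooth_into_deriv[of V g w i k, OF g w i, unfolded has_dir_deriv_path]
            tangent_map_eventually_closed[of V g w i k, OF V g w i]])
    show "continuous_map (tangent_dom k V) (topol E) (\<lambda>w. tangent_map E k f w i \<oplus> tangent_map E k g w i)"
      by (intro continuous_map_add smooth_into_cont f g i)
  qed auto
  then show "smooth_into E V (\<lambda>x. f x \<oplus> g x)" "w 0 \<in> V \<Longrightarrow> i < 2 ^ k \<Longrightarrow>
      tangent_map E k (\<lambda>x. f x \<oplus> g x) w i = tangent_map E k f w i \<oplus> tangent_map E k g w i" by auto
qed

text \<open>A continuous linear map commutes with difference quotients and their limits, so it acts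
  componentwise on every tangent level. Scalar multiples and automorphisms of the algebra are
  treated this way.\<close>

lemma
  fixes V :: "'v::euclidean_space set" and E' :: "('b, 'n) top_algebra_scheme"
  assumes V: "open V" and f: "smooth_into E V f" and E': "lc_algebra E'"
    and L: "continuous_map (topol E) (topol E') L"
      "\<And>x y. x \<in> carrier E \<Longrightarrow> y \<in> carrier E \<Longrightarrow> L (x \<ominus> y) = L x \<ominus>\<^bsub>E'\<^esub> L y"
      "\<And>c x. x \<in> carrier E \<Longrightarrow> L (c \<odot> x) = c \<odot>\<^bsub>E'\<^esub> L x"
  shows smooth_into_linear: "smooth_into E' V (\<lambda>x. L (f x))"
    and tangent_map_linear: "w 0 \<in> V \<Longrightarrow> i < 2 ^ k \<Longrightarrow>
      tangent_map E' k (\<lambda>x. L (f x)) w i = L (tangent_map E k f w i)"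
proof -
  interpret E': lc_alg E' by standard (rule E')
  have "smooth_into E' V (\<lambda>x. L (f x)) \<and> (\<forall>k w i. w 0 \<in> V \<longrightarrow> i < 2 ^ k \<longrightarrow>
    tangent_map E' k (\<lambda>x. L (f x)) w i = (\<lambda>k w i. L (tangent_map E k f w i)) k w i)"
  proof (rule E'.smooth_into_tangentI[OF V])
    fix k i :: nat assume i: "i < 2 ^ k"
    show "has_dir_deriv E' (\<lambda>x. L (tangent_map E k f x i)) w (\<lambda>j. w (j + 2 ^ k))
        (L (tangent_map E (Suc k) f w (i + 2 ^ k)))" if w: "w 0 \<in> V" for w
      unfolding has_dir_deriv_path
      by (rule path_deriv_linear[OF smooth_into_deriv[of V f w i k, OF f w i, unfolded has_dir_deriv_path]
            tangent_map_eventually_closed[of V f w i k, OF V f w i] L])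
    show "continuous_map (tangent_dom k V) (topol E') (\<lambda>w. L (tangent_map E k f w i))"
      using continuous_map_compose[OF smooth_into_cont[OF f i] L(1)] by (simp add: o_def)
  qed auto
  then show "smooth_into E' V (\<lambda>x. L (f x))" "w 0 \<in> V \<Longrightarrow> i < 2 ^ k \<Longrightarrow>
      tangent_map E' k (\<lambda>x. L (f x)) w i = L (tangent_map E k f w i)" by auto
qed

lemma
  fixes V :: "'v::euclidean_space set"
  assumes V: "open V" and f: "smooth_into E V f"
  shows smooth_into_smult: "smooth_into E V (\<lambda>x. c \<odot> f x)"
    and tangent_map_smult: "w 0 \<in> V \<Longrightarrow> i < 2 ^ k \<Longrightarrow>
      tangent_map E k (\<lambda>x. c \<odot> f x) w i = c \<odot> tangent_map E k f w i"
proof -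
  have L: "continuous_map (topol E) (topol E) (\<lambda>x. c \<odot> x)"
    by (intro continuous_map_smult continuous_map_id[unfolded id_def])
  show "smooth_into E V (\<lambda>x. c \<odot> f x)"
    by (rule smooth_into_linear[OF V f lc L]) (auto simp: smult_r_minus smult_smult mult.commute)
  show "tangent_map E k (\<lambda>x. c \<odot> f x) w i = c \<odot> tangent_map E k f w i" if "w 0 \<in> V" "i < 2 ^ k"
    by (rule tangent_map_linear[OF V f lc L]) (use that in \<open>auto simp: smult_r_minus smult_smult mult.commute\<close>)
qed

end

text \<open>The multiplication of the algebra \<open>T\<^sup>k E\<close>, that is, of \<open>E\<close> with \<open>k\<close> nilpotent
  elements of square zero adjoined.\<close>

primrec tangent_mult ::
  "('a, 'm) top_algebra_scheme \<Rightarrow> nat \<Rightarrow> (nat \<Rightarrow> 'a) \<Rightarrow> (nat \<Rightarrow> 'a) \<Rightarrow> nat \<Rightarrow> 'a" where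
  "tangent_mult E 0 u v i = u 0 \<otimes>\<^bsub>E\<^esub> v 0"
| "tangent_mult E (Suc k) u v i =
     (if i < 2 ^ k then tangent_mult E k u v i
      else tangent_mult E k u (\<lambda>j. v (j + 2 ^ k)) (i - 2 ^ k)
           \<oplus>\<^bsub>E\<^esub> tangent_mult E k (\<lambda>j. u (j + 2 ^ k)) v (i - 2 ^ k))"

lemma tangent_mult_cong:
  assumes "\<And>j. j < 2 ^ k \<Longrightarrow> u j = u' j" "\<And>j. j < 2 ^ k \<Longrightarrow> v j = v' j" "i < 2 ^ k"
  shows "tangent_mult E k u v i = tangent_mult E k u' v' i"
  using assms
proof (induction k arbitrary: u v u' v' i)
  case (Suc k)
  have 1: "tangent_mult E k u v i = tangent_mult E k u' v' i" if "i < 2 ^ k"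
    by (rule Suc.IH) (use Suc.prems that in auto)
  have 2: "tangent_mult E k u (\<lambda>j. v (j + 2 ^ k)) (i - 2 ^ k) = tangent_mult E k u' (\<lambda>j. v' (j + 2 ^ k)) (i - 2 ^ k)"
    if "\<not> i < 2 ^ k" by (rule Suc.IH) (use Suc.prems that in auto)
  have 3: "tangent_mult E k (\<lambda>j. u (j + 2 ^ k)) v (i - 2 ^ k) = tangent_mult E k (\<lambda>j. u' (j + 2 ^ k)) v' (i - 2 ^ k)"
    if "\<not> i < 2 ^ k" by (rule Suc.IH) (use Suc.prems that in auto)
  show ?case using 1 2 3 by simp
qed auto

context lc_alg
begin

lemma tangent_mult_closed:
  assumes "\<And>j. j < 2 ^ k \<Longrightarrow> u j \<in> carrier E" "\<And>j. j < 2 ^ k \<Longrightarrow> v j \<in> carrier E" "i < 2 ^ k"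
  shows "tangent_mult E k u v i \<in> carrier E"
  using assms by (induction k arbitrary: u v i) auto

lemma continuous_map_tangent_mult:
  assumes "\<And>j. j < 2 ^ k \<Longrightarrow> continuous_map Z (topol E) (\<lambda>z. u z j)"
    "\<And>j. j < 2 ^ k \<Longrightarrow> continuous_map Z (topol E) (\<lambda>z. v z j)" "i < 2 ^ k"
  shows "continuous_map Z (topol E) (\<lambda>z. tangent_mult E k (u z) (v z) i)"
  using assms
proof (induction k arbitrary: u v i)
  case 0
  then show ?case by (simp add: continuous_map_mult)
next
  case (Suc k)
  show ?case
  proof (cases "i < 2 ^ k")
    case True
    then show ?thesis using Suc by simp
  next
    case False
    then have i: "i - 2 ^ k < 2 ^ k" using Suc.prems by simp
    show ?thesis
      using False by (simp, intro continuous_map_add Suc.IH i) (use Suc.prems in auto)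
  qed
qed

text \<open>By the Leibniz rule the derivative is exactly the upper half of
  \<open>tangent_mult E (Suc k)\<close>; this is what makes \<open>tangent_mult\<close> the right
  product.\<close>

lemma path_deriv_tangent_mult:
  assumes "\<And>j. j < 2 ^ k \<Longrightarrow> path_deriv E (\<lambda>t. u t j) (u' j)"
    "\<And>j. j < 2 ^ k \<Longrightarrow> \<forall>\<^sub>F t in nhds 0. u t j \<in> carrier E"
    "\<And>j. j < 2 ^ k \<Longrightarrow> path_deriv E (\<lambda>t. v t j) (v' j)"
    "\<And>j. j < 2 ^ k \<Longrightarrow> \<forall>\<^sub>F t in nhds 0. v t j \<in> carrier E" "i < 2 ^ k"
  shows "path_deriv E (\<lambda>t. tangent_mult E k (u t) (v t) i)
      (tangent_mult E k (u 0) v' i \<oplus> tangent_mult E k u' (v 0) i)"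
  using assms
proof (induction k arbitrary: u v u' v' i)
  case 0
  then show ?case using path_deriv_mult[of "\<lambda>t. u t 0" "u' 0" "\<lambda>t. v t 0" "v' 0"] by simp
next
  case (Suc k)
  have lt: "j < 2 ^ Suc k" "j + 2 ^ k < 2 ^ Suc k" if "j < 2 ^ k" for j :: nat using that by auto
  have cl: "\<forall>\<^sub>F t in nhds 0. tangent_mult E k (a t) (b t) l \<in> carrier E"
    if "\<And>j. j < 2 ^ k \<Longrightarrow> \<forall>\<^sub>F t in nhds 0. a t j \<in> carrier E" "\<And>j. j < 2 ^ k \<Longrightarrow> \<forall>\<^sub>F t in nhds 0. b t j \<in> carrier E"
      "l < 2 ^ k" for a b :: "real \<Rightarrow> nat \<Rightarrow> 'a" and l
  proof -
    have "\<forall>\<^sub>F t in nhds 0. \<forall>j\<in>{..<2 ^ k}. a t j \<in> carrier E" "\<forall>\<^sub>F t in nhds 0. \<forall>j\<in>{..<2 ^ k}. b t j \<in> carrier E"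
      using that by (intro eventually_ball_finite; simp)+
    then show ?thesis by eventually_elim (rule tangent_mult_closed, use that in auto)
  qed
  show ?case
  proof (cases "i < 2 ^ k")
    case True
    have "path_deriv E (\<lambda>t. tangent_mult E k (u t) (v t) i)
      (tangent_mult E k (u 0) v' i \<oplus> tangent_mult E k u' (v 0) i)"
      by (rule Suc.IH) (use Suc.prems lt True in auto)
    then show ?thesis using True by simp
  next
    case False
    then have i: "i - 2 ^ k < 2 ^ k" using Suc.prems by simp
    let ?s = "\<lambda>w j. w (j + 2 ^ k)" and ?i = "i - 2 ^ k"
    have 1: "path_deriv E (\<lambda>t. tangent_mult E k (u t) (?s (v t)) ?i)
      (tangent_mult E k (u 0) (?s v') ?i \<oplus> tangent_mult E k u' (?s (v 0)) ?i)"
      by (rule Suc.IH[where v = "\<lambda>t. ?s (v t)" and v' = "?s v'"]) (use Suc.prems lt i in auto)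
    have 2: "path_deriv E (\<lambda>t. tangent_mult E k (?s (u t)) (v t) ?i)
      (tangent_mult E k (?s (u 0)) v' ?i \<oplus> tangent_mult E k (?s u') (v 0) ?i)"
      by (rule Suc.IH[where u = "\<lambda>t. ?s (u t)" and u' = "?s u'"]) (use Suc.prems lt i in auto)
    have 3: "\<forall>\<^sub>F t in nhds 0. tangent_mult E k (u t) (?s (v t)) ?i \<in> carrier E"
      by (rule cl[where b = "\<lambda>t. ?s (v t)"]) (use Suc.prems lt i in auto)
    have 4: "\<forall>\<^sub>F t in nhds 0. tangent_mult E k (?s (u t)) (v t) ?i \<in> carrier E"
      by (rule cl[where a = "\<lambda>t. ?s (u t)"]) (use Suc.prems lt i in auto)
    have u0: "u 0 j \<in> carrier E" "v 0 j \<in> carrier E" "u' j \<in> carrier E" "v' j \<in> carrier E" if "j < 2 ^ Suc k" for j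
      using Suc.prems(2,4)[OF that] path_deriv_closed[OF Suc.prems(1)[OF that]] path_deriv_closed[OF Suc.prems(3)[OF that]]
      unfolding eventually_nhds_0 by auto
    have c: "tangent_mult E k (u 0) (?s v') ?i \<in> carrier E" "tangent_mult E k u' (?s (v 0)) ?i \<in> carrier E"
      "tangent_mult E k (?s (u 0)) v' ?i \<in> carrier E" "tangent_mult E k (?s u') (v 0) ?i \<in> carrier E"
      by (rule tangent_mult_closed; use u0 lt i in auto)+
    show ?thesis
      using path_deriv_add[OF 1 3 2 4] False c by (simp add: a_ac)
  qed
qed

lemma
  fixes V :: "'v::euclidean_space set"
  assumes V: "open V" and f: "smooth_into E V f" and g: "smooth_into E V g"
  shows smooth_into_mult: "smooth_into E V (\<lambda>x. f x \<otimes> g x)"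
    and tangent_map_mult: "w 0 \<in> V \<Longrightarrow> i < 2 ^ k \<Longrightarrow>
      tangent_map E k (\<lambda>x. f x \<otimes> g x) w i = tangent_mult E k (tangent_map E k f w) (tangent_map E k g w) i"
proof -
  have "smooth_into E V (\<lambda>x. f x \<otimes> g x) \<and> (\<forall>k w i. w 0 \<in> V \<longrightarrow> i < 2 ^ k \<longrightarrow>
    tangent_map E k (\<lambda>x. f x \<otimes> g x) w i =
      (\<lambda>k w i. tangent_mult E k (tangent_map E k f w) (tangent_map E k g w) i) k w i)"
  proof (rule smooth_into_tangentI[OF V])
    fix k i :: nat assume i: "i < 2 ^ k"
    show "tangent_mult E (Suc k) (tangent_map E (Suc k) f w) (tangent_map E (Suc k) g w) i =
         tangent_mult E k (tangent_map E k f w) (tangent_map E k g w) i" for w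
      using i by (simp, intro tangent_mult_cong) auto
    show "has_dir_deriv E (\<lambda>x. tangent_mult E k (tangent_map E k f x) (tangent_map E k g x) i) w (\<lambda>j. w (j + 2 ^ k))
        (tangent_mult E (Suc k) (tangent_map E (Suc k) f w) (tangent_map E (Suc k) g w) (i + 2 ^ k))"
      if w: "w 0 \<in> V" for w
    proof -
      let ?p = "\<lambda>t j. w j + t *\<^sub>R w (j + 2 ^ k)"
      have "path_deriv E (\<lambda>t. tangent_mult E k (tangent_map E k f (?p t)) (tangent_map E k g (?p t)) i)
        (tangent_mult E k (tangent_map E k f (?p 0)) (\<lambda>j. tangent_map E (Suc k) g w (j + 2 ^ k)) i
         \<oplus> tangent_mult E k (\<lambda>j. tangent_map E (Suc k) f w (j + 2 ^ k)) (tangent_map E k g (?p 0)) i)"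
        by (rule path_deriv_tangent_mult[OF smooth_into_deriv[of V f w _ k, OF f w, unfolded has_dir_deriv_path]
            tangent_map_eventually_closed[of V f w _ k, OF V f w] smooth_into_deriv[of V g w _ k, OF g w, unfolded has_dir_deriv_path]
            tangent_map_eventually_closed[of V g w _ k, OF V g w]]) (use i in auto)
      \<comment> \<open>Level \<open>Suc k\<close> agrees with level \<open>k\<close> on the indices
        below \<open>2 ^ k\<close>, the only ones that the inner products read.\<close>
      moreover have "tangent_mult E (Suc k) (tangent_map E (Suc k) f w) (tangent_map E (Suc k) g w) (i + 2 ^ k) =
         tangent_mult E k (tangent_map E k f w) (\<lambda>j. tangent_map E (Suc k) g w (j + 2 ^ k)) i
         \<oplus> tangent_mult E k (\<lambda>j. tangent_map E (Suc k) f w (j + 2 ^ k)) (tangent_map E k g w) i"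
      proof -
        have "tangent_mult E k (tangent_map E (Suc k) f w) (\<lambda>j. tangent_map E (Suc k) g w (j + 2 ^ k)) i
          = tangent_mult E k (tangent_map E k f w) (\<lambda>j. tangent_map E (Suc k) g w (j + 2 ^ k)) i"
          by (rule tangent_mult_cong) (use i in auto)
        moreover have "tangent_mult E k (\<lambda>j. tangent_map E (Suc k) f w (j + 2 ^ k)) (tangent_map E (Suc k) g w) i
          = tangent_mult E k (\<lambda>j. tangent_map E (Suc k) f w (j + 2 ^ k)) (tangent_map E k g w) i"
          by (rule tangent_mult_cong) (use i in auto)
        ultimately show ?thesis by (simp only: tangent_mult.simps) simp
      qed
      ultimately show ?thesis unfolding has_dir_deriv_path by simp
    qed
    show "continuous_map (tangent_dom k V) (topol E) (\<lambda>w. tangent_mult E k (tangent_map E k f w) (tangent_map E k g w) i)"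
      by (intro continuous_map_tangent_mult smooth_into_cont f g i)
  qed auto
  then show "smooth_into E V (\<lambda>x. f x \<otimes> g x)" "w 0 \<in> V \<Longrightarrow> i < 2 ^ k \<Longrightarrow>
      tangent_map E k (\<lambda>x. f x \<otimes> g x) w i = tangent_mult E k (tangent_map E k f w) (tangent_map E k g w) i" by auto
qed

text \<open>The tangent map of an affine map translates only the base point, which has index 0;
  every other coordinate sees the linear part \<open>L\<close> alone. Shears and translations of the
  plane are of this kind.\<close>

lemma
  fixes V :: "'v::euclidean_space set" and V' :: "'u::euclidean_space set"
  assumes V: "open V" and V': "open V'" and f: "smooth_into E V f" and L: "linear L"
    and LV: "\<And>x. x \<in> V' \<Longrightarrow> c + L x \<in> V"
  shows smooth_into_affine: "smooth_into E V' (\<lambda>x. f (c + L x))"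
    and tangent_map_affine: "w 0 \<in> V' \<Longrightarrow> i < 2 ^ k \<Longrightarrow>
      tangent_map E k (\<lambda>x. f (c + L x)) w i = tangent_map E k f (\<lambda>j. if j = 0 then c + L (w 0) else L (w j)) i"
proof -
  let ?\<phi> = "\<lambda>w j. if j = 0 then c + L (w 0) else L (w (j::nat))"
  have "smooth_into E V' (\<lambda>x. f (c + L x)) \<and> (\<forall>k w i. w 0 \<in> V' \<longrightarrow> i < 2 ^ k \<longrightarrow>
    tangent_map E k (\<lambda>x. f (c + L x)) w i = (\<lambda>k w i. tangent_map E k f (?\<phi> w) i) k w i)"
  proof (rule smooth_into_tangentI[OF V'])
    fix k i :: nat assume i: "i < 2 ^ k"
    show "has_dir_deriv E (\<lambda>x. tangent_map E k f (?\<phi> x) i) w (\<lambda>j. w (j + 2 ^ k)) (tangent_map E (Suc k) f (?\<phi> w) (i + 2 ^ k))"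
      if w: "w 0 \<in> V'" for w
    proof -
      have "?\<phi> (\<lambda>j. w j + t *\<^sub>R w (j + 2 ^ k)) = (\<lambda>j. ?\<phi> w j + t *\<^sub>R ?\<phi> w (j + 2 ^ k))" for t
        by (auto simp: linear_add[OF L] linear_scale[OF L])
      moreover have "?\<phi> w 0 \<in> V" using LV[OF w] by simp
      ultimately show ?thesis
        using smooth_into_deriv[of V f "?\<phi> w" i k, OF f _ i] unfolding has_dir_deriv_path by simp
    qed
    have cL: "continuous_on UNIV L" using linear_continuous_on linear_conv_bounded_linear L by blast
    have "continuous_map (tangent_dom k V') (tangent_dom k V) (\<lambda>w. \<lambda>j\<in>{..<2 ^ k}. ?\<phi> w j)"
    proof (rule continuous_map_into_tangent_dom)
      fix j :: nat
      have "continuous_map (tangent_dom k V') euclidean (\<lambda>w. L (w j))" for j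
        using continuous_map_compose[OF continuous_map_tangent_dom_component, of euclidean L] cL by (simp add: o_def)
      moreover from this[of 0] have "continuous_map (tangent_dom k V') euclidean (\<lambda>w. c + L (w 0))"
        using continuous_map_compose[of _ euclidean "\<lambda>w. L (w 0)" euclidean "\<lambda>x. c + x"]
        by (simp add: o_def continuous_intros)
      ultimately show "continuous_map (tangent_dom k V') euclidean (\<lambda>w. ?\<phi> w j)" by (cases "j = 0") auto
    qed (auto simp: topspace_tangent_dom LV)
    from continuous_map_compose[OF this smooth_into_cont[OF f i]]
    show "continuous_map (tangent_dom k V') (topol E) (\<lambda>w. tangent_map E k f (?\<phi> w) i)"
      by (rule continuous_map_eq) (use i in \<open>auto intro: tangent_map_cong\<close>)
  qed auto
  then show "smooth_into E V' (\<lambda>x. f (c + L x))" "w 0 \<in> V' \<Longrightarrow> i < 2 ^ k \<Longrightarrow>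
      tangent_map E k (\<lambda>x. f (c + L x)) w i = tangent_map E k f (?\<phi> w) i" by auto
qed

lemma smooth_into_local:
  fixes V :: "'v::euclidean_space set"
  assumes V: "open V" and U: "\<And>x. x \<in> V \<Longrightarrow> \<exists>U. open U \<and> x \<in> U \<and> smooth_into E U f"
  shows "smooth_into E V f"
proof (rule smooth_intoI[OF V, where H = "\<lambda>k. tangent_map E k f"])
  fix k i :: nat assume i: "i < 2 ^ k"
  show "has_dir_deriv E (\<lambda>x. tangent_map E k f x i) w (\<lambda>j. w (j + 2 ^ k)) (tangent_map E (Suc k) f w (i + 2 ^ k))"
    if "w 0 \<in> V" for w using U[OF that] smooth_into_deriv[of _ f w i k, OF _ _ i] by auto
  let ?X = "tangent_dom k V"
  let ?I = "{U. open U \<and> smooth_into E U f}" and ?T = "\<lambda>U. {w \<in> topspace ?X. w 0 \<in> U}"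
  show "continuous_map ?X (topol E) (\<lambda>w. tangent_map E k f w i)"
  proof (rule pasting_lemma[of ?I ?X ?T])
    show "openin ?X (?T U)" if "U \<in> ?I" for U using that openin_tangent_dom by auto
    show "continuous_map (subtopology ?X (?T U)) (topol E) (\<lambda>w. tangent_map E k f w i)" if "U \<in> ?I" for U
    proof -
      \<comment> \<open>Both sides consist of the points whose base point lies in
        \<open>U \<inter> V\<close>, with the topology of the full product.\<close>
      have "subtopology ?X (?T U) = subtopology (tangent_dom k U) {w. w 0 \<in> V}"
      proof -
        let ?P = "product_topology (\<lambda>_. euclidean :: 'v topology) {..<(2::nat) ^ k}"
        have "{w. w 0 \<in> V} \<inter> {w \<in> topspace (subtopology ?P {w. w 0 \<in> V}). w 0 \<in> U}
          = topspace ?P \<inter> ({w. w 0 \<in> U} \<inter> {w. w 0 \<in> V})" by auto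
        then show ?thesis
          unfolding tangent_dom_def subtopology_subtopology by (simp only: subtopology_restrict[of ?P])
      qed
      then show ?thesis using smooth_into_cont[of U f i k] that i continuous_map_from_subtopology by auto
    qed
    show "\<exists>j. j \<in> ?I \<and> x \<in> ?T j \<and> tangent_map E k f x i = tangent_map E k f x i" if "x \<in> topspace ?X" for x
      using that U[of "x 0"] by (auto simp: topspace_tangent_dom)
  qed auto
qed auto

lemma smooth_into_subset:
  fixes V :: "'v::euclidean_space set"
  shows "smooth_into E V f \<Longrightarrow> open V \<Longrightarrow> open U \<Longrightarrow> U \<subseteq> V \<Longrightarrow> smooth_into E U f"
  by (rule smooth_into_local) auto

end

text \<open>The expressions that occur in the tangent maps of a scalar function whose derivative in
  direction \<open>v\<close> is \<open>lf v\<close> times another member of the family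
  \<open>S\<close>: polynomials in the values \<open>g (w 0)\<close> and the numbers
  \<open>lf (w j)\<close>. The class is closed under differentiation, which replaces an explicit
  higher chain rule.\<close>

inductive_set tangent_polys :: "('v \<Rightarrow> complex) set \<Rightarrow> ('v \<Rightarrow> complex) \<Rightarrow> ((nat \<Rightarrow> 'v) \<Rightarrow> complex) set"
  for S :: "('v \<Rightarrow> complex) set" and lf :: "'v \<Rightarrow> complex" where
  base: "g \<in> S \<Longrightarrow> (\<lambda>w. g (w 0)) \<in> tangent_polys S lf"
| linear: "(\<lambda>w. lf (w j)) \<in> tangent_polys S lf"
| add: "P \<in> tangent_polys S lf \<Longrightarrow> Q \<in> tangent_polys S lf \<Longrightarrow> (\<lambda>w. P w + Q w) \<in> tangent_polys S lf"
| mult: "P \<in> tangent_polys S lf \<Longrightarrow> Q \<in> tangent_polys S lf \<Longrightarrow> (\<lambda>w. P w * Q w) \<in> tangent_polys S lf"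

lemma tangent_polys_deriv:
  fixes V :: "'v::euclidean_space set"
  assumes lf: "linear lf"
    and S: "\<And>g. g \<in> S \<Longrightarrow> \<exists>g'\<in>S. \<forall>x\<in>V. \<forall>v. ((\<lambda>t. g (x + t *\<^sub>R v)) has_vector_derivative lf v * g' x) (at 0)"
    and P: "P \<in> tangent_polys S lf"
  shows "\<exists>P'\<in>tangent_polys S lf. \<forall>w. w 0 \<in> V \<longrightarrow>
    ((\<lambda>t. P (\<lambda>j. w j + t *\<^sub>R w (j + 2 ^ k))) has_vector_derivative P' w) (at 0)"
  using P
proof induction
  case (base g)
  then obtain g' where g': "g' \<in> S" "\<forall>x\<in>V. \<forall>v. ((\<lambda>t. g (x + t *\<^sub>R v)) has_vector_derivative lf v * g' x) (at 0)"
    using S by blast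
  \<comment> \<open>The direction belonging to the base coordinate 0 has index
    \<open>0 + 2 ^ k\<close>.\<close>
  then show ?case
    by (intro bexI[of _ "\<lambda>w. lf (w (2 ^ k)) * g' (w 0)"])
      (auto intro: tangent_polys.intros)
next
  case (linear j)
  have "((\<lambda>t. lf (w j + t *\<^sub>R w (j + 2 ^ k))) has_vector_derivative lf (w (j + 2 ^ k))) (at 0)" for w
    by (auto simp: linear_add[OF lf] linear_scale[OF lf] intro!: derivative_eq_intros)
  then show ?case by (intro bexI[of _ "\<lambda>w. lf (w (j + 2 ^ k))"]) (auto intro: tangent_polys.intros)
next
  case (add P Q)
  obtain P' where P': "P' \<in> tangent_polys S lf"
    "\<And>w. w 0 \<in> V \<Longrightarrow> ((\<lambda>t. P (\<lambda>j. w j + t *\<^sub>R w (j + 2 ^ k))) has_vector_derivative P' w) (at 0)"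
    using add.IH(1) by blast
  obtain Q' where Q': "Q' \<in> tangent_polys S lf"
    "\<And>w. w 0 \<in> V \<Longrightarrow> ((\<lambda>t. Q (\<lambda>j. w j + t *\<^sub>R w (j + 2 ^ k))) has_vector_derivative Q' w) (at 0)"
    using add.IH(2) by blast
  show ?case
    by (intro bexI[of _ "\<lambda>w. P' w + Q' w"] tangent_polys.add P'(1) Q'(1))
      (use has_vector_derivative_add[OF P'(2) Q'(2)] in auto)
next
  case (mult P Q)
  obtain P' where P': "P' \<in> tangent_polys S lf"
    "\<And>w. w 0 \<in> V \<Longrightarrow> ((\<lambda>t. P (\<lambda>j. w j + t *\<^sub>R w (j + 2 ^ k))) has_vector_derivative P' w) (at 0)"
    using mult.IH(1) by blast
  obtain Q' where Q': "Q' \<in> tangent_polys S lf"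
    "\<And>w. w 0 \<in> V \<Longrightarrow> ((\<lambda>t. Q (\<lambda>j. w j + t *\<^sub>R w (j + 2 ^ k))) has_vector_derivative Q' w) (at 0)"
    using mult.IH(2) by blast
  have "((\<lambda>t. P (\<lambda>j. w j + t *\<^sub>R w (j + 2 ^ k)) * Q (\<lambda>j. w j + t *\<^sub>R w (j + 2 ^ k)))
      has_vector_derivative (P w * Q' w + P' w * Q w)) (at 0)" if "w 0 \<in> V" for w
    using has_vector_derivative_mult[OF P'(2)[of w, OF that] Q'(2)[of w, OF that]] by simp
  then show ?case
    using mult.hyps P'(1) Q'(1) by (intro bexI[of _ "\<lambda>w. P w * Q' w + P' w * Q w"]) (auto intro!: tangent_polys.intros)
qed

lemma tangent_polys_cont:
  fixes V :: "'v::euclidean_space set"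
  assumes lf: "linear lf" and S: "\<And>g. g \<in> S \<Longrightarrow> continuous_on V g" and P: "P \<in> tangent_polys S lf"
  shows "continuous_map (tangent_dom k V) euclidean P"
  using P
proof induction
  case (base g)
  have "continuous_map (tangent_dom k V) (top_of_set V) (\<lambda>w. w 0)"
    using continuous_map_tangent_dom_component
    by (auto simp: continuous_map_in_subtopology topspace_tangent_dom)
  from continuous_map_compose[OF this, of euclidean g] show ?case using S[OF base] by (simp add: o_def)
next
  case (linear j)
  have "continuous_on UNIV lf" using linear_continuous_on linear_conv_bounded_linear lf by blast
  then show ?case
    using continuous_map_compose[OF continuous_map_tangent_dom_component, of euclidean lf] by (simp add: o_def)
next
  case (add P Q)
  have "continuous_map (prod_topology euclidean euclidean) euclidean (\<lambda>(x :: complex, y). x + y)"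
    by (simp add: case_prod_unfold continuous_intros)
  from continuous_map_comp2[OF this add.IH] show ?case .
next
  case (mult P Q)
  have "continuous_map (prod_topology euclidean euclidean) euclidean (\<lambda>(x :: complex, y). x * y)"
    by (simp add: case_prod_unfold continuous_intros)
  from continuous_map_comp2[OF this mult.IH] show ?case .
qed

text \<open>A chosen derivative \<open>D k\<close> inside \<open>tangent_polys\<close> drives the
  same recursion as \<open>tangent_map\<close>: indices below \<open>2 ^ k\<close> are copied, the
  others are differentiated. The resulting \<open>H\<close> is the family that
  \<open>smooth_intoI\<close> asks for.\<close>

lemma (in lc_alg) smooth_into_scalar:
  fixes V :: "'v::euclidean_space set"
  assumes V: "open V" and lf: "linear lf"
    and S: "\<And>g. g \<in> S \<Longrightarrow> \<exists>g'\<in>S. \<forall>x\<in>V. \<forall>v. ((\<lambda>t. g (x + t *\<^sub>R v)) has_vector_derivative lf v * g' x) (at 0)"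
    and Sc: "\<And>g. g \<in> S \<Longrightarrow> continuous_on V g" and g: "g \<in> S" and a: "a \<in> carrier E"
  shows "smooth_into E V (\<lambda>x. g x \<odot> a)"
proof -
  let ?C = "tangent_polys S lf"
  define D where "D k P = (SOME P'. P' \<in> ?C \<and> (\<forall>w. w 0 \<in> V \<longrightarrow>
    ((\<lambda>t. P (\<lambda>j. w j + t *\<^sub>R w (j + 2 ^ k))) has_vector_derivative P' w) (at 0)))" for k :: nat and P
  have D: "D k P \<in> ?C \<and> (\<forall>w. w 0 \<in> V \<longrightarrow>
    ((\<lambda>t. P (\<lambda>j. w j + t *\<^sub>R w (j + 2 ^ k))) has_vector_derivative D k P w) (at 0))" if "P \<in> ?C" for k P
  proof -
    have "\<exists>P'. P' \<in> ?C \<and> (\<forall>w. w 0 \<in> V \<longrightarrow>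
      ((\<lambda>t. P (\<lambda>j. w j + t *\<^sub>R w (j + 2 ^ k))) has_vector_derivative P' w) (at 0))"
      using tangent_polys_deriv[of lf S V P k, OF lf S that] by blast
    from someI_ex[OF this] show ?thesis unfolding D_def .
  qed
  define H :: "nat \<Rightarrow> nat \<Rightarrow> (nat \<Rightarrow> 'v) \<Rightarrow> complex" where "H = rec_nat (\<lambda>i w. g (w 0)) (\<lambda>k Q i. if i < 2 ^ k then Q i else D k (Q (i - 2 ^ k)))"
  have H0: "H 0 = (\<lambda>i w. g (w 0))" and HS: "H (Suc k) = (\<lambda>i. if i < 2 ^ k then H k i else D k (H k (i - 2 ^ k)))" for k
    unfolding H_def by simp_all
  have HC: "H k i \<in> ?C" for k i
    by (induction k arbitrary: i) (auto simp: H0 HS g D intro: tangent_polys.base)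
  show ?thesis
  proof (rule smooth_intoI[OF V, where H = "\<lambda>k w i. H k i w \<odot> a"])
    fix k i :: nat assume i: "i < 2 ^ k"
    show "has_dir_deriv E (\<lambda>x. H k i x \<odot> a) w (\<lambda>j. w (j + 2 ^ k)) (H (Suc k) (i + 2 ^ k) w \<odot> a)" if "w 0 \<in> V" for w
      using path_deriv_scalar[OF D[THEN conjunct2, rule_format, of _ w k, OF HC that] a] unfolding has_dir_deriv_path by (simp add: HS)
    show "continuous_map (tangent_dom k V) (topol E) (\<lambda>w. H k i w \<odot> a)"
      by (rule continuous_map_comp2[OF cont_smult tangent_polys_cont[OF lf Sc HC]]) (use a in auto)
  qed (auto simp: H0 HS)
qed

section \<open>Algebras of smooth functions\<close>

lemma cring_complex_algebra: "cring complex_algebra"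
proof (rule cringI)
  show "abelian_group complex_algebra"
  proof (rule abelian_groupI)
    fix x assume "x \<in> carrier complex_algebra"
    show "\<exists>y\<in>carrier complex_algebra. y \<oplus>\<^bsub>complex_algebra\<^esub> x = \<zero>\<^bsub>complex_algebra\<^esub>"
      by (rule bexI[of _ "- x"]) (auto simp: complex_algebra_def)
  qed (auto simp: complex_algebra_def)
  show "Group.comm_monoid complex_algebra"
    by (rule Group.comm_monoidI) (auto simp: complex_algebra_def)
qed (auto simp: complex_algebra_def algebra_simps)

text \<open>Algebraic laws hold in \<open>B\<close> because they hold after each homomorphism
  \<open>ev i\<close> and these are jointly injective; the topology enters through
  \<open>lc_operations\<close>. It serves function algebras, with evaluation at points, and
  sections, with evaluation of lifts.\<close>

lemma lc_algebra_jointly_injective: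
  fixes E :: "('a, 'm) top_algebra_scheme" and B :: "('b, 'n) top_algebra_scheme" and ev :: "'i \<Rightarrow> 'b \<Rightarrow> 'a"
  assumes E: "lc_algebra E"
    and ev: "\<And>i x. i \<in> I \<Longrightarrow> x \<in> carrier B \<Longrightarrow> ev i x \<in> carrier E"
    and inj: "\<And>x y. x \<in> carrier B \<Longrightarrow> y \<in> carrier B \<Longrightarrow> (\<And>i. i \<in> I \<Longrightarrow> ev i x = ev i y) \<Longrightarrow> x = y"
    and cl: "\<And>x y. x \<in> carrier B \<Longrightarrow> y \<in> carrier B \<Longrightarrow> x \<oplus>\<^bsub>B\<^esub> y \<in> carrier B"
      "\<And>x y. x \<in> carrier B \<Longrightarrow> y \<in> carrier B \<Longrightarrow> x \<otimes>\<^bsub>B\<^esub> y \<in> carrier B"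
      "\<And>c x. x \<in> carrier B \<Longrightarrow> c \<odot>\<^bsub>B\<^esub> x \<in> carrier B"
      "\<zero>\<^bsub>B\<^esub> \<in> carrier B" "\<one>\<^bsub>B\<^esub> \<in> carrier B"
    and hom: "\<And>i x y. i \<in> I \<Longrightarrow> x \<in> carrier B \<Longrightarrow> y \<in> carrier B \<Longrightarrow> ev i (x \<oplus>\<^bsub>B\<^esub> y) = ev i x \<oplus>\<^bsub>E\<^esub> ev i y"
      "\<And>i x y. i \<in> I \<Longrightarrow> x \<in> carrier B \<Longrightarrow> y \<in> carrier B \<Longrightarrow> ev i (x \<otimes>\<^bsub>B\<^esub> y) = ev i x \<otimes>\<^bsub>E\<^esub> ev i y"
      "\<And>i c x. i \<in> I \<Longrightarrow> x \<in> carrier B \<Longrightarrow> ev i (c \<odot>\<^bsub>B\<^esub> x) = c \<odot>\<^bsub>E\<^esub> ev i x"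
      "\<And>i. i \<in> I \<Longrightarrow> ev i \<zero>\<^bsub>B\<^esub> = \<zero>\<^bsub>E\<^esub>" "\<And>i. i \<in> I \<Longrightarrow> ev i \<one>\<^bsub>B\<^esub> = \<one>\<^bsub>E\<^esub>"
    and top: "topspace (topol B) = carrier B"
      "lc_operations (topol B) \<zero>\<^bsub>B\<^esub> (add B) (smult B) (mult B)"
  shows "lc_algebra B"
proof -
  interpret E: lc_alg E by standard (rule E)
  note simps = cl hom ev
  have ab: "abelian_group B"
  proof (rule abelian_groupI)
    fix x assume x: "x \<in> carrier B"
    show "\<exists>y\<in>carrier B. y \<oplus>\<^bsub>B\<^esub> x = \<zero>\<^bsub>B\<^esub>"
      by (rule bexI[of _ "(- 1) \<odot>\<^bsub>B\<^esub> x"], rule inj) (auto simp: simps x E.smult_minus_one E.l_neg)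
  qed (auto simp: simps intro!: inj E.a_assoc E.a_comm)
  have "monoid B"
    by (rule monoidI) (auto simp: simps intro!: inj E.m_assoc)
  then have "ring B"
    by (rule ringI[OF ab]) (auto simp: simps E.l_distr E.r_distr intro!: inj)
  moreover have "module complex_algebra B"
    by (rule moduleI[OF cring_complex_algebra ab])
      (auto simp: complex_algebra_def simps E.smult_l_distr E.smult_r_distr E.smult_smult intro!: inj)
  moreover have "(c \<odot>\<^bsub>B\<^esub> x) \<otimes>\<^bsub>B\<^esub> y = c \<odot>\<^bsub>B\<^esub> (x \<otimes>\<^bsub>B\<^esub> y) \<and> x \<otimes>\<^bsub>B\<^esub> (c \<odot>\<^bsub>B\<^esub> y) = c \<odot>\<^bsub>B\<^esub> (x \<otimes>\<^bsub>B\<^esub> y)"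
    if "x \<in> carrier B" "y \<in> carrier B" for c x y
    using that by (auto simp: simps E.smult_mult intro!: inj)
  moreover have "\<exists>W. openin (topol B) W \<and> \<zero>\<^bsub>B\<^esub> \<in> W \<and> W \<subseteq> U \<and> convex_in B W"
    if U: "openin (topol B) U \<and> \<zero>\<^bsub>B\<^esub> \<in> U" for U
  proof -
    obtain W where W: "openin (topol B) W" "\<zero>\<^bsub>B\<^esub> \<in> W" "W \<subseteq> U" "convex_wrt (add B) (smult B) W"
      using U top(2) unfolding lc_operations_def convex_base_def by blast
    then have "convex_in B W"
      using openin_subset[OF W(1)] top(1) unfolding convex_in_def convex_wrt_def by auto
    then show ?thesis using W by blast
  qed
  ultimately show ?thesis
    using top unfolding lc_algebra_def lc_operations_def by blast
qed

lemma lc_algebra_complex: "lc_algebra complex_algebra"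
proof -
  have "ring complex_algebra" using cring_complex_algebra cring.axioms(1) by blast
  moreover have "module complex_algebra complex_algebra"
    by (rule moduleI[OF cring_complex_algebra])
      (use \<open>ring complex_algebra\<close> ring.axioms(1) in \<open>auto simp: complex_algebra_def algebra_simps\<close>)
  moreover have "\<exists>W. openin euclidean W \<and> (0::complex) \<in> W \<and> W \<subseteq> U \<and> convex_in complex_algebra W"
    if U: "openin euclidean U \<and> 0 \<in> U" for U
  proof -
    obtain e where "e > 0" "ball 0 e \<subseteq> U" using U by (meson open_contains_ball open_openin)
    moreover have "convex_in complex_algebra (ball 0 e)"
      using convex_ball[of 0 e] unfolding convex_in_def complex_algebra_def convex_alt
      by (auto simp: scaleR_conv_of_real)
    ultimately show ?thesis by (intro exI[of _ "ball 0 e"]) auto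
  qed
  ultimately show ?thesis
    unfolding lc_algebra_def
    by (simp add: complex_algebra_def case_prod_unfold continuous_intros Hausdorff_space_euclidean)
qed

interpretation complex_lc: lc_alg complex_algebra
  by standard (rule lc_algebra_complex)

definition open_atlas :: "('v::euclidean_space, 'x) atlas \<Rightarrow> bool" where
  "open_atlas M \<longleftrightarrow> (\<forall>(V, \<psi>)\<in>M. open V)"

lemma points_memI: "(V, \<psi>) \<in> M \<Longrightarrow> x \<in> V \<Longrightarrow> \<psi> x \<in> points M"
  by (force simp: points_def)

context lc_alg
begin

lemma smooth_mapsI:
  fixes M :: "('v::euclidean_space, 'x) atlas"
  assumes M: "open_atlas M" and f: "\<And>V \<psi>. (V, \<psi>) \<in> M \<Longrightarrow> smooth_into E V (\<lambda>x. f (\<psi> x))"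
  shows "(\<lambda>x\<in>points M. f x) \<in> smooth_maps M E"
proof -
  have "f x \<in> carrier E" if "x \<in> points M" for x
    using that f unfolding points_def by (auto dest!: smooth_into_closed)
  moreover have "smooth_into E V ((\<lambda>x\<in>points M. f x) \<circ> \<psi>)" if "(V, \<psi>) \<in> M" for V \<psi>
    by (rule smooth_into_cong[OF _ f[OF that]])
      (use M that in \<open>auto simp: open_atlas_def points_memI\<close>)
  ultimately show ?thesis by (auto simp: smooth_maps_def)
qed

lemma smooth_mapsD:
  "f \<in> smooth_maps M E \<Longrightarrow> (V, \<psi>) \<in> M \<Longrightarrow> smooth_into E V (\<lambda>x. f (\<psi> x))"
  by (auto simp: smooth_maps_def o_def)

text \<open>Elements of \<open>smooth_algebra\<close> are cut off outside \<open>points M\<close>;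
  inside a chart the cut is invisible to tangent maps.\<close>

lemma tangent_map_ext_restrict:
  fixes M :: "('v::euclidean_space, 'x) atlas"
  assumes M: "open_atlas M" "(V, \<psi>) \<in> M" and f: "smooth_into E V (\<lambda>x. f (\<psi> x))"
  shows "tangent_map_ext E k V ((\<lambda>x\<in>points M. f x) \<circ> \<psi>) = tangent_map_ext E k V (\<lambda>x. f (\<psi> x))"
proof -
  have "tangent_map E k ((\<lambda>x\<in>points M. f x) \<circ> \<psi>) w i = tangent_map E k (\<lambda>x. f (\<psi> x)) w i"
    if "w 0 \<in> V" "i < 2 ^ k" for w i
    by (rule tangent_map_cong_on[OF _ f]) (use M that in \<open>auto simp: open_atlas_def points_memI\<close>)
  then show ?thesis
    unfolding tangent_map_ext_def by (intro restrict_ext) (auto simp: topspace_tangent_dom)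
qed

lemma tangent_map_ext_in_cont_maps:
  assumes "smooth_into E V f"
  shows "tangent_map_ext E k V f \<in> cont_maps (tangent_dom k V) (tangent_cod k E)"
  using assms unfolding cont_maps_def smooth_into_def by (auto simp: tangent_map_ext_def)

lemma lc_operations_tangent_cod:
  "lc_operations (tangent_cod k E) (\<lambda>i\<in>{..<2 ^ k}. \<zero>) (\<lambda>f g. \<lambda>i\<in>{..<2 ^ k}. f i \<oplus> g i)
     (\<lambda>c f. \<lambda>i\<in>{..<2 ^ k}. c \<odot> f i) (\<lambda>f g. \<lambda>i\<in>{..<2 ^ k}. tangent_mult E k f g i)"
  unfolding tangent_cod_def
proof (rule lc_operations_product[OF lc_operations])
  let ?P = "product_topology (\<lambda>_. topol E) {..<(2::nat) ^ k}"
  have "continuous_map (prod_topology ?P ?P) (topol E) (\<lambda>x. fst x j)"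
    "continuous_map (prod_topology ?P ?P) (topol E) (\<lambda>x. snd x j)" if "j < 2 ^ k" for j
    using that continuous_map_compose[OF continuous_map_fst continuous_map_product_projection[of j "{..<(2::nat) ^ k}" "\<lambda>_. topol E"]]
      continuous_map_compose[OF continuous_map_snd continuous_map_product_projection[of j "{..<(2::nat) ^ k}" "\<lambda>_. topol E"]]
    by (auto simp: o_def)
  then show "continuous_map (prod_topology ?P ?P) ?P (\<lambda>(f, g). \<lambda>i\<in>{..<2 ^ k}. tangent_mult E k f g i)"
    by (auto simp: continuous_map_componentwise case_prod_unfold intro!: continuous_map_tangent_mult)
qed simp

text \<open>Composing with a chart and applying T^k turns the pointwise operations into those of T^k
  E, with \<open>tangent_mult\<close> as product, and the compact-open spaces carry compatible
  operations. Level \<open>k = 0\<close> alone already makes the family of these maps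
  injective.\<close>

lemma lc_algebra_smooth:
  fixes M :: "('v::euclidean_space, 'x) atlas"
  assumes M: "open_atlas M"
  shows "lc_algebra (smooth_algebra M E)"
proof -
  let ?B = "smooth_algebra M E"
  have V: "open V" if "(V, \<psi>) \<in> M" for V \<psi> using M that by (auto simp: open_atlas_def)
  have s: "smooth_into E V (\<lambda>x. f (\<psi> x))" if "(V, \<psi>) \<in> M" "f \<in> carrier ?B" for V \<psi> f
    using that by (auto simp: smooth_algebra_def smooth_mapsD)
  have cl: "f \<oplus>\<^bsub>?B\<^esub> g \<in> carrier ?B" "f \<otimes>\<^bsub>?B\<^esub> g \<in> carrier ?B" "c \<odot>\<^bsub>?B\<^esub> f \<in> carrier ?B"
    if "f \<in> carrier ?B" "g \<in> carrier ?B" for f g c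
    using that unfolding smooth_algebra_def partial_object.simps monoid.simps ring.simps module.simps
    by - (rule smooth_mapsI[OF M], (rule smooth_into_add[OF V] smooth_into_mult[OF V] smooth_into_smult[OF V]);
        (assumption | erule (1) smooth_mapsD))+
  have cl0: "\<zero>\<^bsub>?B\<^esub> \<in> carrier ?B" "\<one>\<^bsub>?B\<^esub> \<in> carrier ?B"
    by (auto simp: smooth_algebra_def intro!: smooth_mapsI[OF M] smooth_into_const V)
  let ?F = "\<lambda>(k, V, \<psi>) f. tangent_map_ext E k V (f \<circ> \<psi>)"
  let ?T = "\<lambda>(k, V, \<psi>). compact_open (tangent_dom k V) (tangent_cod k E)"
  have ops: "lc_operations (initial_topology (smooth_maps M E) (UNIV \<times> M) ?F ?T) \<zero>\<^bsub>?B\<^esub> (add ?B) (smult ?B) (mult ?B)"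
  proof (rule lc_operations_initial[where
        P = "\<lambda>(k, V, \<psi>) f g. \<lambda>w\<in>topspace (tangent_dom k V). (\<lambda>i\<in>{..<2 ^ k}. f w i \<oplus> g w i)" and
        Q = "\<lambda>(k, V, \<psi>) c f. \<lambda>w\<in>topspace (tangent_dom k V). (\<lambda>i\<in>{..<2 ^ k}. c \<odot> f w i)" and
        M = "\<lambda>(k, V, \<psi>) f g. \<lambda>w\<in>topspace (tangent_dom k V). (\<lambda>i\<in>{..<2 ^ k}. tangent_mult E k (f w) (g w) i)"])
    show "x = y" if x: "x \<in> smooth_maps M E" and y: "y \<in> smooth_maps M E"
      and eq: "\<And>i. i \<in> UNIV \<times> M \<Longrightarrow> ?F i x = ?F i y" for x y
    proof (rule PiE_ext)
      show "x \<in> points M \<rightarrow>\<^sub>E carrier E" "y \<in> points M \<rightarrow>\<^sub>E carrier E" using x y by (auto simp: smooth_maps_def)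
      fix p assume "p \<in> points M"
      then obtain V \<psi> v where p: "(V, \<psi>) \<in> M" "v \<in> V" "p = \<psi> v" unfolding points_def by auto
      let ?w = "\<lambda>j\<in>{..<2 ^ 0}. v"
      have w: "?w \<in> topspace (tangent_dom 0 V)" using p by (auto simp: topspace_tangent_dom)
      have "tangent_map_ext E 0 V (x \<circ> \<psi>) ?w 0 = tangent_map_ext E 0 V (y \<circ> \<psi>) ?w 0"
        using eq[of "(0, V, \<psi>)"] p by simp
      then show "x p = y p" using w p by (simp add: tangent_map_ext_def)
    qed
    fix i assume i: "i \<in> (UNIV :: nat set) \<times> M"
    obtain k V \<psi> where ikV: "i = (k, V, \<psi>)" by (cases i) auto
    then have VM: "(V, \<psi>) \<in> M" using i by auto
    note 1 = tangent_map_ext_restrict[OF M VM] and V = V[OF VM]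
    have z: "?F i \<zero>\<^bsub>?B\<^esub> = (\<lambda>w\<in>topspace (tangent_dom k V). \<lambda>i\<in>{..<2 ^ k}. \<zero>)"
      using 1[of "\<lambda>_. \<zero>"] smooth_into_const[OF V zero_closed] tangent_map_const[OF V zero_closed]
      by (auto simp: smooth_algebra_def ikV tangent_map_ext_def topspace_tangent_dom intro!: restrict_ext)
    show "lc_operations (?T i) (?F i \<zero>\<^bsub>?B\<^esub>)
     ((\<lambda>(k, V, \<psi>) f g. \<lambda>w\<in>topspace (tangent_dom k V). (\<lambda>i\<in>{..<2 ^ k}. f w i \<oplus> g w i)) i)
     ((\<lambda>(k, V, \<psi>) c f. \<lambda>w\<in>topspace (tangent_dom k V). (\<lambda>i\<in>{..<2 ^ k}. c \<odot> f w i)) i)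
     ((\<lambda>(k, V, \<psi>) f g. \<lambda>w\<in>topspace (tangent_dom k V). (\<lambda>i\<in>{..<2 ^ k}. tangent_mult E k (f w) (g w) i)) i)"
      using lc_operations_compact_open[OF Hausdorff_tangent_dom[of k V] lc_operations_tangent_cod[of k]] z
      by (simp add: ikV)
    show "?F i \<in> smooth_maps M E \<rightarrow> topspace (?T i)"
      using tangent_map_ext_in_cont_maps smooth_mapsD[OF _ VM] by (auto simp: ikV o_def)
    fix f assume f: "f \<in> smooth_maps M E"
    note sf = smooth_mapsD[OF f VM]
    show "?F i (c \<odot>\<^bsub>?B\<^esub> f) = (\<lambda>(k, V, \<psi>) c f. \<lambda>w\<in>topspace (tangent_dom k V). (\<lambda>i\<in>{..<2 ^ k}. c \<odot> f w i)) i c (?F i f)" for c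
      using 1[of "\<lambda>x. c \<odot> f x"] smooth_into_smult[OF V sf] tangent_map_smult[OF V sf]
      by (auto simp: smooth_algebra_def ikV tangent_map_ext_def topspace_tangent_dom o_def intro!: restrict_ext)
    fix g assume g: "g \<in> smooth_maps M E"
    note sg = smooth_mapsD[OF g VM]
    show "?F i (f \<oplus>\<^bsub>?B\<^esub> g) = (\<lambda>(k, V, \<psi>) f g. \<lambda>w\<in>topspace (tangent_dom k V). (\<lambda>i\<in>{..<2 ^ k}. f w i \<oplus> g w i)) i (?F i f) (?F i g)"
      using 1[of "\<lambda>x. f x \<oplus> g x"] smooth_into_add[OF V sf sg] tangent_map_add[OF V sf sg]
      by (auto simp: smooth_algebra_def ikV tangent_map_ext_def topspace_tangent_dom o_def intro!: restrict_ext)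
    show "?F i (f \<otimes>\<^bsub>?B\<^esub> g) = (\<lambda>(k, V, \<psi>) f g. \<lambda>w\<in>topspace (tangent_dom k V). (\<lambda>i\<in>{..<2 ^ k}. tangent_mult E k (f w) (g w) i)) i (?F i f) (?F i g)"
      using 1[of "\<lambda>x. f x \<otimes> g x"] smooth_into_mult[OF V sf sg] tangent_map_mult[OF V sf sg]
      by (auto simp: smooth_algebra_def ikV tangent_map_ext_def topspace_tangent_dom o_def
          intro!: restrict_ext tangent_mult_cong)
  qed (use cl cl0 in \<open>auto simp: smooth_algebra_def\<close>)
  show ?thesis
  proof (rule lc_algebra_jointly_injective[OF lc, where I = "points M" and ev = "\<lambda>x f. f x"])
    show "lc_operations (topol ?B) \<zero>\<^bsub>?B\<^esub> (add ?B) (smult ?B) (mult ?B)"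
      using ops by (simp add: smooth_algebra_def)
    show "x = y" if "x \<in> carrier ?B" "y \<in> carrier ?B" "\<And>p. p \<in> points M \<Longrightarrow> x p = y p" for x y
      using that by (auto simp: smooth_algebra_def smooth_maps_def intro: PiE_ext)
  qed (use cl cl0 in \<open>auto simp: smooth_algebra_def smooth_maps_def\<close>)
qed

end

text \<open>A continuous linear map passes through T^k, so on a tangent level the action is the
  given one in each coordinate; \<open>g\<close> is fed in as a constant map on T^k V. The same
  proof covers the localization and the local representatives of sections.\<close>

lemma continuous_map_smooth_algebra_action:
  fixes M :: "('v::euclidean_space, 'x) atlas"
  assumes E: "lc_algebra E" and M: "open_atlas M"
    and c: "continuous_map (prod_topology T (topol E)) (topol E) (\<lambda>(g, a). \<alpha> g a)"
    and L: "\<And>g. g \<in> topspace T \<Longrightarrow> \<alpha> g \<in> alg_hom E E"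
  shows "continuous_map (prod_topology T (topol (smooth_algebra M E))) (topol (smooth_algebra M E))
           (\<lambda>(g, f). \<lambda>x\<in>points M. \<alpha> g (f x))"
    and "g \<in> topspace T \<Longrightarrow> f \<in> smooth_maps M E \<Longrightarrow> (\<lambda>x\<in>points M. \<alpha> g (f x)) \<in> smooth_maps M E"
proof -
  interpret E: lc_alg E by standard (rule E)
  have V: "open V" if "(V, \<psi>) \<in> M" for V \<psi> using M that by (auto simp: open_atlas_def)
  have La: "continuous_map (topol E) (topol E) (\<alpha> g)" if "g \<in> topspace T" for g
    using continuous_map_comp2[OF c, of "topol E" "\<lambda>_. g" "\<lambda>x. x"] that by (simp add: continuous_map_id[unfolded id_def])
  have Lb: "\<alpha> g (c \<odot>\<^bsub>E\<^esub> x) = c \<odot>\<^bsub>E\<^esub> \<alpha> g x" "\<alpha> g x \<in> carrier E" if "g \<in> topspace T" "x \<in> carrier E" for g c x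
    using L[OF that(1)] that unfolding alg_hom_def by auto
  have Lc: "\<alpha> g (x \<ominus>\<^bsub>E\<^esub> y) = \<alpha> g x \<ominus>\<^bsub>E\<^esub> \<alpha> g y" if "g \<in> topspace T" "x \<in> carrier E" "y \<in> carrier E" for g x y
  proof -
    have "\<ominus>\<^bsub>E\<^esub> \<alpha> g y = \<alpha> g (\<ominus>\<^bsub>E\<^esub> y)"
      using Lb(1)[OF that(1,3), of "-1"] E.smult_minus_one[OF Lb(2)[OF that(1,3)]] that by (simp add: E.smult_minus_one)
    then show ?thesis using L[OF that(1)] that unfolding alg_hom_def by (simp add: a_minus_def)
  qed
  have s: "smooth_into E V (\<lambda>x. \<alpha> g (f (\<psi> x)))" if "g \<in> topspace T" "f \<in> smooth_maps M E" "(V, \<psi>) \<in> M" for g f V \<psi>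
    by (rule E.smooth_into_linear[OF V[OF that(3)] E.smooth_mapsD[OF that(2,3)] E La[OF that(1)] Lc Lb(1)])
      (use that in auto)
  show sm: "(\<lambda>x\<in>points M. \<alpha> g (f x)) \<in> smooth_maps M E" if "g \<in> topspace T" "f \<in> smooth_maps M E" for g f
    by (rule E.smooth_mapsI[OF M s[OF that]])
  let ?F = "\<lambda>(k, V, \<psi>) f. tangent_map_ext E k V (f \<circ> \<psi>)"
  let ?T = "\<lambda>(k, V, \<psi>). compact_open (tangent_dom k V) (tangent_cod k E)"
  let ?X = "initial_topology (smooth_maps M E) (UNIV \<times> M) ?F ?T"
  have top: "topol (smooth_algebra M E) = ?X" by (simp add: smooth_algebra_def)
  have Fc: "?F i \<in> smooth_maps M E \<rightarrow> topspace (?T i)" if "i \<in> UNIV \<times> M" for i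
    using E.tangent_map_ext_in_cont_maps E.smooth_mapsD that by (fastforce simp: o_def)
  show "continuous_map (prod_topology T (topol (smooth_algebra M E))) (topol (smooth_algebra M E))
           (\<lambda>(g, f). \<lambda>x\<in>points M. \<alpha> g (f x))"
    unfolding top
  proof (rule continuous_map_into_initial_topology)
    show "(\<lambda>(g, f). \<lambda>x\<in>points M. \<alpha> g (f x)) \<in> topspace (prod_topology T ?X) \<rightarrow> smooth_maps M E"
      using sm by auto
    fix i assume i: "i \<in> (UNIV :: nat set) \<times> M"
    obtain k V \<psi> where ikV: "i = (k, V, \<psi>)" by (cases i) auto
    then have VM: "(V, \<psi>) \<in> M" using i by auto
    let ?Y = "tangent_cod k E"
    have "continuous_map (prod_topology T ?Y) ?Y (\<lambda>(g, u). \<lambda>j\<in>{..<2 ^ k}. \<alpha> g (u j))"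
      unfolding tangent_cod_def continuous_map_componentwise
    proof (intro conjI ballI)
      fix j :: nat assume j: "j \<in> {..<2 ^ k}"
      let ?P = "product_topology (\<lambda>_. topol E) {..<(2::nat) ^ k}"
      have "continuous_map (prod_topology T ?P) (topol E) (\<lambda>x. \<alpha> (fst x) (snd x j))"
        using continuous_map_compose[OF continuous_map_snd continuous_map_product_projection[OF j, of "\<lambda>_. topol E"]]
        by (intro continuous_map_comp2[OF c] continuous_map_fst) (auto simp: o_def)
      then show "continuous_map (prod_topology T ?P) (topol E) (\<lambda>x. (case x of (g, u) \<Rightarrow> \<lambda>j\<in>{..<2 ^ k}. \<alpha> g (u j)) j)"
        using j by (simp add: case_prod_unfold)
    qed auto
    note A = continuous_map_compact_open_comp2[OF Hausdorff_tangent_dom this]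
    have "continuous_map (prod_topology T ?X) (compact_open (tangent_dom k V) ?Y) (\<lambda>x. ?F i (snd x))"
      using continuous_map_compose[OF continuous_map_snd continuous_map_initial_topology[where F = ?F and T = ?T and i = i, OF i Fc[OF i]], of T]
      by (simp add: o_def ikV)
    from A[OF continuous_map_compact_open_const[OF continuous_map_fst] this]
    have "continuous_map (prod_topology T ?X) (compact_open (tangent_dom k V) ?Y)
      (\<lambda>x. \<lambda>w\<in>topspace (tangent_dom k V). \<lambda>j\<in>{..<2 ^ k}. \<alpha> ((\<lambda>w\<in>topspace (tangent_dom k V). fst x) w) (?F i (snd x) w j))" .
    then show "continuous_map (prod_topology T ?X) (?T i) (\<lambda>z. ?F i (case z of (g, f) \<Rightarrow> \<lambda>x\<in>points M. \<alpha> g (f x)))"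
      unfolding ikV
    proof (simp only: prod.case, elim continuous_map_eq)
      fix x assume "x \<in> topspace (prod_topology T ?X)"
      then obtain g f where x: "x = (g, f)" "g \<in> topspace T" "f \<in> smooth_maps M E" by auto
      have t: "tangent_map E k (\<lambda>x. \<alpha> g (f (\<psi> x))) w i = \<alpha> g (tangent_map E k (\<lambda>x. f (\<psi> x)) w i)"
        if "w 0 \<in> V" "i < 2 ^ k" for w i
        by (rule E.tangent_map_linear[OF V[OF VM] E.smooth_mapsD[OF x(3) VM] E La[OF x(2)] Lc Lb(1)])
          (use x that in auto)
      show "(\<lambda>w\<in>topspace (tangent_dom k V). \<lambda>j\<in>{..<2 ^ k}. \<alpha> ((\<lambda>w\<in>topspace (tangent_dom k V). fst x) w)
          (tangent_map_ext E k V (snd x \<circ> \<psi>) w j)) =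
         tangent_map_ext E k V ((case x of (g, f) \<Rightarrow> \<lambda>x\<in>points M. \<alpha> g (f x)) \<circ> \<psi>)"
        using E.tangent_map_ext_restrict[OF M VM s[OF x(2,3) VM], of k]
        by (auto simp: x tangent_map_ext_def t topspace_tangent_dom o_def intro!: restrict_ext)
    qed
  qed
qed

section \<open>Quotient algebras and localization\<close>

text \<open>Since \<open>\<alpha>\<close> of the inverse of \<open>g\<close> is a continuous
  two-sided inverse of \<open>\<alpha> g\<close>, bijectivity and the homeomorphism property follow
  from the homomorphism law and joint continuity.\<close>

lemma dynamical_systemI:
  fixes A :: "('a, 'm) top_algebra_scheme" and G :: "('g, 'n) monoid_scheme"
  assumes A: "lc_algebra A" and G: "topological_group G T"
    and ext: "\<And>g. g \<in> carrier G \<Longrightarrow> \<alpha> g \<in> extensional (carrier A)"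
    and hom: "\<And>g. g \<in> carrier G \<Longrightarrow> \<alpha> g \<in> alg_hom A A"
    and one: "\<And>g. g \<in> carrier G \<Longrightarrow> \<alpha> g \<one>\<^bsub>A\<^esub> = \<one>\<^bsub>A\<^esub>"
    and id: "\<And>x. x \<in> carrier A \<Longrightarrow> \<alpha> \<one>\<^bsub>G\<^esub> x = x"
    and comp: "\<And>g h x. g \<in> carrier G \<Longrightarrow> h \<in> carrier G \<Longrightarrow> x \<in> carrier A \<Longrightarrow> \<alpha> (g \<otimes>\<^bsub>G\<^esub> h) x = \<alpha> g (\<alpha> h x)"
    and cont: "continuous_map (prod_topology T (topol A)) (topol A) (\<lambda>(g, a). \<alpha> g a)"
  shows "dynamical_system A G T \<alpha>"
proof -
  interpret A: lc_alg A by standard (rule A)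
  have gG: "group G" and TG: "topspace T = carrier G" using G by (auto simp: topological_group_def)
  interpret G: group G by (rule gG)
  have cl: "\<alpha> g x \<in> carrier A" if "g \<in> carrier G" "x \<in> carrier A" for g x
    using hom[OF that(1)] that by (auto simp: alg_hom_def)
  have inv1: "\<alpha> (inv\<^bsub>G\<^esub> g) (\<alpha> g x) = x" "\<alpha> g (\<alpha> (inv\<^bsub>G\<^esub> g) x) = x" if "g \<in> carrier G" "x \<in> carrier A" for g x
    using comp[of "inv\<^bsub>G\<^esub> g" g x] comp[of g "inv\<^bsub>G\<^esub> g" x] that id by auto
  have cg: "continuous_map (topol A) (topol A) (\<alpha> g)" if "g \<in> carrier G" for g
    using continuous_map_comp2[OF cont, of "topol A" "\<lambda>_. g" "\<lambda>x. x"] that TG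
    by (simp add: continuous_map_id[unfolded id_def])
  have aut: "\<alpha> g \<in> lc_aut A" if g: "g \<in> carrier G" for g
  proof -
    have "bij_betw (\<alpha> g) (carrier A) (carrier A)"
      by (rule bij_betw_byWitness[where f' = "\<alpha> (inv\<^bsub>G\<^esub> g)"]) (use g inv1 cl in auto)
    moreover have "homeomorphic_maps (topol A) (topol A) (\<alpha> g) (\<alpha> (inv\<^bsub>G\<^esub> g))"
      unfolding homeomorphic_maps_def using g inv1 cg by auto
    ultimately show ?thesis
      unfolding lc_aut_def Bij_def homeomorphic_map_maps using ext[OF g] hom[OF g] one[OF g] by auto
  qed
  have "\<alpha> \<in> Group.hom G (lc_aut_group A)"
  proof (rule homI)
    show "\<alpha> x \<in> carrier (lc_aut_group A)" if "x \<in> carrier G" for x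
      using aut[OF that] by (simp add: lc_aut_group_def)
    show "\<alpha> (x \<otimes>\<^bsub>G\<^esub> y) = \<alpha> x \<otimes>\<^bsub>lc_aut_group A\<^esub> \<alpha> y" if xy: "x \<in> carrier G" "y \<in> carrier G" for x y
    proof -
      have "\<alpha> x \<in> Bij (carrier A)" "\<alpha> y \<in> Bij (carrier A)" using aut xy by (auto simp: lc_aut_def)
      then have "\<alpha> x \<otimes>\<^bsub>lc_aut_group A\<^esub> \<alpha> y = compose (carrier A) (\<alpha> x) (\<alpha> y)"
        by (simp add: lc_aut_group_def BijGroup_def)
      also have "\<dots> = \<alpha> (x \<otimes>\<^bsub>G\<^esub> y)"
        by (rule extensionalityI[where A = "carrier A"])
          (use xy ext comp in \<open>auto simp: compose_def\<close>)
      finally show ?thesis by simp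
    qed
  qed
  then show ?thesis using A G cont by (simp add: dynamical_system_def)
qed

lemma dynamical_systemD:
  fixes A :: "('a, 'm) top_algebra_scheme" and G :: "('g, 'n) monoid_scheme"
  assumes d: "dynamical_system A G T \<alpha>"
  shows "lc_algebra A" "topological_group G T"
    "continuous_map (prod_topology T (topol A)) (topol A) (\<lambda>(g, a). \<alpha> g a)"
    and "g \<in> carrier G \<Longrightarrow> \<alpha> g \<in> alg_hom A A"
    and "g \<in> carrier G \<Longrightarrow> \<alpha> g \<one>\<^bsub>A\<^esub> = \<one>\<^bsub>A\<^esub>"
    and "x \<in> carrier A \<Longrightarrow> \<alpha> \<one>\<^bsub>G\<^esub> x = x"
    and "g \<in> carrier G \<Longrightarrow> h \<in> carrier G \<Longrightarrow> x \<in> carrier A \<Longrightarrow> \<alpha> (g \<otimes>\<^bsub>G\<^esub> h) x = \<alpha> g (\<alpha> h x)"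
proof -
  show "lc_algebra A" "topological_group G T"
    "continuous_map (prod_topology T (topol A)) (topol A) (\<lambda>(g, a). \<alpha> g a)"
    using d by (auto simp: dynamical_system_def)
  interpret G: group G using d by (auto simp: dynamical_system_def topological_group_def)
  have aut: "\<alpha> g \<in> lc_aut A" if "g \<in> carrier G" for g
    using d that by (auto simp: dynamical_system_def Group.hom_def lc_aut_group_def)
  then show "g \<in> carrier G \<Longrightarrow> \<alpha> g \<in> alg_hom A A" "g \<in> carrier G \<Longrightarrow> \<alpha> g \<one>\<^bsub>A\<^esub> = \<one>\<^bsub>A\<^esub>"
    by (auto simp: lc_aut_def)
  have bij: "\<alpha> g \<in> Bij (carrier A)" if "g \<in> carrier G" for g using aut[OF that] by (auto simp: lc_aut_def)
  have comp: "\<alpha> (g \<otimes>\<^bsub>G\<^esub> h) x = \<alpha> g (\<alpha> h x)" if "g \<in> carrier G" "h \<in> carrier G" "x \<in> carrier A" for g h x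
  proof -
    have "\<alpha> (g \<otimes>\<^bsub>G\<^esub> h) = \<alpha> g \<otimes>\<^bsub>lc_aut_group A\<^esub> \<alpha> h"
      using d that unfolding dynamical_system_def by (auto simp: Group.hom_def)
    also have "\<dots> = compose (carrier A) (\<alpha> g) (\<alpha> h)"
      using bij[OF that(1)] bij[OF that(2)] by (simp add: lc_aut_group_def BijGroup_def)
    finally show ?thesis using that by (simp add: compose_def)
  qed
  then show "g \<in> carrier G \<Longrightarrow> h \<in> carrier G \<Longrightarrow> x \<in> carrier A \<Longrightarrow> \<alpha> (g \<otimes>\<^bsub>G\<^esub> h) x = \<alpha> g (\<alpha> h x)" .
  show "\<alpha> \<one>\<^bsub>G\<^esub> x = x" if x: "x \<in> carrier A"
  proof -
    have b: "bij_betw (\<alpha> \<one>\<^bsub>G\<^esub>) (carrier A) (carrier A)" using bij[OF G.one_closed] by (simp add: Bij_def)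
    \<comment> \<open>Membership in \<open>hom\<close> only says that products are preserved; the
      identity law follows because an injective idempotent map is the identity.\<close>
    have "\<alpha> \<one>\<^bsub>G\<^esub> (\<alpha> \<one>\<^bsub>G\<^esub> x) = \<alpha> \<one>\<^bsub>G\<^esub> x" using comp[OF G.one_closed G.one_closed x] by simp
    then show ?thesis
      using b x by (meson bij_betwE bij_betw_imp_inj_on inj_onD)
  qed
qed

text \<open>A product of two open surjections is open, hence a quotient map. For arbitrary quotient
  maps this fails, which is why openness of the projections is tracked.\<close>

lemma continuous_map_open_quotient2:
  assumes q1: "open_map X1 Y1 q1" "q1 ` topspace X1 = topspace Y1"
    and q2: "open_map X2 Y2 q2" "q2 ` topspace X2 = topspace Y2"
    and m: "continuous_map (prod_topology X1 X2) Z (\<lambda>(x, y). m (q1 x) (q2 y))"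
  shows "continuous_map (prod_topology Y1 Y2) Z (\<lambda>(x, y). m x y)"
  unfolding continuous_map
proof (intro conjI allI impI)
  show "(\<lambda>(x, y). m x y) ` topspace (prod_topology Y1 Y2) \<subseteq> topspace Z"
    using continuous_map_image_subset_topspace[OF m] by (fastforce simp: q1(2)[symmetric] q2(2)[symmetric])
  fix W assume W: "openin Z W"
  let ?O = "{p \<in> topspace (prod_topology X1 X2). (case p of (x, y) \<Rightarrow> m (q1 x) (q2 y)) \<in> W}"
  have oO: "openin (prod_topology X1 X2) ?O" using openin_continuous_map_preimage[OF m W] .
  show "openin (prod_topology Y1 Y2) {p \<in> topspace (prod_topology Y1 Y2). (case p of (x, y) \<Rightarrow> m x y) \<in> W}"
    unfolding openin_prod_topology_alt
  proof (intro allI impI)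
    fix a b assume ab: "(a, b) \<in> {p \<in> topspace (prod_topology Y1 Y2). (case p of (x, y) \<Rightarrow> m x y) \<in> W}"
    then have "a \<in> q1 ` topspace X1" "b \<in> q2 ` topspace X2" using q1(2) q2(2) by auto
    then obtain x y where xy: "x \<in> topspace X1" "a = q1 x" "y \<in> topspace X2" "b = q2 y" by blast
    then have "(x, y) \<in> ?O" using ab by auto
    then obtain U V where UV: "openin X1 U" "openin X2 V" "x \<in> U" "y \<in> V" "U \<times> V \<subseteq> ?O"
      using oO unfolding openin_prod_topology_alt by meson
    have "q1 ` U \<times> q2 ` V \<subseteq> {p \<in> topspace (prod_topology Y1 Y2). (case p of (x, y) \<Rightarrow> m x y) \<in> W}"
    proof
      fix p assume "p \<in> q1 ` U \<times> q2 ` V"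
      then obtain u v where uv: "u \<in> U" "v \<in> V" "p = (q1 u, q2 v)" by auto
      then have "(u, v) \<in> ?O" using UV(5) by auto
      then show "p \<in> {p \<in> topspace (prod_topology Y1 Y2). (case p of (x, y) \<Rightarrow> m x y) \<in> W}"
        using uv q1(2) q2(2) by auto
    qed
    then show "\<exists>U V. openin Y1 U \<and> openin Y2 V \<and> a \<in> U \<and> b \<in> V \<and>
        U \<times> V \<subseteq> {p \<in> topspace (prod_topology Y1 Y2). (case p of (x, y) \<Rightarrow> m x y) \<in> W}"
      using q1(1) q2(1) UV xy unfolding open_map_def
      by (intro exI[of _ "q1 ` U"] exI[of _ "q2 ` V"]) auto
  qed
qed

text \<open>Identities and convex neighbourhoods are pushed forward along \<open>q\<close>, and
  joint continuity descends because \<open>q\<close> is open. The Hausdorff property does not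
  descend in general and is a hypothesis.\<close>

lemma lc_algebra_open_surjective:
  fixes E :: "('a, 'm) top_algebra_scheme" and B :: "('b, 'n) top_algebra_scheme"
  assumes E: "lc_algebra E" and q: "q ` carrier E = carrier B"
    and hom: "\<And>x y. x \<in> carrier E \<Longrightarrow> y \<in> carrier E \<Longrightarrow> q x \<oplus>\<^bsub>B\<^esub> q y = q (x \<oplus>\<^bsub>E\<^esub> y)"
      "\<And>x y. x \<in> carrier E \<Longrightarrow> y \<in> carrier E \<Longrightarrow> q x \<otimes>\<^bsub>B\<^esub> q y = q (x \<otimes>\<^bsub>E\<^esub> y)"
      "\<And>c x. x \<in> carrier E \<Longrightarrow> c \<odot>\<^bsub>B\<^esub> q x = q (c \<odot>\<^bsub>E\<^esub> x)"
      "\<zero>\<^bsub>B\<^esub> = q \<zero>\<^bsub>E\<^esub>" "\<one>\<^bsub>B\<^esub> = q \<one>\<^bsub>E\<^esub>"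
    and top: "topspace (topol B) = carrier B" "Hausdorff_space (topol B)"
    and c: "continuous_map (topol E) (topol B) q" and o: "open_map (topol E) (topol B) q"
  shows "lc_algebra B"
proof -
  interpret E: lc_alg E by standard (rule E)
  have qc: "q x \<in> carrier B" if "x \<in> carrier E" for x using q that by auto
  have ex: "\<exists>x\<in>carrier E. X = q x" if "X \<in> carrier B" for X using q that by auto
  have ab: "abelian_group B"
  proof (rule abelian_groupI)
    fix X assume "X \<in> carrier B"
    then obtain x where x: "x \<in> carrier E" "X = q x" using ex by blast
    show "\<exists>Y\<in>carrier B. Y \<oplus>\<^bsub>B\<^esub> X = \<zero>\<^bsub>B\<^esub>"
      by (rule bexI[of _ "q (\<ominus>\<^bsub>E\<^esub> x)"]) (use x in \<open>auto simp: hom E.l_neg qc\<close>)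
  qed (auto simp: hom qc E.a_ac dest!: ex)
  have "monoid B" by (rule monoidI) (auto simp: hom qc E.m_assoc dest!: ex)
  then have "ring B"
    by (rule ringI[OF ab]) (auto simp: hom qc E.l_distr E.r_distr dest!: ex)
  moreover have "module complex_algebra B"
    by (rule moduleI[OF cring_complex_algebra ab])
      (auto simp: complex_algebra_def hom qc E.smult_l_distr E.smult_r_distr E.smult_smult dest!: ex)
  moreover have "(c \<odot>\<^bsub>B\<^esub> x) \<otimes>\<^bsub>B\<^esub> y = c \<odot>\<^bsub>B\<^esub> (x \<otimes>\<^bsub>B\<^esub> y) \<and> x \<otimes>\<^bsub>B\<^esub> (c \<odot>\<^bsub>B\<^esub> y) = c \<odot>\<^bsub>B\<^esub> (x \<otimes>\<^bsub>B\<^esub> y)"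
    if "x \<in> carrier B" "y \<in> carrier B" for c x y
    using that by (auto simp: hom qc E.smult_mult dest!: ex)
  moreover have q': "q ` topspace (topol E) = topspace (topol B)" using q top by simp
  have cc: "continuous_map (prod_topology (topol E) (topol E)) (topol B) (\<lambda>(x, y). m (q x) (q y))"
    if "continuous_map (prod_topology (topol E) (topol E)) (topol E) (\<lambda>(x, y). m' x y)"
      "\<And>x y. x \<in> carrier E \<Longrightarrow> y \<in> carrier E \<Longrightarrow> m (q x) (q y) = q (m' x y)" for m m'
    using continuous_map_compose[OF that(1) c] by (rule continuous_map_eq) (auto simp: that(2))
  moreover have "continuous_map (prod_topology (topol B) (topol B)) (topol B) (\<lambda>(x, y). x \<oplus>\<^bsub>B\<^esub> y)"
    by (rule continuous_map_open_quotient2[OF o q' o q' cc[OF E.cont_add hom(1)]])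
  moreover have "continuous_map (prod_topology (topol B) (topol B)) (topol B) (\<lambda>(x, y). x \<otimes>\<^bsub>B\<^esub> y)"
    by (rule continuous_map_open_quotient2[OF o q' o q' cc[OF E.cont_mult hom(2)]])
  moreover have "continuous_map (prod_topology euclidean (topol B)) (topol B) (\<lambda>(c, x). c \<odot>\<^bsub>B\<^esub> x)"
  proof (rule continuous_map_open_quotient2[where ?q1.0 = "\<lambda>x. x", OF _ _ o q'])
    show "continuous_map (prod_topology euclidean (topol E)) (topol B) (\<lambda>(x, y). x \<odot>\<^bsub>B\<^esub> q y)"
      using continuous_map_compose[OF E.cont_smult c] by (rule continuous_map_eq) (auto simp: hom)
  qed (auto simp: open_map_def)
  moreover have "\<exists>W. openin (topol B) W \<and> \<zero>\<^bsub>B\<^esub> \<in> W \<and> W \<subseteq> U \<and> convex_in B W"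
    if U: "openin (topol B) U \<and> \<zero>\<^bsub>B\<^esub> \<in> U" for U
  proof -
    have "openin (topol E) {x \<in> topspace (topol E). q x \<in> U}"
      using openin_continuous_map_preimage[OF c] U by blast
    moreover have "\<zero>\<^bsub>E\<^esub> \<in> {x \<in> topspace (topol E). q x \<in> U}" using U hom(4) by simp
    ultimately obtain W where W: "openin (topol E) W" "\<zero>\<^bsub>E\<^esub> \<in> W"
      "W \<subseteq> {x \<in> topspace (topol E). q x \<in> U}" "convex_in E W"
      using E unfolding lc_algebra_def by meson
    have "convex_in B (q ` W)"
      unfolding convex_in_def
    proof (intro conjI ballI allI impI)
      have WE: "W \<subseteq> carrier E" using W(4) by (simp add: convex_in_def)
      then show "q ` W \<subseteq> carrier B" using qc by auto
      fix X Y and t :: real assume "X \<in> q ` W" "Y \<in> q ` W" and t: "0 \<le> t" "t \<le> 1"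
      then obtain x y where xy: "x \<in> W" "y \<in> W" "X = q x" "Y = q y" by auto
      have "(complex_of_real (1 - t) \<odot>\<^bsub>E\<^esub> x) \<oplus>\<^bsub>E\<^esub> (complex_of_real t \<odot>\<^bsub>E\<^esub> y) \<in> W"
        using W(4) xy t unfolding convex_in_def by blast
      moreover have "(complex_of_real (1 - t) \<odot>\<^bsub>B\<^esub> X) \<oplus>\<^bsub>B\<^esub> (complex_of_real t \<odot>\<^bsub>B\<^esub> Y)
          = q ((complex_of_real (1 - t) \<odot>\<^bsub>E\<^esub> x) \<oplus>\<^bsub>E\<^esub> (complex_of_real t \<odot>\<^bsub>E\<^esub> y))"
        using xy WE by (auto simp: hom subset_iff)
      ultimately show "(complex_of_real (1 - t) \<odot>\<^bsub>B\<^esub> X) \<oplus>\<^bsub>B\<^esub> (complex_of_real t \<odot>\<^bsub>B\<^esub> Y) \<in> q ` W" by auto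
    qed
    then show ?thesis
      using W o hom(4) unfolding open_map_def by (intro exI[of _ "q ` W"]) auto
  qed
  ultimately show ?thesis
    using top unfolding lc_algebra_def by blast
qed

section \<open>Closed ideals and quotient algebras\<close>

context lc_alg
begin

lemma continuous_map_minus:
  assumes "continuous_map Z (topol E) u" "continuous_map Z (topol E) v"
  shows "continuous_map Z (topol E) (\<lambda>z. u z \<ominus> v z)"
proof -
  have "continuous_map Z (topol E) (\<lambda>z. u z \<oplus> (- 1) \<odot> v z)"
    by (intro continuous_map_add continuous_map_smult assms)
  then show ?thesis
    by (rule continuous_map_eq)
      (use continuous_map_in_carrier[OF assms(2)] in \<open>simp add: a_minus_def smult_minus_one\<close>)
qed

text \<open>Closure commutes with products, so addition maps the closure of
  \<open>I \<times> I\<close> into that of \<open>I\<close>; the other laws follow from the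
  continuity of maps in one variable.\<close>

lemma ideal_closure:
  assumes I: "ideal I E"
  shows "ideal (topol E closure_of I) E"
proof -
  interpret I: ideal I E by (rule I)
  let ?C = "topol E closure_of I"
  have CE: "?C \<subseteq> carrier E" using closure_of_subset_topspace[of "topol E" I] by simp
  have IC: "I \<subseteq> ?C" using closure_of_subset[of I "topol E"] I.a_subset by simp
  have img: "f x \<in> ?C" if "continuous_map (topol E) (topol E) f" "f ` I \<subseteq> I" "x \<in> ?C" for f x
    using continuous_map_image_closure_subset[OF that(1), of I] closure_of_mono[OF that(2), of "topol E"] that(3)
    by blast
  note id = continuous_map_id[unfolded id_def]
  show ?thesis
  proof (rule idealI[OF ring_axioms])
    show "subgroup ?C (add_monoid E)"
    proof
      show "?C \<subseteq> carrier (add_monoid E)" using CE by simp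
      show "\<one>\<^bsub>add_monoid E\<^esub> \<in> ?C" using IC I.zero_closed by auto
      fix x assume x: "x \<in> ?C"
      have "(\<lambda>x. (- 1) \<odot> x) ` I \<subseteq> I"
        using I.a_inv_closed I.a_subset by (auto simp: smult_minus_one subset_iff)
      from img[OF continuous_map_smult[OF id] this x]
      have "(- 1) \<odot> x \<in> ?C" .
      then show "inv\<^bsub>add_monoid E\<^esub> x \<in> ?C" using x CE by (auto simp: smult_minus_one a_inv_def[symmetric])
      fix y assume y: "y \<in> ?C"
      have "(x, y) \<in> prod_topology (topol E) (topol E) closure_of (I \<times> I)"
        using x y by (simp add: closure_of_Times)
      then have "x \<oplus> y \<in> topol E closure_of ((\<lambda>(x, y). x \<oplus> y) ` (I \<times> I))"
        using continuous_map_image_closure_subset[OF cont_add, of "I \<times> I"] by auto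
      moreover have "(\<lambda>(x, y). x \<oplus> y) ` (I \<times> I) \<subseteq> I" using I.a_closed by auto
      ultimately show "x \<otimes>\<^bsub>add_monoid E\<^esub> y \<in> ?C"
        using subsetD[OF closure_of_mono[of _ I "topol E"]] by simp
    qed
    fix a x assume a: "a \<in> ?C" and x: "x \<in> carrier E"
    show "x \<otimes> a \<in> ?C"
      by (rule img[where f = "\<lambda>a. x \<otimes> a", OF _ _ a])
        (use x I.I_l_closed in \<open>auto intro!: continuous_map_mult id\<close>)
    show "a \<otimes> x \<in> ?C"
      by (rule img[where f = "\<lambda>a. a \<otimes> x", OF _ _ a])
        (use x I.I_r_closed in \<open>auto intro!: continuous_map_mult id\<close>)
  qed
qed

text \<open>The algebra is unital: \<open>c \<odot> x\<close> is the product of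
  \<open>c \<odot> \<one>\<close> and \<open>x\<close>, so a ring ideal is a linear
  subspace.\<close>

lemma ideal_smult_closed:
  assumes "ideal I E" "x \<in> I"
  shows "c \<odot> x \<in> I"
proof -
  have x: "x \<in> carrier E" using assms ideal.Icarr by metis
  have "(c \<odot> \<one>) \<otimes> x \<in> I" using ideal.I_l_closed[OF assms] by simp
  then show ?thesis using x by (simp add: smult_mult)
qed

lemma carrier_quotient: "carrier (quotient_algebra E I) = (\<lambda>x. I +> x) ` carrier E"
  by (auto simp: quotient_algebra_def FactRing_def A_RCOSETS_def')

lemma coset_self: "ideal I E \<Longrightarrow> x \<in> carrier E \<Longrightarrow> x \<in> I +> x"
  using additive_subgroup.zero_closed[OF ideal.axioms(1)] by (force simp: a_r_coset_def')

lemma coset_subset: "ideal I E \<Longrightarrow> x \<in> carrier E \<Longrightarrow> I +> x \<subseteq> carrier E"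
  using additive_subgroup.a_subset[OF ideal.axioms(1)] by (force simp: a_r_coset_def')

lemma coset_mem:
  assumes I: "ideal I E" and x: "x \<in> carrier E" and y: "y \<in> I +> x"
  shows "y \<in> carrier E" "I +> y = I +> x"
proof -
  show yE: "y \<in> carrier E" using coset_subset[OF I x] y by auto
  obtain i where i: "i \<in> I" "y = i \<oplus> x" using y by (auto simp: a_r_coset_def')
  have iE: "i \<in> carrier E" using i I ideal.Icarr by metis
  have "y \<ominus> x = i" using i iE x by (simp add: a_minus_def a_assoc r_neg)
  then show "I +> y = I +> x" using quotient_eq_iff_same_a_r_cos[OF I yE x] i by simp
qed

lemma coset_eqI: "ideal I E \<Longrightarrow> x \<in> carrier E \<Longrightarrow> y \<in> carrier E \<Longrightarrow> x \<ominus> y \<in> I \<Longrightarrow> I +> x = I +> y"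
  using quotient_eq_iff_same_a_r_cos by blast

text \<open>Scalar multiplication on the quotient and \<open>loc_action\<close> are defined as
  unions over all representatives; when \<open>f\<close> respects the ideal, the union collapses to
  one coset.\<close>

lemma UN_coset:
  assumes I: "ideal I E" and x: "x \<in> carrier E" and f: "\<And>y. y \<in> carrier E \<Longrightarrow> f y \<in> carrier E"
    and d: "\<And>y. y \<in> carrier E \<Longrightarrow> y \<ominus> x \<in> I \<Longrightarrow> f y \<ominus> f x \<in> I"
  shows "(\<Union>y\<in>I +> x. I +> f y) = I +> f x"
proof -
  have "I +> f y = I +> f x" if y: "y \<in> I +> x" for y
  proof -
    note y' = coset_mem[OF I x y]
    have "y \<ominus> x \<in> I" using quotient_eq_iff_same_a_r_cos[OF I y'(1) x] y'(2) by simp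
    then show ?thesis using coset_eqI[OF I f f] d y' x by blast
  qed
  then show ?thesis using coset_self[OF I x] by blast
qed

lemma quotient_operations:
  assumes I: "ideal I E"
  shows "x \<in> carrier E \<Longrightarrow> y \<in> carrier E \<Longrightarrow> (I +> x) \<oplus>\<^bsub>quotient_algebra E I\<^esub> (I +> y) = I +> (x \<oplus> y)"
    "x \<in> carrier E \<Longrightarrow> y \<in> carrier E \<Longrightarrow> (I +> x) \<otimes>\<^bsub>quotient_algebra E I\<^esub> (I +> y) = I +> (x \<otimes> y)"
    "x \<in> carrier E \<Longrightarrow> c \<odot>\<^bsub>quotient_algebra E I\<^esub> (I +> x) = I +> (c \<odot> x)"
    "\<zero>\<^bsub>quotient_algebra E I\<^esub> = I +> \<zero>" "\<one>\<^bsub>quotient_algebra E I\<^esub> = I +> \<one>"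
proof -
  show "x \<in> carrier E \<Longrightarrow> y \<in> carrier E \<Longrightarrow> (I +> x) \<oplus>\<^bsub>quotient_algebra E I\<^esub> (I +> y) = I +> (x \<oplus> y)"
    using ideal.a_rcos_sum[OF I] by (simp add: quotient_algebra_def FactRing_def)
  show "x \<in> carrier E \<Longrightarrow> y \<in> carrier E \<Longrightarrow> (I +> x) \<otimes>\<^bsub>quotient_algebra E I\<^esub> (I +> y) = I +> (x \<otimes> y)"
    using ideal.rcoset_mult_add[OF I] by (simp add: quotient_algebra_def FactRing_def)
  show "\<zero>\<^bsub>quotient_algebra E I\<^esub> = I +> \<zero>"
    using a_rcos_zero[OF I additive_subgroup.zero_closed[OF ideal.axioms(1)[OF I]]]
    by (simp add: quotient_algebra_def FactRing_def)
  show "\<one>\<^bsub>quotient_algebra E I\<^esub> = I +> \<one>" by (simp add: quotient_algebra_def FactRing_def)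
  show "c \<odot>\<^bsub>quotient_algebra E I\<^esub> (I +> x) = I +> (c \<odot> x)" if x: "x \<in> carrier E"
  proof -
    have "(\<Union>y\<in>I +> x. I +> (c \<odot> y)) = I +> (c \<odot> x)"
      by (rule UN_coset[OF I x]) (use x ideal_smult_closed[OF I] in \<open>auto simp: smult_r_minus[symmetric]\<close>)
    then show ?thesis by (simp add: quotient_algebra_def)
  qed
qed

lemma openin_quotient:
  assumes I: "ideal I E"
  shows "openin (topol (quotient_algebra E I)) U \<longleftrightarrow>
    U \<subseteq> carrier (quotient_algebra E I) \<and> openin (topol E) {x \<in> carrier E. I +> x \<in> U}"
proof -
  let ?C = "carrier (quotient_algebra E I)"
  have un: "\<Union>U = {x \<in> carrier E. I +> x \<in> U}" if U: "U \<subseteq> ?C" for U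
  proof
    show "\<Union>U \<subseteq> {x \<in> carrier E. I +> x \<in> U}"
    proof
      fix x assume "x \<in> \<Union>U"
      then obtain X where X: "X \<in> U" "x \<in> X" by auto
      then obtain y where y: "y \<in> carrier E" "X = I +> y" using U carrier_quotient by auto
      show "x \<in> {x \<in> carrier E. I +> x \<in> U}"
        using coset_mem[OF I y(1), of x] X unfolding y(2) by simp
    qed
    show "{x \<in> carrier E. I +> x \<in> U} \<subseteq> \<Union>U" using coset_self[OF I] by auto
  qed
  have C: "?C = carrier (E Quot I)" by (simp add: quotient_algebra_def)
  \<comment> \<open>\<open>topology\<close> has the intended open sets only if the family satisfies
    the axioms. Cosets are disjoint, so taking unions of sets of cosets commutes with
    intersections.\<close>
  have "istopology (\<lambda>U. U \<subseteq> ?C \<and> openin (topol E) (\<Union>U))"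
    unfolding istopology_def
  proof (intro conjI allI impI; (elim conjE)?)
    fix S T assume ST: "S \<subseteq> ?C" "openin (topol E) (\<Union>S)" "T \<subseteq> ?C" "openin (topol E) (\<Union>T)"
    have "\<Union>(S \<inter> T) = \<Union>S \<inter> \<Union>T"
      using un[OF ST(1)] un[OF ST(3)] un[of "S \<inter> T"] ST by auto
    then show "openin (topol E) (\<Union>(S \<inter> T))" using ST by auto
    show "S \<inter> T \<subseteq> ?C" using ST by auto
  next
    fix \<K> assume K: "\<forall>K\<in>\<K>. K \<subseteq> ?C \<and> openin (topol E) (\<Union>K)"
    then show "\<Union>\<K> \<subseteq> ?C" by auto
    have "\<Union>(\<Union>\<K>) = (\<Union>K\<in>\<K>. \<Union>K)" by auto
    then show "openin (topol E) (\<Union>(\<Union>\<K>))" using K by auto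
  qed
  then have "openin (topol (quotient_algebra E I)) U \<longleftrightarrow> U \<subseteq> ?C \<and> openin (topol E) (\<Union>U)"
    by (simp add: quotient_algebra_def topology_inverse')
  then show ?thesis using un by auto
qed

lemma
  assumes I: "ideal I E"
  shows topspace_quotient: "topspace (topol (quotient_algebra E I)) = carrier (quotient_algebra E I)"
    and continuous_map_quotient: "continuous_map (topol E) (topol (quotient_algebra E I)) (\<lambda>x. I +> x)"
    and open_map_quotient: "open_map (topol E) (topol (quotient_algebra E I)) (\<lambda>x. I +> x)"
proof -
  let ?Q = "quotient_algebra E I"
  have "{x \<in> carrier E. I +> x \<in> carrier ?Q} = topspace (topol E)" by (auto simp: carrier_quotient)
  then have "openin (topol ?Q) (carrier ?Q)"
    unfolding openin_quotient[OF I] by (metis openin_topspace subset_refl)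
  then show t: "topspace (topol ?Q) = carrier ?Q"
    using openin_quotient[OF I] openin_subset openin_topspace by (metis subset_antisym)
  show "continuous_map (topol E) (topol ?Q) (\<lambda>x. I +> x)"
    unfolding continuous_map t using openin_quotient[OF I] by (auto simp: carrier_quotient)
  show "open_map (topol E) (topol ?Q) (\<lambda>x. I +> x)"
    unfolding open_map_def
  proof (intro allI impI)
    fix W assume W: "openin (topol E) W"
    have WE: "W \<subseteq> carrier E" using openin_subset[OF W] by simp
    have IE: "i \<in> carrier E" if "i \<in> I" for i using ideal.Icarr[OF I that] .
    \<comment> \<open>The saturation of \<open>W\<close> is the union of its translates by elements
      of \<open>I\<close>, hence open.\<close>
    have "{x \<in> carrier E. I +> x \<in> (\<lambda>x. I +> x) ` W} = (\<Union>i\<in>I. {x \<in> topspace (topol E). x \<ominus> i \<in> W})"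
    proof (intro Set.set_eqI iffI)
      fix x assume "x \<in> {x \<in> carrier E. I +> x \<in> (\<lambda>x. I +> x) ` W}"
      then obtain w where w: "x \<in> carrier E" "w \<in> W" "I +> x = I +> w" by auto
      then have "x \<ominus> w \<in> I" using quotient_eq_iff_same_a_r_cos[OF I] WE by blast
      moreover have "x \<ominus> (x \<ominus> w) = w"
        using w WE by (auto simp: a_minus_def minus_add a_assoc[symmetric] r_neg subset_iff)
      ultimately show "x \<in> (\<Union>i\<in>I. {x \<in> topspace (topol E). x \<ominus> i \<in> W})"
        using w by (intro UN_I[of "x \<ominus> w"]) auto
    next
      fix x assume "x \<in> (\<Union>i\<in>I. {x \<in> topspace (topol E). x \<ominus> i \<in> W})"
      then obtain i where i: "i \<in> I" "x \<in> carrier E" "x \<ominus> i \<in> W" by auto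
      have "x \<ominus> (x \<ominus> i) = i"
        using i IE by (auto simp: a_minus_def minus_add a_assoc[symmetric] r_neg)
      then have "I +> x = I +> (x \<ominus> i)"
        by (intro coset_eqI[OF I]) (use i IE in auto)
      then show "x \<in> {x \<in> carrier E. I +> x \<in> (\<lambda>x. I +> x) ` W}" using i by auto
    qed
    moreover have "openin (topol E) {x \<in> topspace (topol E). x \<ominus> i \<in> W}" if "i \<in> I" for i
      by (rule openin_continuous_map_preimage[OF continuous_map_minus W])
        (use IE[OF that] in \<open>auto simp: continuous_map_id[unfolded id_def]\<close>)
    ultimately show "openin (topol ?Q) ((\<lambda>x. I +> x) ` W)"
      unfolding openin_quotient[OF I] using WE by (auto simp: carrier_quotient)
  qed
qed

lemma lc_algebra_quotient:
  assumes I: "ideal I E" and cI: "closedin (topol E) I"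
  shows "lc_algebra (quotient_algebra E I)"
proof (rule lc_algebra_open_surjective[OF lc _ quotient_operations[OF I] topspace_quotient[OF I] _
      continuous_map_quotient[OF I] open_map_quotient[OF I]])
  let ?Q = "quotient_algebra E I"
  show "Hausdorff_space (topol ?Q)"
    unfolding Hausdorff_space_def topspace_quotient[OF I]
  proof (intro allI impI)
    fix X Y assume "X \<in> carrier ?Q \<and> Y \<in> carrier ?Q \<and> X \<noteq> Y"
    then obtain x y where xy: "x \<in> carrier E" "y \<in> carrier E" "X = I +> x" "Y = I +> y" "X \<noteq> Y"
      unfolding carrier_quotient by blast
    then have xyI: "x \<ominus> y \<notin> I" using coset_eqI[OF I] by blast
    \<comment> \<open>The complement of the closed set \<open>I\<close> is a neighbourhood of
      \<open>x \<ominus> y\<close>; by continuity of subtraction it separates whole neighbourhoods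
      of \<open>x\<close> and \<open>y\<close> modulo \<open>I\<close>.\<close>
    have c: "continuous_map (prod_topology (topol E) (topol E)) (topol E) (\<lambda>p. fst p \<ominus> snd p)"
      by (intro continuous_map_minus continuous_map_fst continuous_map_snd)
    have "openin (topol E) (topspace (topol E) - I)" using cI by (simp add: closedin_def)
    from openin_continuous_map_preimage[OF c this]
    have "openin (prod_topology (topol E) (topol E))
        {p \<in> topspace (prod_topology (topol E) (topol E)). fst p \<ominus> snd p \<in> topspace (topol E) - I}"
      (is "openin _ ?O") .
    moreover have "(x, y) \<in> ?O" using xy xyI by simp
    ultimately obtain U V where UV: "openin (topol E) U" "openin (topol E) V" "x \<in> U" "y \<in> V" "U \<times> V \<subseteq> ?O"
      unfolding openin_prod_topology_alt by meson
    have "disjnt ((\<lambda>x. I +> x) ` U) ((\<lambda>x. I +> x) ` V)"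
      unfolding disjnt_iff
    proof (intro allI notI, elim conjE imageE)
      fix z u v assume "z = I +> u" "z = I +> v" "u \<in> U" "v \<in> V"
      moreover have "u \<in> carrier E" "v \<in> carrier E"
        using openin_subset[OF UV(1)] openin_subset[OF UV(2)] calculation by auto
      ultimately have "u \<ominus> v \<in> I" using quotient_eq_iff_same_a_r_cos[OF I] by metis
      then show False using UV(5) \<open>u \<in> U\<close> \<open>v \<in> V\<close> by auto
    qed
    then show "\<exists>U V. openin (topol ?Q) U \<and> openin (topol ?Q) V \<and> X \<in> U \<and> Y \<in> V \<and> disjnt U V"
      using open_map_quotient[OF I] UV xy unfolding open_map_def by blast
  qed
qed (auto simp: carrier_quotient)

end

section \<open>Localization of a dynamical system at a fixed element\<close>

lemma open_atlas_real_line: "open_atlas real_line"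
  by (simp add: open_atlas_def real_line_def)

lemma points_real_line [simp]: "points real_line = UNIV"
  by (auto simp: points_def real_line_def)

lemma smooth_maps_real_line: "f \<in> smooth_maps real_line E \<longleftrightarrow> smooth_into E UNIV f"
  unfolding smooth_maps_def points_real_line by (auto simp: real_line_def o_def smooth_into_def)

lemma (in lc_alg) smooth_into_line:
  assumes a: "a \<in> carrier E"
  shows "smooth_into E UNIV (\<lambda>t::real. complex_of_real t \<odot> a)"
\<comment> \<open>The identity, 1 and 0 form a family closed under differentiation.\<close>
proof (rule smooth_into_scalar[where S = "{complex_of_real, \<lambda>_. 1, \<lambda>_. 0}" and lf = complex_of_real])
  show "linear complex_of_real" by (auto simp: linear_iff scaleR_conv_of_real)
  fix g assume "g \<in> {complex_of_real, \<lambda>_. 1, \<lambda>_. 0}"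
  then consider "g = complex_of_real" | "g = (\<lambda>_. 1)" | "g = (\<lambda>_. 0)" by blast
  then show "\<exists>g'\<in>{complex_of_real, \<lambda>_. 1, \<lambda>_. 0}. \<forall>x\<in>UNIV. \<forall>v.
      ((\<lambda>t. g (x + t *\<^sub>R v)) has_vector_derivative complex_of_real v * g' x) (at 0)"
  proof cases
    case 1
    have "((\<lambda>t. complex_of_real (x + t * v)) has_vector_derivative complex_of_real v) (at 0)" for x v
      by (rule has_vector_derivative_of_real) (auto intro!: derivative_eq_intros)
    then show ?thesis using 1 by (intro bexI[of _ "\<lambda>_. 1"]) auto
  qed (auto intro!: bexI[of _ "\<lambda>_. 0"])
  show "continuous_on UNIV g" using \<open>g \<in> _\<close> by (auto intro: continuous_intros)
qed (use a in auto)

locale localized_system =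
  fixes A :: "('a, 'm) top_algebra_scheme" and G :: "('g, 'n) monoid_scheme" and T :: "'g topology"
    and \<alpha> :: "'g \<Rightarrow> 'a \<Rightarrow> 'a" and z :: 'a
  assumes dyn: "dynamical_system A G T \<alpha>" and z: "z \<in> carrier A"
    and fixed: "\<And>g. g \<in> carrier G \<Longrightarrow> \<alpha> g z = z"
begin

abbreviation "B \<equiv> smooth_algebra real_line A"
abbreviation "I \<equiv> loc_ideal A z"
abbreviation "p \<equiv> \<lambda>t::real. \<one>\<^bsub>A\<^esub> \<ominus>\<^bsub>A\<^esub> (complex_of_real t \<odot>\<^bsub>A\<^esub> z)"

sublocale A: lc_alg A by standard (rule dynamical_systemD(1)[OF dyn])

sublocale B: lc_alg B by standard (rule A.lc_algebra_smooth[OF open_atlas_real_line])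

lemma carrier_B: "f \<in> carrier B \<longleftrightarrow> smooth_into A UNIV f"
  by (simp add: smooth_algebra_def smooth_maps_real_line)

lemma B_operations:
  "f \<oplus>\<^bsub>B\<^esub> g = (\<lambda>t. f t \<oplus>\<^bsub>A\<^esub> g t)" "f \<otimes>\<^bsub>B\<^esub> g = (\<lambda>t. f t \<otimes>\<^bsub>A\<^esub> g t)" "c \<odot>\<^bsub>B\<^esub> f = (\<lambda>t. c \<odot>\<^bsub>A\<^esub> f t)"
  "\<one>\<^bsub>B\<^esub> = (\<lambda>t. \<one>\<^bsub>A\<^esub>)" "\<zero>\<^bsub>B\<^esub> = (\<lambda>t. \<zero>\<^bsub>A\<^esub>)"
  by (simp_all add: smooth_algebra_def restrict_def)

lemma B_minus:
  assumes "f \<in> carrier B" "g \<in> carrier B"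
  shows "f \<ominus>\<^bsub>B\<^esub> g = (\<lambda>t. f t \<ominus>\<^bsub>A\<^esub> g t)"
proof -
  have "g t \<in> carrier A" for t using assms(2) A.smooth_into_closed[of UNIV g t] by (simp add: carrier_B)
  moreover have "f \<ominus>\<^bsub>B\<^esub> g = f \<oplus>\<^bsub>B\<^esub> (- 1) \<odot>\<^bsub>B\<^esub> g" using assms by (simp add: a_minus_def B.smult_minus_one)
  ultimately show ?thesis by (simp add: B_operations a_minus_def A.smult_minus_one)
qed

lemma p_carrier: "p \<in> carrier B"
proof -
  have "smooth_into A UNIV (\<lambda>t::real. \<one>\<^bsub>A\<^esub> \<oplus>\<^bsub>A\<^esub> (- 1) \<odot>\<^bsub>A\<^esub> (complex_of_real t \<odot>\<^bsub>A\<^esub> z))"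
    by (intro A.smooth_into_add A.smooth_into_const A.smooth_into_smult A.smooth_into_line z) auto
  then show ?thesis using z by (simp add: carrier_B a_minus_def A.smult_minus_one)
qed

lemma ideal_I: "ideal I B"
  unfolding loc_ideal_def by (rule B.ideal_closure, rule B.genideal_ideal) (use p_carrier in auto)

lemma closed_I: "closedin (topol B) I"
  unfolding loc_ideal_def by simp

lemma p_in_I: "p \<in> I"
  using B.genideal_self[of "{p}"] p_carrier closure_of_subset[of "Idl\<^bsub>B\<^esub> {p}" "topol B"]
    additive_subgroup.a_subset[OF ideal.axioms(1)[OF B.genideal_ideal[of "{p}"]]]
  unfolding loc_ideal_def by auto

text \<open>The action on representatives, before passing to cosets.\<close>

definition act :: "'g \<Rightarrow> (real \<Rightarrow> 'a) \<Rightarrow> real \<Rightarrow> 'a" where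
  "act g f = (\<lambda>t. \<alpha> g (f t))"

lemma topspace_T: "topspace T = carrier G"
  using dynamical_systemD(2)[OF dyn] by (simp add: topological_group_def)

lemma act_closed: "g \<in> carrier G \<Longrightarrow> f \<in> carrier B \<Longrightarrow> act g f \<in> carrier B"
  using continuous_map_smooth_algebra_action(2)[OF A.lc open_atlas_real_line dynamical_systemD(3)[OF dyn]
      dynamical_systemD(4)[OF dyn], of g f]
  by (simp add: smooth_algebra_def act_def topspace_T restrict_def)

lemma act_cont: "continuous_map (prod_topology T (topol B)) (topol B) (\<lambda>(g, f). act g f)"
  using continuous_map_smooth_algebra_action(1)[OF A.lc open_atlas_real_line dynamical_systemD(3)[OF dyn]
      dynamical_systemD(4)[OF dyn]]
  by (simp add: act_def topspace_T restrict_def)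

lemma carrier_B_value: "f \<in> carrier B \<Longrightarrow> f t \<in> carrier A"
  using A.smooth_into_closed[of UNIV f t] by (simp add: carrier_B)

lemma act_hom:
  assumes g: "g \<in> carrier G" and f: "f \<in> carrier B"
  shows "h \<in> carrier B \<Longrightarrow> act g (f \<oplus>\<^bsub>B\<^esub> h) = act g f \<oplus>\<^bsub>B\<^esub> act g h"
    "h \<in> carrier B \<Longrightarrow> act g (f \<otimes>\<^bsub>B\<^esub> h) = act g f \<otimes>\<^bsub>B\<^esub> act g h"
    "act g (c \<odot>\<^bsub>B\<^esub> f) = c \<odot>\<^bsub>B\<^esub> act g f"
  using dynamical_systemD(4)[OF dyn g] f
  by (auto simp: alg_hom_def act_def B_operations carrier_B_value)

lemma act_minus:
  assumes g: "g \<in> carrier G" and f: "f \<in> carrier B" and h: "h \<in> carrier B"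
  shows "act g (f \<ominus>\<^bsub>B\<^esub> h) = act g f \<ominus>\<^bsub>B\<^esub> act g h"
proof -
  have "act g (f \<oplus>\<^bsub>B\<^esub> (- 1) \<odot>\<^bsub>B\<^esub> h) = act g f \<oplus>\<^bsub>B\<^esub> (- 1) \<odot>\<^bsub>B\<^esub> act g h"
    using act_hom(1)[OF g f, of "(- 1) \<odot>\<^bsub>B\<^esub> h"] act_hom(3)[OF g h, of "-1"] h by simp
  then show ?thesis
    using act_closed[OF g h] h by (simp add: a_minus_def B.smult_minus_one)
qed

text \<open>The functions that \<open>act g\<close> sends into the generated ideal form an ideal
  \<open>?K\<close>. It contains \<open>p\<close>, because \<open>z\<close> and the unit are fixed,
  so it contains the whole generated ideal; continuity of \<open>act g\<close> carries this over to
  the closure.\<close>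

lemma act_I:
  assumes g: "g \<in> carrier G" and f: "f \<in> I"
  shows "act g f \<in> I"
proof -
  let ?J = "Idl\<^bsub>B\<^esub> {p}"
  have J: "ideal ?J B" using B.genideal_ideal p_carrier by simp
  interpret J: ideal ?J B by (rule J)
  let ?K = "{f \<in> carrier B. act g f \<in> ?J}"
  have "ideal ?K B"
  proof (rule idealI[OF B.ring_axioms])
    show "subgroup ?K (add_monoid B)"
    proof
      show "\<one>\<^bsub>add_monoid B\<^esub> \<in> ?K"
        using act_hom(3)[OF g B.zero_closed, of 0] J.zero_closed act_closed[OF g B.zero_closed] by simp
      fix x assume x: "x \<in> ?K"
      have "act g (\<ominus>\<^bsub>B\<^esub> x) = \<ominus>\<^bsub>B\<^esub> act g x"
        using x act_hom(3)[OF g, of x "-1"] act_closed[OF g, of x] by (simp add: B.smult_minus_one)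
      then show "inv\<^bsub>add_monoid B\<^esub> x \<in> ?K" using x J.a_inv_closed by (simp add: a_inv_def[symmetric])
      fix y assume y: "y \<in> ?K"
      then show "x \<otimes>\<^bsub>add_monoid B\<^esub> y \<in> ?K" using x J.a_closed by (simp add: act_hom(1)[OF g])
    qed auto
    fix a x assume a: "a \<in> ?K" and x: "x \<in> carrier B"
    show "x \<otimes>\<^bsub>B\<^esub> a \<in> ?K" "a \<otimes>\<^bsub>B\<^esub> x \<in> ?K"
      using a x J.I_l_closed J.I_r_closed act_closed[OF g x] by (auto simp: act_hom(2)[OF g])
  qed
  moreover have "act g p = p"
  proof -
    have "\<alpha> g (\<one>\<^bsub>A\<^esub> \<oplus>\<^bsub>A\<^esub> (- of_real t) \<odot>\<^bsub>A\<^esub> z) = \<one>\<^bsub>A\<^esub> \<oplus>\<^bsub>A\<^esub> (- of_real t) \<odot>\<^bsub>A\<^esub> z" for t :: real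
      using dynamical_systemD(4)[OF dyn g] dynamical_systemD(5)[OF dyn g] z fixed[OF g] by (simp add: alg_hom_def)
    moreover have "(- of_real t) \<odot>\<^bsub>A\<^esub> z = \<ominus>\<^bsub>A\<^esub> (of_real t \<odot>\<^bsub>A\<^esub> z)" for t :: real
      using A.smult_smult[OF z, of "-1" "of_real t"] z by (simp add: A.smult_minus_one)
    ultimately show ?thesis by (simp add: act_def a_minus_def)
  qed
  ultimately have "?J \<subseteq> ?K" using B.genideal_minimal[of ?K "{p}"] p_carrier B.genideal_self[of "{p}"] by auto
  then have "act g ` ?J \<subseteq> ?J" by auto
  moreover have "continuous_map (topol B) (topol B) (act g)"
    using continuous_map_comp2[OF act_cont, of "topol B" "\<lambda>_. g" "\<lambda>x. x"] g
    by (simp add: topspace_T continuous_map_id[unfolded id_def])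
  ultimately have "act g ` (topol B closure_of ?J) \<subseteq> topol B closure_of ?J"
    using continuous_map_image_closure_subset closure_of_mono by (meson order_trans)
  then show ?thesis using f unfolding loc_ideal_def by auto
qed

lemma loc_action_coset:
  assumes g: "g \<in> carrier G" and f: "f \<in> carrier B"
  shows "loc_action A z \<alpha> g (I +>\<^bsub>B\<^esub> f) = I +>\<^bsub>B\<^esub> act g f"
proof -
  have "(\<Union>f\<in>I +>\<^bsub>B\<^esub> f. I +>\<^bsub>B\<^esub> act g f) = I +>\<^bsub>B\<^esub> act g f"
    by (rule B.UN_coset[OF ideal_I f act_closed[OF g]]) (use g f act_I in \<open>auto simp: act_minus[symmetric]\<close>)
  moreover have "I +>\<^bsub>B\<^esub> f \<in> carrier (localization A z)"
    using f by (simp add: localization_def B.carrier_quotient)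
  ultimately show ?thesis by (simp add: loc_action_def act_def)
qed

lemma dynamical_system_localization: "dynamical_system (localization A z) G T (loc_action A z \<alpha>)"
proof (rule dynamical_systemI)
  have C: "carrier (localization A z) = (\<lambda>f. I +>\<^bsub>B\<^esub> f) ` carrier B"
    by (simp add: localization_def B.carrier_quotient)
  note ops = B.quotient_operations[OF ideal_I, folded localization_def]
  show "lc_algebra (localization A z)"
    unfolding localization_def by (rule B.lc_algebra_quotient[OF ideal_I closed_I])
  show G: "topological_group G T" by (rule dynamical_systemD(2)[OF dyn])
  interpret G: group G using G by (simp add: topological_group_def)
  show "loc_action A z \<alpha> \<one>\<^bsub>G\<^esub> X = X" if "X \<in> carrier (localization A z)" for X
    using that loc_action_coset[OF G.one_closed] unfolding C
    by (auto simp: act_def dynamical_systemD(6)[OF dyn] carrier_B_value)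
  fix g assume g: "g \<in> carrier G"
  show "loc_action A z \<alpha> g \<in> extensional (carrier (localization A z))" by (simp add: loc_action_def)
  show "loc_action A z \<alpha> g \<in> alg_hom (localization A z) (localization A z)"
    unfolding alg_hom_def C using g by (auto simp: ops loc_action_coset act_closed act_hom)
  show "loc_action A z \<alpha> g \<one>\<^bsub>localization A z\<^esub> = \<one>\<^bsub>localization A z\<^esub>"
    using loc_action_coset[OF g B.one_closed] dynamical_systemD(5)[OF dyn g]
    by (simp add: ops act_def B_operations)
  fix h X assume h: "h \<in> carrier G" and "X \<in> carrier (localization A z)"
  then obtain f where f: "f \<in> carrier B" "X = I +>\<^bsub>B\<^esub> f" unfolding C by blast
  have "act (g \<otimes>\<^bsub>G\<^esub> h) f = act g (act h f)"
    using g h f by (simp add: act_def dynamical_systemD(7)[OF dyn] carrier_B_value)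
  then show "loc_action A z \<alpha> (g \<otimes>\<^bsub>G\<^esub> h) X = loc_action A z \<alpha> g (loc_action A z \<alpha> h X)"
    using g h f by (simp add: loc_action_coset act_closed)
next
  show "continuous_map (prod_topology T (topol (localization A z))) (topol (localization A z))
    (\<lambda>(g, X). loc_action A z \<alpha> g X)"
    unfolding localization_def
  \<comment> \<open>The identity on the group and the open projection on the other factor let joint
    continuity descend to the quotient.\<close>
  proof (rule continuous_map_open_quotient2[where ?q1.0 = "\<lambda>x. x", OF _ _ B.open_map_quotient[OF ideal_I]])
    show "(\<lambda>x. I +>\<^bsub>B\<^esub> x) ` topspace (topol B) = topspace (topol (quotient_algebra B I))"
      by (simp add: B.topspace_quotient[OF ideal_I] B.carrier_quotient)
    show "continuous_map (prod_topology T (topol B)) (topol (quotient_algebra B I))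
      (\<lambda>(x, y). loc_action A z \<alpha> x (I +>\<^bsub>B\<^esub> y))"
      using continuous_map_compose[OF act_cont B.continuous_map_quotient[OF ideal_I]]
      by (rule continuous_map_eq) (auto simp: topspace_T loc_action_coset)
  qed (auto simp: open_map_def)
qed

end

section \<open>The circle and the torus algebra\<close>

abbreviation "\<A> \<equiv> torus_algebra"

text \<open>Here \<open>\<psi>\<close> may be a covering on all of \<open>V\<close> that is a chart
  only on small pieces. A compact set in the tangent space splits into compact parts lying over such
  pieces, so tangent maps over all of \<open>V\<close> still depend continuously on
  \<open>f\<close>. On the torus this permits translations that leave a given chart.\<close>

lemma (in lc_alg) continuous_map_global_chart:
  fixes M :: "('v::euclidean_space, 'x) atlas"
  assumes M: "open_atlas M" and V: "open V"
    and loc: "\<And>x. x \<in> V \<Longrightarrow> \<exists>U. open U \<and> x \<in> U \<and> U \<subseteq> V \<and> (U, \<psi>) \<in> M"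
  shows "f \<in> smooth_maps M E \<Longrightarrow> smooth_into E V (\<lambda>x. f (\<psi> x))"
    and "continuous_map (topol (smooth_algebra M E)) (compact_open (tangent_dom k V) (tangent_cod k E))
           (\<lambda>f. tangent_map_ext E k V (f \<circ> \<psi>))"
proof -
  show s: "smooth_into E V (\<lambda>x. f (\<psi> x))" if f: "f \<in> smooth_maps M E" for f
    by (rule smooth_into_local[OF V]) (use loc smooth_mapsD[OF f] in blast)
  let ?F = "\<lambda>(k, V, \<psi>) f. tangent_map_ext E k V (f \<circ> \<psi>)"
  let ?T = "\<lambda>(k, V, \<psi>). compact_open (tangent_dom k V) (tangent_cod k E)"
  let ?X = "initial_topology (smooth_maps M E) (UNIV \<times> M) ?F ?T"
  have top: "topol (smooth_algebra M E) = ?X" by (simp add: smooth_algebra_def)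
  have Fc: "?F i \<in> smooth_maps M E \<rightarrow> topspace (?T i)" if "i \<in> UNIV \<times> M" for i
    using tangent_map_ext_in_cont_maps smooth_mapsD that by (fastforce simp: o_def)
  show "continuous_map (topol (smooth_algebra M E)) (compact_open (tangent_dom k V) (tangent_cod k E))
           (\<lambda>f. tangent_map_ext E k V (f \<circ> \<psi>))"
    unfolding top
  proof (rule continuous_map_into_compact_open)
    show "(\<lambda>f. tangent_map_ext E k V (f \<circ> \<psi>)) \<in> topspace ?X \<rightarrow> cont_maps (tangent_dom k V) (tangent_cod k E)"
      using tangent_map_ext_in_cont_maps s by (auto simp: o_def)
    let ?D = "tangent_dom k V"
    fix K W assume K: "compactin ?D K" and W: "openin (tangent_cod k E) W"
    have KD: "K \<subseteq> topspace ?D" using K compactin_subset_topspace by blast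
    obtain U where U: "\<And>x. x \<in> V \<Longrightarrow> open (U x) \<and> x \<in> U x \<and> U x \<subseteq> V \<and> (U x, \<psi>) \<in> M" using loc by metis
    have K0: "w 0 \<in> V" if "w \<in> K" for w using KD that by (auto simp: topspace_tangent_dom)
    have "openin ?D {v \<in> topspace ?D. v 0 \<in> U (w 0)} \<and> w \<in> {v \<in> topspace ?D. v 0 \<in> U (w 0)}" if "w \<in> K" for w
      using openin_tangent_dom U[OF K0[OF that]] KD that by auto
    from compact_cover_refine[OF Hausdorff_tangent_dom K, of "\<lambda>w. {v \<in> topspace ?D. v 0 \<in> U (w 0)}", OF this]
    obtain D C where D: "finite D" "D \<subseteq> K" "K = (\<Union>w\<in>D. C w)"
      and C: "\<And>w. w \<in> D \<Longrightarrow> compactin ?D (C w) \<and> C w \<subseteq> {v \<in> topspace ?D. v 0 \<in> U (w 0)}" by blast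
    let ?O = "\<lambda>w. {f \<in> topspace ?X. tangent_map_ext E k (U (w 0)) (f \<circ> \<psi>) ` C w \<subseteq> W}"
    have "openin ?X (?O w)" if w: "w \<in> D" for w
    proof -
      have UM: "(U (w 0), \<psi>) \<in> M" and UV: "U (w 0) \<subseteq> V" using U[of "w 0"] K0[of w] subsetD[OF D(2) w] by auto
      have "compactin (tangent_dom k (U (w 0))) (C w)"
        unfolding tangent_dom_subset[OF UV] compactin_subtopology using C[OF w] by auto
      moreover have "continuous_map ?X (compact_open (tangent_dom k (U (w 0))) (tangent_cod k E)) (?F (k, U (w 0), \<psi>))"
        using continuous_map_initial_topology[where F = ?F and T = ?T and i = "(k, U (w 0), \<psi>)", OF _ Fc] UM by simp
      ultimately show ?thesis using openin_preimage_compact_open[OF _ _ W] unfolding prod.case by blast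
    qed
    then have "openin ?X (topspace ?X \<inter> (\<Inter>w\<in>D. ?O w))"
      using D(1) openin_topspace[of ?X] by (cases "D = {}") (auto intro!: openin_Int openin_INT2)
    moreover have "{f \<in> topspace ?X. tangent_map_ext E k V (f \<circ> \<psi>) ` K \<subseteq> W} = topspace ?X \<inter> (\<Inter>w\<in>D. ?O w)"
    proof -
      have "tangent_map_ext E k (U (w 0)) (f \<circ> \<psi>) v = tangent_map_ext E k V (f \<circ> \<psi>) v"
        if "w \<in> D" "v \<in> C w" for w v f
        using C[OF that(1)] that(2) by (auto simp: tangent_map_ext_def topspace_tangent_dom)
      then show ?thesis unfolding D(3) by (auto simp: image_subset_iff)
    qed
    ultimately show "openin ?X {f \<in> topspace ?X. tangent_map_ext E k V (f \<circ> \<psi>) ` K \<subseteq> W}" by simp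
  qed
qed

section \<open>The covering of the circle by the line\<close>

lemma circle_cover_cis: "circle_cover r = cis (2 * pi * r)"
  by (simp add: circle_cover_def cis_conv_exp mult_ac)

lemma circle_cover_add: "circle_cover (r + s) = circle_cover r * circle_cover s"
  by (simp add: circle_cover_cis cis_mult distrib_left)

lemma circle_cover_of_int [simp]: "circle_cover (of_int n) = 1"
  by (simp add: circle_cover_cis cis_multiple_2pi)

lemma circle_cover_0 [simp]: "circle_cover 0 = 1"
  by (simp add: circle_cover_cis)

lemma circle_cover_powi: "circle_cover r powi n = circle_cover (of_int n * r)"
  by (simp add: circle_cover_cis cis_power_int mult_ac)

lemma mem_circle: "z \<in> circle \<longleftrightarrow> norm z = 1"
  by (simp add: circle_def)

lemma circle_cover_in_circle [simp]: "circle_cover r \<in> circle"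
  by (simp add: mem_circle circle_cover_cis)

lemma circle_cover_nonzero [simp]: "circle_cover r \<noteq> 0"
  by (simp add: circle_cover_cis)

lemma circle_nonzero: "z \<in> circle \<Longrightarrow> z \<noteq> 0"
  by (auto simp: mem_circle)

lemma circle_closed: "z \<in> circle \<Longrightarrow> w \<in> circle \<Longrightarrow> z * w \<in> circle" "1 \<in> circle"
  "z \<in> circle \<Longrightarrow> inverse z \<in> circle" "z \<in> circle \<Longrightarrow> z powi n \<in> circle"
  by (auto simp: mem_circle norm_mult norm_inverse norm_power_int)

lemma circle_cover_eq_iff: "circle_cover r = circle_cover s \<longleftrightarrow> (\<exists>n::int. r = s + of_int n)"
proof
  assume "circle_cover r = circle_cover s"
  then obtain n :: int where "2 * complex_of_real pi * \<i> * complex_of_real r =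
      2 * complex_of_real pi * \<i> * complex_of_real s + (of_int (2 * n) * pi) * \<i>"
    unfolding circle_cover_def exp_eq by blast
  from arg_cong[OF this, of Im] have "2 * pi * r = 2 * pi * (s + of_int n)" by (simp add: algebra_simps)
  then show "\<exists>n::int. r = s + of_int n" by auto
qed (auto simp: circle_cover_add)

lemma circle_cover_surj: "z \<in> circle \<Longrightarrow> \<exists>r. z = circle_cover r"
proof -
  assume z: "z \<in> circle"
  then have "z = cis (Arg z)" using cis_Arg[of z] circle_nonzero[OF z] by (simp add: mem_circle sgn_div_norm)
  then have "z = circle_cover (Arg z / (2 * pi))" by (simp add: circle_cover_cis)
  then show ?thesis by blast
qed

lemma circle_cover_surj_interval:
  assumes "z \<in> circle"
  shows "\<exists>r. a \<le> r \<and> r < a + 1 \<and> z = circle_cover r"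
proof -
  obtain s where s: "z = circle_cover s" using circle_cover_surj[OF assms] by blast
  have "circle_cover (a + frac (s - a)) = circle_cover s"
    unfolding circle_cover_eq_iff by (rule exI[of _ "- \<lfloor>s - a\<rfloor>"]) (simp add: frac_def)
  then show ?thesis using s frac_ge_0[of "s - a"] frac_lt_1[of "s - a"] by (intro exI[of _ "a + frac (s - a)"]) auto
qed

lemma circle_cover_inj: "(\<And>x y. x \<in> V \<Longrightarrow> y \<in> V \<Longrightarrow> \<bar>x - y\<bar> < 1) \<Longrightarrow> inj_on circle_cover V"
proof (rule inj_onI)
  fix x y assume d: "\<And>x y. x \<in> V \<Longrightarrow> y \<in> V \<Longrightarrow> \<bar>x - y\<bar> < 1" and xy: "x \<in> V" "y \<in> V" "circle_cover x = circle_cover y"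
  obtain n :: int where n: "x = y + of_int n" using xy circle_cover_eq_iff by blast
  then have "\<bar>real_of_int n\<bar> < 1" using d[OF xy(1,2)] by simp
  then have "n = 0" by linarith
  then show "x = y" using n by simp
qed

lemma circle_cover_inj_ball: "inj_on circle_cover (ball x (1/4))"
  by (rule circle_cover_inj) (unfold mem_ball dist_real_def, linarith)

lemma continuous_circle_cover: "continuous_on S circle_cover"
  unfolding circle_cover_def by (intro continuous_intros)

text \<open>Up to a period, the points away from a small ball around \<open>x\<close> form the arc
  \<open>{x + e .. x + 1 - e}\<close>. Its image is compact, and removing it from the circle leaves
  an open set inside the image of the ball.\<close>

lemma open_map_circle_cover: "open_map euclidean circle_top circle_cover"
  unfolding open_map_def
proof (intro allI impI)
  fix U :: "real set" assume "openin euclidean U"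
  then have U: "open U" by simp
  show "openin circle_top (circle_cover ` U)"
  proof (subst openin_subopen, intro ballI)
    fix z assume "z \<in> circle_cover ` U"
    then obtain x where x: "x \<in> U" "z = circle_cover x" by auto
    obtain e0 where e0: "e0 > 0" "ball x e0 \<subseteq> U" using U x by (meson open_contains_ball)
    \<comment> \<open>The bound 1/4 keeps the complementary arc nonempty, so that its endpoint
      \<open>x + 1 - e\<close> can be used below.\<close>
    define e where "e = min e0 (1/4)"
    have e: "0 < e" "e \<le> 1/4" "ball x e \<subseteq> U" using e0 by (auto simp: e_def)
    let ?K = "circle_cover ` {x + e .. x + 1 - e}"
    have "compact ?K" by (intro compact_continuous_image continuous_circle_cover) auto
    then have "closed ?K" by (rule compact_imp_closed)
    then have "openin circle_top (circle - ?K)" unfolding circle_top_def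
      by (metis Diff_Int_distrib Int_Diff Diff_eq Int_commute open_Compl openin_open_Int)
    moreover have "z \<in> circle - ?K"
    proof -
      have False if y: "y \<in> {x + e .. x + 1 - e}" "circle_cover x = circle_cover y" for y
      proof -
        obtain n :: int where "x = y + of_int n" using y(2) circle_cover_eq_iff by blast
        then have "real_of_int n \<le> - e" "real_of_int n \<ge> e - 1" using y(1) by auto
        then have "n < 0" "n > -1" using e by linarith+
        then show False by simp
      qed
      then have "circle_cover x \<notin> ?K" by blast
      then show ?thesis using x by simp
    qed
    moreover have "circle - ?K \<subseteq> circle_cover ` U"
    proof
      fix w assume w: "w \<in> circle - ?K"
      then obtain r where r: "x - e \<le> r" "r < x - e + 1" "w = circle_cover r"
        using circle_cover_surj_interval[of w "x - e"] by auto
      have "r < x + e"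
      proof (rule ccontr)
        assume "\<not> r < x + e"
        then have "w \<in> ?K" using r by auto
        then show False using w by simp
      qed
      \<comment> \<open>The left endpoint of the half-open period is identified with
        \<open>x + 1 - e\<close>, which lies on the removed arc.\<close>
      moreover have "r \<noteq> x - e"
      proof
        assume "r = x - e"
        then have "w = circle_cover (x + 1 - e)"
          using r(3) circle_cover_eq_iff[of r "x + 1 - e"] by (auto intro!: exI[of _ "-1"])
        moreover have "x + 1 - e \<in> {x + e .. x + 1 - e}" using e by auto
        ultimately show False using w by blast
      qed
      ultimately have "r \<in> ball x e" using r by (auto simp: dist_real_def)
      then show "w \<in> circle_cover ` U" using e r by auto
    qed
    ultimately show "\<exists>T. openin circle_top T \<and> z \<in> T \<and> T \<subseteq> circle_cover ` U" by blast
  qed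
qed

lemma topspace_circle_top [simp]: "topspace circle_top = circle"
  by (simp add: circle_top_def)

lemma topological_group_circle: "topological_group circle_group circle_top"
proof -
  have g: "group circle_group"
  proof (rule groupI)
    fix x assume "x \<in> carrier circle_group"
    then show "\<exists>y\<in>carrier circle_group. y \<otimes>\<^bsub>circle_group\<^esub> x = \<one>\<^bsub>circle_group\<^esub>"
      by (intro bexI[of _ "inverse x"]) (auto simp: circle_group_def circle_closed circle_nonzero)
  qed (auto simp: circle_group_def circle_closed)
  interpret group circle_group by (rule g)
  have inv: "inv\<^bsub>circle_group\<^esub> z = inverse z" if "z \<in> circle" for z
    by (rule inv_equality) (use that in \<open>auto simp: circle_group_def circle_closed circle_nonzero\<close>)
  have "continuous_map circle_top circle_top inverse"
    unfolding circle_top_def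
    by (auto intro!: continuous_intros simp: circle_closed dest: circle_nonzero)
  then have "continuous_map circle_top circle_top (\<lambda>g. inv\<^bsub>circle_group\<^esub> g)"
    by (rule continuous_map_eq) (simp add: inv)
  moreover have "continuous_map (prod_topology circle_top circle_top) circle_top (\<lambda>(g, h). g * h)"
    unfolding circle_top_def prod_topology_subtopology_eu case_prod_unfold
    by (auto intro!: continuous_intros simp: circle_closed)
  ultimately show ?thesis using g by (simp add: topological_group_def circle_group_def)
qed

section \<open>The torus algebra, its shears and its rotations\<close>

abbreviation torus_cover :: "real \<times> real \<Rightarrow> complex \<times> complex" where
  "torus_cover \<equiv> map_prod circle_cover circle_cover"

lemma torus_cover_surj: "p \<in> torus \<Longrightarrow> \<exists>x. p = torus_cover x"
  using circle_cover_surj by (fastforce simp: torus_def)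

lemma torus_pair [simp]: "(z1, z2) \<in> torus \<longleftrightarrow> z1 \<in> circle \<and> z2 \<in> circle"
  by (simp add: torus_def)

lemma torus_cover_in_torus [simp]: "torus_cover x \<in> torus"
  by (cases x) (simp add: torus_def)

lemma open_torus_atlas: "open_atlas torus_atlas"
  by (auto simp: open_atlas_def torus_atlas_def open_Times)

lemma torus_chart:
  "\<exists>U. open U \<and> x \<in> U \<and> U \<subseteq> UNIV \<and> (U, torus_cover) \<in> torus_atlas"
proof (intro exI[of _ "ball (fst x) (1/4) \<times> ball (snd x) (1/4)"] conjI)
  show "(ball (fst x) (1/4) \<times> ball (snd x) (1/4), torus_cover) \<in> torus_atlas"
    unfolding torus_atlas_def using circle_cover_inj_ball by blast
qed (auto simp: open_Times mem_Times_iff)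

lemma points_torus [simp]: "points torus_atlas = torus"
proof
  show "points torus_atlas \<subseteq> torus" by (auto simp: points_def torus_atlas_def torus_def)
  show "torus \<subseteq> points torus_atlas"
  proof
    fix p assume "p \<in> torus"
    then obtain x where x: "p = torus_cover x" using torus_cover_surj by blast
    obtain U where "x \<in> U" "(U, torus_cover) \<in> torus_atlas" using torus_chart by blast
    then show "p \<in> points torus_atlas" using x points_memI by metis
  qed
qed

lemma complex_algebra_simps [simp]:
  "carrier complex_algebra = UNIV" "x \<otimes>\<^bsub>complex_algebra\<^esub> y = x * y" "x \<oplus>\<^bsub>complex_algebra\<^esub> y = x + y"
  "c \<odot>\<^bsub>complex_algebra\<^esub> x = c * x" "\<one>\<^bsub>complex_algebra\<^esub> = 1" "\<zero>\<^bsub>complex_algebra\<^esub> = 0"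
  "topol complex_algebra = euclidean"
  by (simp_all add: complex_algebra_def)

lemma torus_algebra_operations:
  "f \<oplus>\<^bsub>\<A>\<^esub> g = (\<lambda>p\<in>torus. f p + g p)" "f \<otimes>\<^bsub>\<A>\<^esub> g = (\<lambda>p\<in>torus. f p * g p)"
  "c \<odot>\<^bsub>\<A>\<^esub> f = (\<lambda>p\<in>torus. c * f p)" "\<one>\<^bsub>\<A>\<^esub> = (\<lambda>p\<in>torus. 1)" "\<zero>\<^bsub>\<A>\<^esub> = (\<lambda>p\<in>torus. 0)"
  by (simp_all add: torus_algebra_def smooth_algebra_def)

lemma lc_algebra_torus: "lc_algebra \<A>"
  unfolding torus_algebra_def by (rule complex_lc.lc_algebra_smooth[OF open_torus_atlas])

interpretation torus: lc_alg \<A>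
  by standard (rule lc_algebra_torus)

text \<open>The covering map is a chart near every point and smoothness is local, so smoothness on
  the torus can be tested on the doubly periodic pullback to the whole plane.\<close>

lemma torus_carrier:
  "f \<in> carrier \<A> \<longleftrightarrow> f \<in> extensional torus \<and> smooth_into complex_algebra UNIV (\<lambda>x. f (torus_cover x))"
proof
  assume "f \<in> carrier \<A>"
  then have f: "f \<in> smooth_maps torus_atlas complex_algebra" by (simp add: torus_algebra_def smooth_algebra_def)
  then show "f \<in> extensional torus \<and> smooth_into complex_algebra UNIV (\<lambda>x. f (torus_cover x))"
    using complex_lc.continuous_map_global_chart(1)[OF open_torus_atlas open_UNIV torus_chart f]
    by (auto simp: smooth_maps_def PiE_def)
next
  assume f: "f \<in> extensional torus \<and> smooth_into complex_algebra UNIV (\<lambda>x. f (torus_cover x))"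
  have "(\<lambda>p\<in>points torus_atlas. f p) \<in> smooth_maps torus_atlas complex_algebra"
  proof (rule complex_lc.smooth_mapsI[OF open_torus_atlas])
    fix V \<psi> assume "(V, \<psi>) \<in> torus_atlas"
    then have "open V" "\<psi> = torus_cover" by (auto simp: torus_atlas_def open_Times)
    then show "smooth_into complex_algebra V (\<lambda>x. f (\<psi> x))"
      using f complex_lc.smooth_into_subset[of UNIV] by auto
  qed
  moreover have "(\<lambda>p\<in>points torus_atlas. f p) = f" using f by (simp add: extensional_restrict)
  ultimately show "f \<in> carrier \<A>" by (simp add: torus_algebra_def smooth_algebra_def)
qed

lemma torus_extI:
  assumes "f \<in> extensional torus" "g \<in> extensional torus" "\<And>z1 z2. z1 \<in> circle \<Longrightarrow> z2 \<in> circle \<Longrightarrow> f (z1, z2) = g (z1, z2)"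
  shows "f = g"
  using assms by (intro extensionalityI[where A = torus]) (auto simp: torus_def)

definition rot :: "complex \<Rightarrow> (complex \<times> complex \<Rightarrow> complex) \<Rightarrow> complex \<times> complex \<Rightarrow> complex" where
  "rot t f = (\<lambda>(z1, z2)\<in>torus. f (z1, t * z2))"

lemma gamma_apply: "z1 \<in> circle \<Longrightarrow> z2 \<in> circle \<Longrightarrow> gamma n f (z1, z2) = f (z1, z1 powi n * z2)"
  and rot_apply: "z1 \<in> circle \<Longrightarrow> z2 \<in> circle \<Longrightarrow> rot t f (z1, z2) = f (z1, t * z2)"
  by (simp_all add: gamma_def rot_def torus_def)

lemma gamma_ext [simp]: "gamma n f \<in> extensional torus" and rot_ext [simp]: "rot t f \<in> extensional torus"
  by (simp_all add: gamma_def rot_def)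

lemma torus_carrier_ext: "f \<in> carrier \<A> \<Longrightarrow> f \<in> extensional torus"
  by (simp add: torus_carrier)

lemma gamma_closed [simp]:
  assumes f: "f \<in> carrier \<A>"
  shows "gamma n f \<in> carrier \<A>"
proof -
  \<comment> \<open>On the plane \<open>gamma n\<close> is precomposition with a linear
    shear.\<close>
  let ?L = "\<lambda>x :: real \<times> real. (fst x, of_int n * fst x + snd x)"
  have "linear ?L" by (rule linearI) (auto simp: algebra_simps)
  then have "smooth_into complex_algebra UNIV (\<lambda>x. f (torus_cover (0 + ?L x)))"
    using f complex_lc.smooth_into_affine[of UNIV UNIV "\<lambda>x. f (torus_cover x)" ?L 0] by (simp add: torus_carrier)
  moreover have "gamma n f (torus_cover x) = f (torus_cover (0 + ?L x))" for x
    by (cases x) (simp add: gamma_apply circle_cover_powi circle_cover_add)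
  ultimately show ?thesis by (simp add: torus_carrier)
qed

lemma rot_closed [simp]:
  assumes f: "f \<in> carrier \<A>" and t: "t \<in> circle"
  shows "rot t f \<in> carrier \<A>"
proof -
  obtain \<tau> where \<tau>: "t = circle_cover \<tau>" using circle_cover_surj[OF t] by blast
  \<comment> \<open>On the plane the rotation by \<open>t\<close> is the translation by
    \<open>\<tau>\<close> in the second coordinate.\<close>
  have "smooth_into complex_algebra UNIV (\<lambda>x. f (torus_cover ((0, \<tau>) + x)))"
    using f complex_lc.smooth_into_affine[of UNIV UNIV "\<lambda>x. f (torus_cover x)" "\<lambda>x. x" "(0, \<tau>)"]
    by (simp add: torus_carrier linear_id[unfolded id_def])
  moreover have "rot t f (torus_cover x) = f (torus_cover ((0, \<tau>) + x))" for x
    by (cases x) (simp add: rot_apply \<tau> circle_cover_add)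
  ultimately show ?thesis by (simp add: torus_carrier)
qed

lemma gamma_0: "f \<in> carrier \<A> \<Longrightarrow> gamma 0 f = f"
  by (rule torus_extI) (auto simp: gamma_apply torus_carrier_ext)

lemma gamma_gamma: "gamma m (gamma n f) = gamma (m + n) f"
  by (rule torus_extI) (auto simp: gamma_apply circle_closed circle_nonzero power_int_add mult_ac)

lemma rot_gamma: "t \<in> circle \<Longrightarrow> rot t (gamma n f) = gamma n (rot t f)"
  by (rule torus_extI) (auto simp: gamma_apply rot_apply circle_closed mult_ac)

lemma gamma_hom:
  "gamma n (f \<oplus>\<^bsub>\<A>\<^esub> g) = gamma n f \<oplus>\<^bsub>\<A>\<^esub> gamma n g"
  "gamma n (f \<otimes>\<^bsub>\<A>\<^esub> g) = gamma n f \<otimes>\<^bsub>\<A>\<^esub> gamma n g"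
  "gamma n (c \<odot>\<^bsub>\<A>\<^esub> f) = c \<odot>\<^bsub>\<A>\<^esub> gamma n f"
  "gamma n \<one>\<^bsub>\<A>\<^esub> = \<one>\<^bsub>\<A>\<^esub>" "gamma n \<zero>\<^bsub>\<A>\<^esub> = \<zero>\<^bsub>\<A>\<^esub>"
  by (rule torus_extI; simp add: torus_algebra_operations gamma_apply circle_closed)+

lemma rot_hom:
  assumes "t \<in> circle"
  shows "rot t (f \<oplus>\<^bsub>\<A>\<^esub> g) = rot t f \<oplus>\<^bsub>\<A>\<^esub> rot t g"
    "rot t (f \<otimes>\<^bsub>\<A>\<^esub> g) = rot t f \<otimes>\<^bsub>\<A>\<^esub> rot t g"
    "rot t (c \<odot>\<^bsub>\<A>\<^esub> f) = c \<odot>\<^bsub>\<A>\<^esub> rot t f"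
    "rot t \<one>\<^bsub>\<A>\<^esub> = \<one>\<^bsub>\<A>\<^esub>"
  by (rule torus_extI; simp add: torus_algebra_operations rot_apply circle_closed assms)+

lemma rot_1: "f \<in> carrier \<A> \<Longrightarrow> rot 1 f = f"
  by (rule torus_extI) (auto simp: rot_apply torus_carrier_ext)

lemma rot_rot: "s \<in> circle \<Longrightarrow> t \<in> circle \<Longrightarrow> rot (s * t) f = rot s (rot t f)"
  by (rule torus_extI) (auto simp: rot_apply circle_closed mult_ac)

lemma torus_mult_commute: "f \<otimes>\<^bsub>\<A>\<^esub> g = g \<otimes>\<^bsub>\<A>\<^esub> f"
  by (simp add: torus_algebra_operations mult.commute)

definition zeta :: "int \<Rightarrow> complex \<times> complex \<Rightarrow> complex" where
  "zeta k = (\<lambda>(z1, z2)\<in>torus. z2 powi k)"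

lemma zeta_closed [simp]: "zeta k \<in> carrier \<A>"
proof -
  \<comment> \<open>The multiples of one exponential are closed under differentiation: a derivative
    brings a factor 2 pi i k and the second coordinate of the direction.\<close>
  let ?g = "\<lambda>c (x :: real \<times> real). c * circle_cover (of_int k * snd x)"
  have "smooth_into complex_algebra UNIV (\<lambda>x. ?g 1 x \<odot>\<^bsub>complex_algebra\<^esub> 1)"
  proof (rule complex_lc.smooth_into_scalar[where S = "range ?g" and lf = "\<lambda>x. complex_of_real (snd x)"])
    show "linear (\<lambda>x :: real \<times> real. complex_of_real (snd x))" by (rule linearI) (auto simp: scaleR_conv_of_real)
    fix g assume "g \<in> range ?g"
    then obtain c where c: "g = ?g c" by blast
    then show "continuous_on UNIV g" unfolding circle_cover_def by (auto intro!: continuous_intros)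
    let ?d = "2 * complex_of_real pi * \<i> * of_int k * c"
    have "((\<lambda>t. ?g c (x + t *\<^sub>R v)) has_vector_derivative complex_of_real (snd v) * ?g ?d x) (at 0)" for x v
    proof -
      have "((\<lambda>s::complex. c * exp (2 * complex_of_real pi * \<i> * (of_int k * (complex_of_real (snd x) + s * complex_of_real (snd v)))))
          has_field_derivative complex_of_real (snd v) * ?g ?d x) (at (complex_of_real 0))"
        by (auto intro!: derivative_eq_intros simp: circle_cover_def)
      from has_vector_derivative_real_field[OF this]
      show ?thesis by (simp add: circle_cover_def o_def)
    qed
    then show "\<exists>g'\<in>range ?g. \<forall>x\<in>UNIV. \<forall>v. ((\<lambda>t. g (x + t *\<^sub>R v)) has_vector_derivative complex_of_real (snd v) * g' x) (at 0)"
      unfolding c by (intro bexI[of _ "?g ?d"]) auto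
  next
    show "?g 1 \<in> range ?g" by (rule rangeI)
  qed auto
  moreover have "zeta k (torus_cover x) = ?g 1 x \<odot>\<^bsub>complex_algebra\<^esub> 1" for x
    by (cases x) (simp add: zeta_def circle_cover_powi)
  ultimately show ?thesis by (simp add: torus_carrier zeta_def)
qed

lemma zeta_mult: "zeta j \<otimes>\<^bsub>\<A>\<^esub> zeta k = zeta (j + k)"
  by (rule torus_extI) (auto simp: zeta_def torus_algebra_operations circle_nonzero power_int_add)

lemma zeta_0: "zeta 0 = \<one>\<^bsub>\<A>\<^esub>"
  by (rule torus_extI) (auto simp: zeta_def torus_algebra_operations)

lemma rot_zeta: "t \<in> circle \<Longrightarrow> rot t (zeta k) = (t powi k) \<odot>\<^bsub>\<A>\<^esub> zeta k"
  by (rule torus_extI) (auto simp: zeta_def torus_algebra_operations rot_apply circle_closed power_int_mult_distrib)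

lemma continuous_map_torus_chart:
  "continuous_map (topol \<A>) (compact_open (tangent_dom k UNIV) (tangent_cod k complex_algebra))
     (\<lambda>f. tangent_map_ext complex_algebra k UNIV (f \<circ> torus_cover))"
  unfolding torus_algebra_def
  by (rule complex_lc.continuous_map_global_chart(2)[OF open_torus_atlas open_UNIV torus_chart])

text \<open>The circle is the open image of the line, so it is enough to let \<open>\<tau>\<close>
  vary over the reals. There rotation becomes translation of the plane by
  \<open>(0, \<tau>)\<close>, that is, a precomposition on each tangent level, which is jointly
  continuous for the compact-open topology.\<close>

lemma continuous_map_rot: "continuous_map (prod_topology circle_top (topol \<A>)) (topol \<A>) (\<lambda>(t, f). rot t f)"
proof (rule continuous_map_open_quotient2[where ?q1.0 = circle_cover and ?q2.0 = "\<lambda>f. f", OF open_map_circle_cover])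
  let ?C = complex_algebra
  let ?F = "\<lambda>(k, V, \<psi>) f. tangent_map_ext ?C k V (f \<circ> \<psi>)"
  let ?T = "\<lambda>(k, V, \<psi>). compact_open (tangent_dom k V) (tangent_cod k ?C)"
  let ?A = "topol \<A>"
  have top: "?A = initial_topology (carrier \<A>) (UNIV \<times> torus_atlas) ?F ?T"
    by (simp add: torus_algebra_def smooth_algebra_def)
  show "continuous_map (prod_topology euclidean ?A) ?A (\<lambda>(\<tau>, f). rot (circle_cover \<tau>) f)"
    unfolding top
  proof (rule continuous_map_into_initial_topology, unfold top[symmetric])
    show "(\<lambda>(\<tau>, f). rot (circle_cover \<tau>) f) \<in> topspace (prod_topology euclidean ?A) \<rightarrow> carrier \<A>"
      by auto
    fix i assume i: "i \<in> (UNIV :: nat set) \<times> torus_atlas"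
    then obtain k V where ikV: "i = (k, V, torus_cover)" "(V, torus_cover) \<in> torus_atlas"
      by (auto simp: torus_atlas_def)
    have V: "open V" using ikV open_torus_atlas by (auto simp: open_atlas_def)
    \<comment> \<open>Only the base point moves. It may leave \<open>V\<close>, so the tangent maps
      of \<open>f\<close> are taken over the whole plane.\<close>
    let ?s = "\<lambda>(\<tau>::real) (w :: nat \<Rightarrow> real \<times> real). \<lambda>j\<in>{..<2 ^ k}. if j = 0 then (0, \<tau>) + w j else w j"
    have comp: "continuous_map (prod_topology euclidean (tangent_dom k V)) euclidean (\<lambda>p. snd p j)" for j
      using continuous_map_compose[OF continuous_map_snd continuous_map_tangent_dom_component] by (simp add: o_def)
    have "continuous_map (prod_topology euclidean (tangent_dom k V)) (tangent_dom k UNIV) (\<lambda>(\<tau>, w). ?s \<tau> w)"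
      unfolding case_prod_unfold
    proof (rule continuous_map_into_tangent_dom)
      fix j :: nat
      have "continuous_map (prod_topology euclidean euclidean) euclidean (\<lambda>(\<tau>::real, y::real \<times> real). (0, \<tau>) + y)"
        by (auto simp: case_prod_unfold intro!: continuous_intros)
      from continuous_map_comp2[OF this continuous_map_fst comp[of j]]
      show "continuous_map (prod_topology euclidean (tangent_dom k V)) euclidean
        (\<lambda>z. if j = 0 then (0, fst z) + snd z j else snd z j)"
        using comp[of j] by (cases "j = 0") auto
    qed auto
    note P = continuous_map_compact_open_precomp[OF this, of "tangent_cod k ?C"]
    have "continuous_map (prod_topology euclidean ?A) (prod_topology euclidean (compact_open (tangent_dom k UNIV) (tangent_cod k ?C)))
      (\<lambda>p. (fst p, tangent_map_ext ?C k UNIV (snd p \<circ> torus_cover)))"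
      using continuous_map_compose[OF continuous_map_snd continuous_map_torus_chart]
      by (intro continuous_map_pairedI continuous_map_fst) (auto simp: o_def)
    from continuous_map_compose[OF this P]
    show "continuous_map (prod_topology euclidean ?A) (?T i) (\<lambda>p. ?F i (case p of (\<tau>, f) \<Rightarrow> rot (circle_cover \<tau>) f))"
      unfolding ikV prod.case
    proof (rule continuous_map_eq)
      fix p assume "p \<in> topspace (prod_topology (euclidean :: real topology) ?A)"
      then obtain \<tau> f where p: "p = (\<tau>, f)" "f \<in> carrier \<A>" by auto
      have f: "smooth_into ?C UNIV (\<lambda>x. f (torus_cover x))" using p by (simp add: torus_carrier)
      have "rot (circle_cover \<tau>) f \<circ> torus_cover = (\<lambda>x. f (torus_cover ((0, \<tau>) + x)))"
        by (auto simp: rot_apply circle_cover_add)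
      moreover have "tangent_map ?C k (\<lambda>x. f (torus_cover ((0, \<tau>) + x))) w i =
        tangent_map ?C k (\<lambda>x. f (torus_cover x)) (?s \<tau> w) i" if "w 0 \<in> V" "i < 2 ^ k" for w i
      proof -
        have "tangent_map ?C k (\<lambda>x. f (torus_cover ((0, \<tau>) + x))) w i =
          tangent_map ?C k (\<lambda>x. f (torus_cover x)) (\<lambda>j. if j = 0 then (0, \<tau>) + w 0 else w j) i"
          by (rule complex_lc.tangent_map_affine[OF open_UNIV V f linear_id[unfolded id_def]]) (use that in auto)
        also have "\<dots> = tangent_map ?C k (\<lambda>x. f (torus_cover x)) (?s \<tau> w) i"
          by (rule tangent_map_cong) (use that in auto)
        finally show ?thesis .
      qed
      ultimately show "((\<lambda>(\<tau>, h). \<lambda>x\<in>topspace (tangent_dom k V). h (?s \<tau> x)) \<circ>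
          (\<lambda>p. (fst p, tangent_map_ext ?C k UNIV (snd p \<circ> torus_cover)))) p =
         tangent_map_ext ?C k V ((case p of (\<tau>, f) \<Rightarrow> rot (circle_cover \<tau>) f) \<circ> torus_cover)"
        by (auto simp: p tangent_map_ext_def topspace_tangent_dom o_def intro!: restrict_ext cong: if_cong)
    qed
  qed
  show "circle_cover ` topspace euclidean = topspace circle_top"
    using circle_cover_surj by auto
qed (auto simp: open_map_def)

text \<open>Level 0 of the topology is uniform convergence on compact sets of the plane, and the
  plane is locally compact, so evaluation is jointly continuous. It supplies continuity in both
  variables for the non-triviality argument.\<close>

lemma continuous_torus_evaluation:
  fixes F :: "real \<Rightarrow> complex \<times> complex \<Rightarrow> complex"
  assumes F: "continuous_map euclidean (topol \<A>) F"
  shows "continuous_on UNIV (\<lambda>(r, x). F r (torus_cover x))"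
proof (rule continuous_at_imp_continuous_on, rule ballI)
  let ?C = complex_algebra
  fix p :: "real \<times> real \<times> real" assume "p \<in> UNIV"
  obtain r0 x0 where p: "p = (r0, x0)" by (cases p)
  let ?D = "tangent_dom 0 (UNIV :: (real \<times> real) set)"
  \<comment> \<open>At level 0 a tangent point is a family with the single index 0, so
    \<open>?w\<close> embeds the plane.\<close>
  let ?w = "\<lambda>x. \<lambda>j\<in>{..<(2::nat) ^ 0}. x :: real \<times> real"
  let ?G = "\<lambda>r. tangent_map_ext ?C 0 UNIV (F r \<circ> torus_cover)"
  have FA: "F r \<in> carrier \<A>" for r
    using F torus.continuous_map_in_carrier[OF F, of r] by simp
  have G: "continuous_map euclidean (compact_open ?D (tangent_cod 0 ?C)) ?G"
    using continuous_map_compose[OF F continuous_map_torus_chart] by (simp add: o_def)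
  have Gv: "?G r (?w x) 0 = F r (torus_cover x)" for r x
    by (simp add: tangent_map_ext_def topspace_tangent_dom)
  have cw: "continuous_map euclidean ?D ?w"
    by (rule continuous_map_into_tangent_dom) auto
  show "isCont (\<lambda>(r, x). F r (torus_cover x)) p"
    unfolding continuous_at_open p
  proof (intro allI impI, elim conjE)
    fix S assume S: "open S" "(case (r0, x0) of (r, x) \<Rightarrow> F r (torus_cover x)) \<in> S"
    let ?S = "{u \<in> topspace (tangent_cod 0 ?C). u 0 \<in> S}"
    have oS: "openin (tangent_cod 0 ?C) ?S"
      unfolding tangent_cod_def
      by (rule openin_continuous_map_preimage[OF continuous_map_product_projection]) (use S in auto)
    have c0: "continuous_map euclidean (tangent_cod 0 ?C) (\<lambda>x. ?G r0 (?w x))"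
    proof -
      have "continuous_map ?D (tangent_cod 0 ?C) (?G r0)"
        using continuous_map_image_subset_topspace[OF G] by (auto simp: cont_maps_def)
      from continuous_map_compose[OF cw this] show ?thesis by (simp add: o_def)
    qed
    have "open {x. ?G r0 (?w x) \<in> ?S}"
      using openin_continuous_map_preimage[OF c0 oS] by simp
    moreover have inT: "?G r (?w x) \<in> topspace (tangent_cod 0 ?C)" for r x
      by (auto simp: tangent_map_ext_def topspace_tangent_dom tangent_cod_def)
    moreover have "x0 \<in> {x. ?G r0 (?w x) \<in> ?S}"
      using S(2) inT[of r0 x0] unfolding mem_Collect_eq Gv by simp
    ultimately obtain e where e: "e > 0" "cball x0 e \<subseteq> {x. ?G r0 (?w x) \<in> ?S}"
      unfolding open_contains_cball by blast
    have K: "compactin ?D (?w ` cball x0 e)"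
      by (rule image_compactin[OF _ cw]) auto
    have "open {r. ?G r ` (?w ` cball x0 e) \<subseteq> ?S}"
      using openin_preimage_compact_open[OF G K oS] by simp
    moreover have "r0 \<in> {r. ?G r ` (?w ` cball x0 e) \<subseteq> ?S}" using e by auto
    ultimately show "\<exists>T. open T \<and> (r0, x0) \<in> T \<and> (\<forall>x'\<in>T. (case x' of (r, x) \<Rightarrow> F r (torus_cover x)) \<in> S)"
    proof (intro exI[of _ "{r. ?G r ` (?w ` cball x0 e) \<subseteq> ?S} \<times> ball x0 e"] conjI ballI)
      fix q assume "q \<in> {r. ?G r ` (?w ` cball x0 e) \<subseteq> ?S} \<times> ball x0 e"
      then obtain r x where q: "q = (r, x)" "?G r ` (?w ` cball x0 e) \<subseteq> ?S" "x \<in> cball x0 e" by auto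
      then have "?G r (?w x) \<in> ?S" by blast
      then show "(case q of (r, x) \<Rightarrow> F r (torus_cover x)) \<in> S" using Gv[of r x] q by simp
    qed (use e in \<open>auto simp: open_Times\<close>)
  qed
qed

section \<open>The algebra of sections as equivariant functions on the line\<close>

abbreviation "orb \<equiv> orbit_class gamma"
abbreviation "sections \<equiv> smooth_sections \<A> gamma"
abbreviation "\<S> \<equiv> section_algebra \<A> gamma"

lemma orb_eq_iff:
  assumes "f \<in> carrier \<A>" "g \<in> carrier \<A>"
  shows "orb r f = orb s g \<longleftrightarrow> (\<exists>n::int. s = r + of_int n \<and> g = gamma (- n) f)"
proof
  assume eq: "orb r f = orb s g"
  have "(s, g) \<in> orb s g"
    using gamma_0[OF assms(2)] by (auto simp: orbit_class_def intro!: exI[of _ 0])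
  then have "(s, g) \<in> orb r f" by (simp only: eq)
  then show "\<exists>n::int. s = r + of_int n \<and> g = gamma (- n) f" by (auto simp: orbit_class_def)
next
  assume "\<exists>n::int. s = r + of_int n \<and> g = gamma (- n) f"
  then obtain n :: int where n: "s = r + of_int n" "g = gamma (- n) f" by blast
  show "orb r f = orb s g"
    unfolding orbit_class_def
  proof (intro Set.set_eqI iffI)
    fix p assume "p \<in> {(r + of_int m, gamma (- m) f) | m. True}"
    then obtain m where "p = (r + of_int m, gamma (- m) f)" by blast
    then have "p = (s + of_int (m - n), gamma (- (m - n)) g)" by (simp add: n gamma_gamma)
    then show "p \<in> {(s + of_int m, gamma (- m) g) | m. True}" by blast
  next
    fix p assume "p \<in> {(s + of_int m, gamma (- m) g) | m. True}"
    then obtain m where "p = (s + of_int m, gamma (- m) g)" by blast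
    then have "p = (r + of_int (m + n), gamma (- (m + n)) f)" by (simp add: n gamma_gamma)
    then show "p \<in> {(r + of_int m, gamma (- m) f) | m. True}" by blast
  qed
qed

text \<open>The integers act freely on the line, so over a fixed \<open>r\<close> a class has only
  one representative.\<close>

lemma orb_inj: "f \<in> carrier \<A> \<Longrightarrow> g \<in> carrier \<A> \<Longrightarrow> orb r f = orb r g \<Longrightarrow> f = g"
  using orb_eq_iff[of f g r r] gamma_0 by auto

lemma bundle_proj_orb: "bundle_proj (orb r f) = circle_cover r"
  unfolding bundle_proj_def
proof (rule the_equality)
  show "\<exists>(s, g)\<in>orb r f. circle_cover r = circle_cover s"
    by (rule bexI[of _ "(r + of_int 0, gamma (- 0) f)"]) (auto simp: orbit_class_def intro!: exI[of _ 0])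
  show "z = circle_cover r" if "\<exists>(s, g)\<in>orb r f. z = circle_cover s" for z
    using that by (auto simp: orbit_class_def circle_cover_add)
qed

lemma total_space_fibre:
  assumes "c \<in> total_space \<A> gamma" "bundle_proj c = circle_cover r"
  shows "\<exists>f\<in>carrier \<A>. c = orb r f"
proof -
  obtain s g where sg: "g \<in> carrier \<A>" "c = orb s g" using assms(1) unfolding total_space_def by blast
  then have "circle_cover r = circle_cover s" using assms(2) bundle_proj_orb[of s g] by simp
  then obtain n :: int where n: "r = s + of_int n" using circle_cover_eq_iff by blast
  then have "orb s g = orb r (gamma (- n) g)"
    unfolding orb_eq_iff[OF sg(1) gamma_closed[OF sg(1)]] by blast
  then show ?thesis using sg gamma_closed by blast
qed

text \<open>Since \<open>h\<close> commutes with the action, all representatives of a class lead to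
  the same value and the \<open>THE\<close> is determined.\<close>

lemma fibre_lift1_orb:
  assumes h: "\<And>f. f \<in> carrier \<A> \<Longrightarrow> h f \<in> carrier \<A>"
    "\<And>n f. f \<in> carrier \<A> \<Longrightarrow> h (gamma n f) = gamma n (h f)"
    and f: "f \<in> carrier \<A>"
  shows "fibre_lift1 \<A> gamma h (orb r f) = orb r (h f)"
  unfolding fibre_lift1_def
proof (rule the_equality)
  show "\<exists>s. \<exists>g\<in>carrier \<A>. orb r f = orb s g \<and> orb r (h f) = orb s (h g)" using f by blast
  fix e assume "\<exists>s. \<exists>g\<in>carrier \<A>. orb r f = orb s g \<and> e = orb s (h g)"
  then obtain s g where g: "g \<in> carrier \<A>" "orb r f = orb s g" "e = orb s (h g)" by blast
  then obtain n :: int where n: "s = r + of_int n" "g = gamma (- n) f" using orb_eq_iff[OF f g(1)] by auto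
  then have "h g = gamma (- n) (h f)" using h(2)[OF f] by simp
  then show "e = orb r (h f)" using orb_eq_iff[OF h(1)[OF f] h(1)[OF g(1)], of r s] g(3) n(1) by auto
qed

lemma fibre_lift2_orb:
  assumes h: "\<And>f g. f \<in> carrier \<A> \<Longrightarrow> g \<in> carrier \<A> \<Longrightarrow> h f g \<in> carrier \<A>"
    "\<And>n f g. h (gamma n f) (gamma n g) = gamma n (h f g)"
    and f: "f \<in> carrier \<A>" "g \<in> carrier \<A>"
  shows "fibre_lift2 \<A> gamma h (orb r f) (orb r g) = orb r (h f g)"
  unfolding fibre_lift2_def
proof (rule the_equality)
  show "\<exists>s. \<exists>f'\<in>carrier \<A>. \<exists>g'\<in>carrier \<A>.
      orb r f = orb s f' \<and> orb r g = orb s g' \<and> orb r (h f g) = orb s (h f' g')" using f by blast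
  fix e assume "\<exists>s. \<exists>f'\<in>carrier \<A>. \<exists>g'\<in>carrier \<A>.
      orb r f = orb s f' \<and> orb r g = orb s g' \<and> e = orb s (h f' g')"
  then obtain s f' g' where g: "f' \<in> carrier \<A>" "g' \<in> carrier \<A>"
    "orb r f = orb s f'" "orb r g = orb s g'" "e = orb s (h f' g')" by blast
  obtain n :: int where n: "s = r + of_int n" "f' = gamma (- n) f" using orb_eq_iff[OF f(1) g(1)] g(3) by auto
  obtain m :: int where m: "s = r + of_int m" "g' = gamma (- m) g" using orb_eq_iff[OF f(2) g(2)] g(4) by auto
  \<comment> \<open>Both classes are rewritten over the same base point, which forces the same
    integer shift.\<close>
  have "m = n" using n(1) m(1) by simp
  then have "h f' g' = gamma (- n) (h f g)" using h(2) n m by simp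
  then show "e = orb r (h f g)" using orb_eq_iff[OF h(1)[OF f] h(1)[OF g(1,2)], of r s] g(5) n(1) by auto
qed

lemma fibre_const_orb:
  assumes a: "a \<in> carrier \<A>" "\<And>n. gamma n a = a"
  shows "fibre_const gamma a (circle_cover r) = orb r a"
  unfolding fibre_const_def
proof (rule the_equality)
  show "\<exists>s. circle_cover s = circle_cover r \<and> orb r a = orb s a" by blast
  fix e assume "\<exists>s. circle_cover s = circle_cover r \<and> e = orb s a"
  then obtain s where s: "circle_cover r = circle_cover s" "e = orb s a" by metis
  then obtain n :: int where "r = s + of_int n" using circle_cover_eq_iff by blast
  then show "e = orb r a" using s(2) orb_eq_iff[OF a(1) a(1), of s r] a(2) by auto
qed

text \<open>Sections before any smoothness is imposed: the correspondence with equivariant functions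
  is purely algebraic and is set up at this level.\<close>

definition presections :: "(complex \<Rightarrow> (real \<times> (complex \<times> complex \<Rightarrow> complex)) set) set" where
  "presections = {s \<in> circle \<rightarrow>\<^sub>E total_space \<A> gamma. \<forall>z\<in>circle. bundle_proj (s z) = z}"

definition lift :: "(complex \<Rightarrow> (real \<times> (complex \<times> complex \<Rightarrow> complex)) set) \<Rightarrow> real \<Rightarrow> complex \<times> complex \<Rightarrow> complex" where
  "lift s r = (THE f. f \<in> carrier \<A> \<and> s (circle_cover r) = orb r f)"

lemma lift_eqI: "f \<in> carrier \<A> \<Longrightarrow> s (circle_cover r) = orb r f \<Longrightarrow> lift s r = f"
  unfolding lift_def using orb_inj by (intro the_equality) auto

lemma
  assumes "s \<in> presections"
  shows lift_closed [simp]: "lift s r \<in> carrier \<A>"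
    and orb_lift: "s (circle_cover r) = orb r (lift s r)"
proof -
  have "s (circle_cover r) \<in> total_space \<A> gamma" "bundle_proj (s (circle_cover r)) = circle_cover r"
    using assms by (auto simp: presections_def)
  then obtain f where f: "f \<in> carrier \<A>" "s (circle_cover r) = orb r f"
    using total_space_fibre by blast
  then show "lift s r \<in> carrier \<A>" "s (circle_cover r) = orb r (lift s r)"
    using lift_eqI[of f s r, OF f] by auto
qed

lemma lift_add_int:
  assumes s: "s \<in> presections"
  shows "lift s (r + of_int n) = gamma (- n) (lift s r)"
proof (rule lift_eqI)
  have "s (circle_cover (r + of_int n)) = orb r (lift s r)" using orb_lift[OF s] by (simp add: circle_cover_add)
  then show "s (circle_cover (r + of_int n)) = orb (r + of_int n) (gamma (- n) (lift s r))"
    using orb_eq_iff[of "lift s r" "gamma (- n) (lift s r)" r "r + of_int n"] s by auto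
qed (use s in simp)

lemma presection_eqI:
  assumes "s \<in> presections" "u \<in> presections" "\<And>r. lift s r = lift u r"
  shows "s = u"
proof (rule extensionalityI[where A = circle])
  show "s \<in> extensional circle" "u \<in> extensional circle" using assms by (auto simp: presections_def PiE_def)
  fix z assume "z \<in> circle"
  then obtain r where "z = circle_cover r" using circle_cover_surj by blast
  then show "s z = u z" using orb_lift[OF assms(1), of r] orb_lift[OF assms(2), of r] assms(3) by simp
qed

text \<open>The inverse of \<open>lift\<close>; the arbitrary choice of \<open>r\<close> over
  \<open>z\<close> is harmless when \<open>F\<close> is equivariant.\<close>

definition presection_of :: "(real \<Rightarrow> complex \<times> complex \<Rightarrow> complex) \<Rightarrow> complex \<Rightarrow> (real \<times> (complex \<times> complex \<Rightarrow> complex)) set" where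
  "presection_of F = (\<lambda>z\<in>circle. let r = (SOME r. z = circle_cover r) in orb r (F r))"

lemma
  assumes F: "\<And>r. F r \<in> carrier \<A>" "\<And>r n. F (r + of_int n) = gamma (- n) (F r)"
  shows presection_of_closed: "presection_of F \<in> presections"
    and lift_presection_of [simp]: "lift (presection_of F) r = F r"
proof -
  have v: "presection_of F (circle_cover r) = orb r (F r)" for r
  proof -
    let ?s = "SOME s. circle_cover r = circle_cover s"
    have "circle_cover r = circle_cover ?s" by (rule someI[of _ r]) simp
    then have "\<exists>n::int. ?s = r + of_int n" using circle_cover_eq_iff[of ?s r] by simp
    then have "orb r (F r) = orb ?s (F ?s)" unfolding orb_eq_iff[OF F(1) F(1)] using F(2) by metis
    then show ?thesis by (simp add: presection_of_def Let_def)
  qed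
  then show "lift (presection_of F) r = F r" using lift_eqI F by blast
  have "presection_of F z \<in> total_space \<A> gamma \<and> bundle_proj (presection_of F z) = z" if "z \<in> circle" for z
  proof -
    obtain r where "z = circle_cover r" using circle_cover_surj[OF \<open>z \<in> circle\<close>] by blast
    then show ?thesis using v[of r] F(1)[of r] bundle_proj_orb by (auto simp: total_space_def)
  qed
  then show "presection_of F \<in> presections"
    unfolding presections_def PiE_iff by (simp add: presection_of_def)
qed

lemma inj_on_bundle_chart:
  assumes V: "V \<in> chart_domains"
  shows "inj_on (bundle_chart gamma V) (circle_cover ` V \<times> carrier \<A>)"
proof (rule inj_onI)
  have inj: "inj_on circle_cover V" using V by (simp add: chart_domains_def)
  fix p q assume p: "p \<in> circle_cover ` V \<times> carrier \<A>" and q: "q \<in> circle_cover ` V \<times> carrier \<A>"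
    and eq: "bundle_chart gamma V p = bundle_chart gamma V q"
  obtain r f where rf: "r \<in> V" "f \<in> carrier \<A>" "p = (circle_cover r, f)" using p by auto
  obtain s g where sg: "s \<in> V" "g \<in> carrier \<A>" "q = (circle_cover s, g)" using q by auto
  have "orb r f = orb s g" using eq rf sg inj by (simp add: bundle_chart_def the_inv_into_f_f)
  then obtain n :: int where n: "s = r + of_int n" using orb_eq_iff[OF rf(2) sg(2)] by auto
  then have "circle_cover s = circle_cover r" by (simp add: circle_cover_add)
  then have "s = r" using inj rf sg by (meson inj_onD)
  then show "p = q" using orb_inj rf sg \<open>orb r f = orb s g\<close> by metis
qed

lemma local_rep_lift:
  assumes s: "s \<in> presections" and V: "V \<in> chart_domains" and r: "r \<in> V"
  shows "local_rep \<A> gamma V s (circle_cover r) = lift s r"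
proof -
  have inj: "inj_on circle_cover V" using V by (simp add: chart_domains_def)
  have "the_inv_into (circle_cover ` V \<times> carrier \<A>) (bundle_chart gamma V) (s (circle_cover r))
    = (circle_cover r, lift s r)"
    by (rule the_inv_into_f_eq[OF inj_on_bundle_chart[OF V]])
      (use r s in \<open>auto simp: bundle_chart_def the_inv_into_f_f[OF inj] orb_lift[OF s, of r]\<close>)
  then show ?thesis using r by (simp add: local_rep_def)
qed

lemma chart_ball: "ball (x :: real) (1/4) \<in> chart_domains"
  by (simp add: chart_domains_def circle_cover_inj_ball)

lemma open_circle_atlas: "open_atlas (circle_atlas U)"
  by (auto simp: open_atlas_def circle_atlas_def)

lemma points_circle_atlas: "V \<in> chart_domains \<Longrightarrow> points (circle_atlas (circle_cover ` V)) = circle_cover ` V"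
  unfolding points_def circle_atlas_def chart_domains_def by fastforce

text \<open>Over a chart domain the local representative is \<open>lift s\<close> read through
  \<open>circle_cover\<close>, and smoothness is local, so the charts and the line see the same
  condition.\<close>

lemma sections_iff: "s \<in> sections \<longleftrightarrow> s \<in> presections \<and> smooth_into \<A> UNIV (lift s)"
proof
  assume s: "s \<in> sections"
  then have p: "s \<in> presections" by (simp add: smooth_sections_def presections_def)
  have "smooth_into \<A> UNIV (lift s)"
  proof (rule torus.smooth_into_local[OF open_UNIV])
    fix x :: real
    let ?V = "ball x (1/4)"
    have "(?V, circle_cover) \<in> circle_atlas (circle_cover ` ?V)"
      using chart_ball[of x] by (auto simp: circle_atlas_def chart_domains_def)
    moreover have "local_rep \<A> gamma ?V s \<in> smooth_maps (circle_atlas (circle_cover ` ?V)) \<A>"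
      using s chart_ball[of x] by (simp add: smooth_sections_def)
    ultimately have "smooth_into \<A> ?V (\<lambda>r. local_rep \<A> gamma ?V s (circle_cover r))"
      using torus.smooth_mapsD by blast
    then have "smooth_into \<A> ?V (lift s)"
      by (rule torus.smooth_into_cong[OF open_ball]) (simp add: local_rep_lift[OF p chart_ball])
    then show "\<exists>U. open U \<and> x \<in> U \<and> smooth_into \<A> U (lift s)" by (intro exI[of _ ?V]) auto
  qed
  then show "s \<in> presections \<and> smooth_into \<A> UNIV (lift s)" using p by simp
next
  assume "s \<in> presections \<and> smooth_into \<A> UNIV (lift s)"
  then have s: "s \<in> presections" and sm: "smooth_into \<A> UNIV (lift s)" by auto
  have "local_rep \<A> gamma V s \<in> smooth_maps (circle_atlas (circle_cover ` V)) \<A>"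
    if V: "V \<in> chart_domains" for V
  proof -
    let ?l = "local_rep \<A> gamma V s"
    have oV: "open V" using V by (simp add: chart_domains_def)
    have "(\<lambda>z\<in>points (circle_atlas (circle_cover ` V)). ?l z) \<in> smooth_maps (circle_atlas (circle_cover ` V)) \<A>"
    proof (rule torus.smooth_mapsI[OF open_circle_atlas])
      fix W \<psi> assume "(W, \<psi>) \<in> circle_atlas (circle_cover ` V)"
      then have W: "open W" "\<psi> = circle_cover" "circle_cover ` W \<subseteq> circle_cover ` V" by (auto simp: circle_atlas_def)
      show "smooth_into \<A> W (\<lambda>r. ?l (\<psi> r))"
      proof (rule torus.smooth_into_local[OF W(1)])
        fix r assume "r \<in> W"
        then obtain v where v: "v \<in> V" "circle_cover r = circle_cover v" using W by blast
        then obtain n :: int where n: "r = v + of_int n" using circle_cover_eq_iff by blast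
        \<comment> \<open>A parametrization of the same arc may run through another sheet of the
          covering; near \<open>r\<close> it differs from \<open>V\<close> by the integer
          \<open>n\<close>.\<close>
        let ?U = "(\<lambda>x. of_int n + x) ` V"
        have U: "open ?U" using oV open_translation by blast
        have "smooth_into \<A> ?U (\<lambda>x. lift s (- of_int n + x))"
          by (rule torus.smooth_into_affine[OF open_UNIV U sm linear_id[unfolded id_def]]) auto
        then have "smooth_into \<A> ?U (\<lambda>x. ?l (\<psi> x))"
        proof (rule torus.smooth_into_cong[OF U])
          fix x assume "x \<in> ?U"
          then have "- of_int n + x \<in> V" by auto
          moreover have "circle_cover (- of_int n + x) = circle_cover x"
            unfolding circle_cover_eq_iff by (rule exI[of _ "- n"]) simp
          ultimately show "lift s (- of_int n + x) = ?l (\<psi> x)"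
            using local_rep_lift[OF s V, of "- of_int n + x"] W(2) by simp
        qed
        moreover have "r \<in> ?U" using v n by auto
        ultimately show "\<exists>U. open U \<and> r \<in> U \<and> smooth_into \<A> U (\<lambda>r. ?l (\<psi> r))" using U by blast
      qed
    qed
    moreover have "(\<lambda>z\<in>points (circle_atlas (circle_cover ` V)). ?l z) = ?l"
      by (simp add: points_circle_atlas[OF V] local_rep_def restrict_def fun_eq_iff)
    ultimately show ?thesis by simp
  qed
  then show "s \<in> sections" using s by (simp add: smooth_sections_def presections_def)
qed

lemma sections_presections: "s \<in> sections \<Longrightarrow> s \<in> presections"
  by (simp add: sections_iff)

lemma section_ofI:
  assumes F: "smooth_into \<A> UNIV F" "\<And>r n. F (r + of_int n) = gamma (- n) (F r)"
  shows "presection_of F \<in> sections" "lift (presection_of F) = F"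
proof -
  have c: "F r \<in> carrier \<A>" for r using torus.smooth_into_closed[OF F(1), of r] by simp
  show l: "lift (presection_of F) = F" using lift_presection_of[OF c F(2)] by blast
  show "presection_of F \<in> sections" unfolding sections_iff l using presection_of_closed[OF c F(2)] F(1) by simp
qed

text \<open>The operations on sections are defined through classes. Once the class over each
  \<open>r\<close> is known, this gives membership and the lift together.\<close>

lemma presection_operation:
  assumes v: "\<And>r. s (circle_cover r) = orb r (F r)" and F: "\<And>r. F r \<in> carrier \<A>"
    and ext: "s \<in> extensional circle"
  shows "s \<in> presections" "lift s = F"
proof -
  show "lift s = F" using lift_eqI[of "F _" s, OF F v] by blast
  have "s z \<in> total_space \<A> gamma \<and> bundle_proj (s z) = z" if "z \<in> circle" for z
  proof -
    obtain r where "z = circle_cover r" using circle_cover_surj[OF \<open>z \<in> circle\<close>] by blast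
    then show ?thesis using v[of r] F[of r] bundle_proj_orb by (auto simp: total_space_def)
  qed
  then show "s \<in> presections" using ext by (auto simp: presections_def PiE_iff)
qed

section \<open>The locally convex algebra of sections and the circle action\<close>

lemma section_operations:
  assumes s: "s \<in> sections" and u: "u \<in> sections"
  shows "s \<oplus>\<^bsub>\<S>\<^esub> u \<in> sections" "lift (s \<oplus>\<^bsub>\<S>\<^esub> u) = (\<lambda>r. lift s r \<oplus>\<^bsub>\<A>\<^esub> lift u r)"
    "s \<otimes>\<^bsub>\<S>\<^esub> u \<in> sections" "lift (s \<otimes>\<^bsub>\<S>\<^esub> u) = (\<lambda>r. lift s r \<otimes>\<^bsub>\<A>\<^esub> lift u r)"
    "c \<odot>\<^bsub>\<S>\<^esub> s \<in> sections" "lift (c \<odot>\<^bsub>\<S>\<^esub> s) = (\<lambda>r. c \<odot>\<^bsub>\<A>\<^esub> lift s r)"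
proof -
  note p = sections_presections[OF s] sections_presections[OF u]
  have sm: "smooth_into \<A> UNIV (lift s)" "smooth_into \<A> UNIV (lift u)"
    using s u by (auto simp: sections_iff)
  have a: "(s \<oplus>\<^bsub>\<S>\<^esub> u) (circle_cover r) = orb r (lift s r \<oplus>\<^bsub>\<A>\<^esub> lift u r)" for r
    by (simp add: section_algebra_def orb_lift[OF p(1), of r] orb_lift[OF p(2), of r])
      (rule fibre_lift2_orb; use p in \<open>simp add: gamma_hom\<close>)
  have m: "(s \<otimes>\<^bsub>\<S>\<^esub> u) (circle_cover r) = orb r (lift s r \<otimes>\<^bsub>\<A>\<^esub> lift u r)" for r
    by (simp add: section_algebra_def orb_lift[OF p(1), of r] orb_lift[OF p(2), of r])
      (rule fibre_lift2_orb; use p in \<open>simp add: gamma_hom\<close>)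
  have c: "(c \<odot>\<^bsub>\<S>\<^esub> s) (circle_cover r) = orb r (c \<odot>\<^bsub>\<A>\<^esub> lift s r)" for r
    by (simp add: section_algebra_def orb_lift[OF p(1), of r])
      (rule fibre_lift1_orb; use p in \<open>simp add: gamma_hom\<close>)
  have ext: "s \<oplus>\<^bsub>\<S>\<^esub> u \<in> extensional circle" "s \<otimes>\<^bsub>\<S>\<^esub> u \<in> extensional circle"
    "c \<odot>\<^bsub>\<S>\<^esub> s \<in> extensional circle" by (simp_all add: section_algebra_def)
  note A = presection_operation[OF a _ ext(1)] and M = presection_operation[OF m _ ext(2)]
    and C = presection_operation[OF c _ ext(3)]
  show a': "lift (s \<oplus>\<^bsub>\<S>\<^esub> u) = (\<lambda>r. lift s r \<oplus>\<^bsub>\<A>\<^esub> lift u r)"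
    and m': "lift (s \<otimes>\<^bsub>\<S>\<^esub> u) = (\<lambda>r. lift s r \<otimes>\<^bsub>\<A>\<^esub> lift u r)"
    and c': "lift (c \<odot>\<^bsub>\<S>\<^esub> s) = (\<lambda>r. c \<odot>\<^bsub>\<A>\<^esub> lift s r)"
    using A M C p by simp_all
  show "s \<oplus>\<^bsub>\<S>\<^esub> u \<in> sections"
    unfolding sections_iff a' using A(1) p torus.smooth_into_add[OF open_UNIV sm] by simp
  show "s \<otimes>\<^bsub>\<S>\<^esub> u \<in> sections"
    unfolding sections_iff m' using M(1) p torus.smooth_into_mult[OF open_UNIV sm] by simp
  show "c \<odot>\<^bsub>\<S>\<^esub> s \<in> sections"
    unfolding sections_iff c' using C(1) p torus.smooth_into_smult[OF open_UNIV sm(1)] by simp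
qed

lemma section_constants:
  "\<one>\<^bsub>\<S>\<^esub> \<in> sections" "lift \<one>\<^bsub>\<S>\<^esub> = (\<lambda>r. \<one>\<^bsub>\<A>\<^esub>)"
  "\<zero>\<^bsub>\<S>\<^esub> \<in> sections" "lift \<zero>\<^bsub>\<S>\<^esub> = (\<lambda>r. \<zero>\<^bsub>\<A>\<^esub>)"
proof -
  have o: "\<one>\<^bsub>\<S>\<^esub> (circle_cover r) = orb r \<one>\<^bsub>\<A>\<^esub>"
    and z: "\<zero>\<^bsub>\<S>\<^esub> (circle_cover r) = orb r \<zero>\<^bsub>\<A>\<^esub>" for r
    by (simp_all add: section_algebra_def fibre_const_orb gamma_hom)
  have ext: "\<one>\<^bsub>\<S>\<^esub> \<in> extensional circle" "\<zero>\<^bsub>\<S>\<^esub> \<in> extensional circle"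
    by (simp_all add: section_algebra_def)
  show o': "lift \<one>\<^bsub>\<S>\<^esub> = (\<lambda>r. \<one>\<^bsub>\<A>\<^esub>)" and z': "lift \<zero>\<^bsub>\<S>\<^esub> = (\<lambda>r. \<zero>\<^bsub>\<A>\<^esub>)"
    using presection_operation[OF o _ ext(1)] presection_operation[OF z _ ext(2)] by simp_all
  show "\<one>\<^bsub>\<S>\<^esub> \<in> sections" "\<zero>\<^bsub>\<S>\<^esub> \<in> sections"
    unfolding sections_iff o' z'
    using presection_operation(1)[OF o _ ext(1)] presection_operation(1)[OF z _ ext(2)]
    by (simp_all add: torus.smooth_into_const)
qed

lemma carrier_section_alg [simp]: "carrier \<S> = sections"
  by (simp add: section_algebra_def)

abbreviation "rep \<equiv> local_rep \<A> gamma"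
abbreviation "chart_algebra V \<equiv> smooth_algebra (circle_atlas (circle_cover ` V)) \<A>"

lemma topol_section_alg:
  "topol \<S> = initial_topology sections chart_domains rep (\<lambda>V. topol (chart_algebra V))"
  by (simp add: section_algebra_def)

lemma lc_chart_algebra: "lc_algebra (chart_algebra V)"
  by (rule torus.lc_algebra_smooth[OF open_circle_atlas])

lemma rep_closed: "V \<in> chart_domains \<Longrightarrow> s \<in> sections \<Longrightarrow> rep V s \<in> smooth_maps (circle_atlas (circle_cover ` V)) \<A>"
  by (simp add: smooth_sections_def)

lemma rep_eqI:
  assumes V: "V \<in> chart_domains" and s: "s \<in> presections" and f: "f \<in> extensional (circle_cover ` V)"
    and eq: "\<And>r. r \<in> V \<Longrightarrow> lift s r = f (circle_cover r)"
  shows "rep V s = f"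
proof (rule extensionalityI[where A = "circle_cover ` V"])
  show "rep V s \<in> extensional (circle_cover ` V)" by (simp add: local_rep_def)
qed (use f eq local_rep_lift[OF s V] in auto)

text \<open>Lifts turn the operations into pointwise ones in \<open>\<A>\<close>, and local
  representatives turn them into those of the chart algebras; both families are injective. The first
  gives the algebraic laws, the second the topology.\<close>

lemma lc_algebra_sections: "lc_algebra \<S>"
proof -
  note ops = section_operations section_constants
  have top: "lc_operations (topol \<S>) \<zero>\<^bsub>\<S>\<^esub> (add \<S>) (smult \<S>) (mult \<S>)"
    unfolding topol_section_alg
  proof (rule lc_operations_initial[where P = "\<lambda>V. add (chart_algebra V)" and Q = "\<lambda>V. smult (chart_algebra V)"
        and M = "\<lambda>V. mult (chart_algebra V)"])
    fix V assume V: "V \<in> chart_domains"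
    interpret C: lc_alg "chart_algebra V" by standard (rule lc_chart_algebra)
    note pts = points_circle_atlas[OF V]
    have "rep V \<zero>\<^bsub>\<S>\<^esub> = \<zero>\<^bsub>chart_algebra V\<^esub>"
      by (rule rep_eqI[OF V]) (auto simp: sections_presections ops smooth_algebra_def pts)
    then show "lc_operations (topol (chart_algebra V)) (rep V \<zero>\<^bsub>\<S>\<^esub>) (add (chart_algebra V))
        (smult (chart_algebra V)) (mult (chart_algebra V))"
      using C.lc_operations by simp
    show "rep V \<in> sections \<rightarrow> topspace (topol (chart_algebra V))"
      using rep_closed[OF V] by (auto simp: smooth_algebra_def)
    fix s assume s: "s \<in> sections"
    note ps = sections_presections[OF s]
    show "rep V (c \<odot>\<^bsub>\<S>\<^esub> s) = c \<odot>\<^bsub>chart_algebra V\<^esub> rep V s" for c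
      by (rule rep_eqI[OF V]) (auto simp: sections_presections ops(5,6)[OF s s] smooth_algebra_def pts local_rep_lift[OF ps V])
    fix u assume u: "u \<in> sections"
    note pu = sections_presections[OF u]
    show "rep V (s \<oplus>\<^bsub>\<S>\<^esub> u) = rep V s \<oplus>\<^bsub>chart_algebra V\<^esub> rep V u"
      by (rule rep_eqI[OF V])
        (auto simp: sections_presections ops(1,2)[OF s u] smooth_algebra_def pts local_rep_lift[OF ps V] local_rep_lift[OF pu V])
    show "rep V (s \<otimes>\<^bsub>\<S>\<^esub> u) = rep V s \<otimes>\<^bsub>chart_algebra V\<^esub> rep V u"
      by (rule rep_eqI[OF V])
        (auto simp: sections_presections ops(3,4)[OF s u] smooth_algebra_def pts local_rep_lift[OF ps V] local_rep_lift[OF pu V])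
  next
    fix s u assume s: "s \<in> sections" and u: "u \<in> sections" and eq: "\<And>V. V \<in> chart_domains \<Longrightarrow> rep V s = rep V u"
    have "lift s r = lift u r" for r
      using local_rep_lift[OF sections_presections[OF s] chart_ball[of r], of r]
        local_rep_lift[OF sections_presections[OF u] chart_ball[of r], of r] eq[OF chart_ball[of r]] by simp
    then show "s = u" using s u by (intro presection_eqI) (auto simp: sections_presections)
  qed (use ops in auto)
  show ?thesis
  proof (rule lc_algebra_jointly_injective[OF lc_algebra_torus, where I = UNIV and ev = "\<lambda>r s. lift s r"])
    show "topspace (topol \<S>) = carrier \<S>" by (simp add: topol_section_alg)
    show "x = y" if "x \<in> carrier \<S>" "y \<in> carrier \<S>" "\<And>i. i \<in> UNIV \<Longrightarrow> lift x i = lift y i" for x y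
      using that by (intro presection_eqI) (auto simp: sections_presections)
  qed (use ops top in \<open>auto simp: sections_presections\<close>)
qed

text \<open>Cut off outside \<open>sections\<close> because members of \<open>Bij\<close> are
  extensional.\<close>

definition beta :: "complex \<Rightarrow> (complex \<Rightarrow> (real \<times> (complex \<times> complex \<Rightarrow> complex)) set) \<Rightarrow>
    complex \<Rightarrow> (real \<times> (complex \<times> complex \<Rightarrow> complex)) set" where
  "beta t = (\<lambda>s\<in>sections. \<lambda>z\<in>circle. fibre_lift1 \<A> gamma (rot t) (s z))"

lemma rot_alg_hom: "t \<in> circle \<Longrightarrow> rot t \<in> alg_hom \<A> \<A>"
  by (auto simp: alg_hom_def rot_hom)

lemma
  assumes t: "t \<in> circle" and s: "s \<in> sections"
  shows beta_closed: "beta t s \<in> sections" and lift_beta: "lift (beta t s) = (\<lambda>r. rot t (lift s r))"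
proof -
  note p = sections_presections[OF s]
  have b: "beta t s (circle_cover r) = orb r (rot t (lift s r))" for r
    using s by (simp add: beta_def orb_lift[OF p, of r]) (rule fibre_lift1_orb; use p t in \<open>simp add: rot_gamma\<close>)
  have ext: "beta t s \<in> extensional circle" using s by (simp add: beta_def)
  show l: "lift (beta t s) = (\<lambda>r. rot t (lift s r))"
    using presection_operation(2)[OF b _ ext] p t by simp
  have "rot t (x \<ominus>\<^bsub>\<A>\<^esub> y) = rot t x \<ominus>\<^bsub>\<A>\<^esub> rot t y"
    if "x \<in> carrier \<A>" "y \<in> carrier \<A>" for x y
  proof -
    have "\<ominus>\<^bsub>\<A>\<^esub> rot t y = rot t (\<ominus>\<^bsub>\<A>\<^esub> y)"
      using rot_hom(3)[OF t, of "-1" y] torus.smult_minus_one[OF that(2)] torus.smult_minus_one[OF rot_closed[OF that(2) t]]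
      by simp
    then show ?thesis using rot_hom(1)[OF t] by (simp add: a_minus_def)
  qed
  moreover have "continuous_map (topol \<A>) (topol \<A>) (rot t)"
    using continuous_map_comp2[OF continuous_map_rot, of "topol \<A>" "\<lambda>_. t" "\<lambda>f. f"] t
    by (simp add: continuous_map_id[unfolded id_def])
  moreover have "smooth_into \<A> UNIV (lift s)" using s by (simp add: sections_iff)
  ultimately have "smooth_into \<A> UNIV (\<lambda>r. rot t (lift s r))"
    using torus.smooth_into_linear[OF open_UNIV _ lc_algebra_torus, of "lift s" "rot t"] rot_hom(3)[OF t] by simp
  then show "beta t s \<in> sections"
    unfolding sections_iff l using presection_operation(1)[OF b _ ext] p t by simp
qed

lemma section_eqI: "s \<in> sections \<Longrightarrow> u \<in> sections \<Longrightarrow> lift s = lift u \<Longrightarrow> s = u"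
  by (rule presection_eqI) (auto simp: sections_presections)

lemma dynamical_system_beta: "dynamical_system \<S> circle_group circle_top beta"
proof (rule dynamical_systemI[OF lc_algebra_sections topological_group_circle])
  note ops = section_operations section_constants
  fix g assume "g \<in> carrier circle_group"
  then have g: "g \<in> circle" by (simp add: circle_group_def)
  show "beta g \<in> extensional (carrier \<S>)" by (simp add: beta_def)
  show "beta g \<in> alg_hom \<S> \<S>"
    unfolding alg_hom_def using g
    by (auto intro!: section_eqI simp: ops beta_closed lift_beta rot_hom)
  show "beta g \<one>\<^bsub>\<S>\<^esub> = \<one>\<^bsub>\<S>\<^esub>"
    using g by (auto intro!: section_eqI simp: ops beta_closed lift_beta rot_hom)
  fix h x assume h: "h \<in> carrier circle_group" and x: "x \<in> carrier \<S>"
  then show "beta (g \<otimes>\<^bsub>circle_group\<^esub> h) x = beta g (beta h x)"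
    using g by (auto intro!: section_eqI simp: circle_group_def circle_closed beta_closed lift_beta rot_rot)
next
  fix x assume "x \<in> carrier \<S>"
  then show "beta \<one>\<^bsub>circle_group\<^esub> x = x"
    by (auto intro!: section_eqI simp: circle_group_def circle_closed beta_closed lift_beta rot_1 sections_presections)
next
  let ?X = "topol \<S>"
  show "continuous_map (prod_topology circle_top ?X) ?X (\<lambda>(g, a). beta g a)"
    unfolding topol_section_alg
  proof (rule continuous_map_into_initial_topology, unfold topol_section_alg[symmetric])
    show "(\<lambda>(g, a). beta g a) \<in> topspace (prod_topology circle_top ?X) \<rightarrow> sections"
      by (auto simp: beta_closed topol_section_alg)
    fix V assume V: "V \<in> chart_domains"
    have r: "rep V \<in> sections \<rightarrow> topspace (topol (chart_algebra V))"
      using rep_closed[OF V] by (auto simp: smooth_algebra_def)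
    have "continuous_map ?X (topol (chart_algebra V)) (rep V)"
      unfolding topol_section_alg
      using continuous_map_initial_topology[where F = rep and T = "\<lambda>V. topol (chart_algebra V)" and i = V, OF V r] .
    then have 1: "continuous_map (prod_topology circle_top ?X) (prod_topology circle_top (topol (chart_algebra V)))
      (\<lambda>p. (fst p, rep V (snd p)))"
      using continuous_map_compose[OF continuous_map_snd]
      by (intro continuous_map_pairedI continuous_map_fst) (auto simp: o_def)
    \<comment> \<open>In a chart the action is the rotation of values, an instance of a jointly
      continuous action by algebra maps.\<close>
    have 2: "continuous_map (prod_topology circle_top (topol (chart_algebra V))) (topol (chart_algebra V))
      (\<lambda>(g, f). \<lambda>x\<in>points (circle_atlas (circle_cover ` V)). rot g (f x))"
      by (rule continuous_map_smooth_algebra_action(1)[OF lc_algebra_torus open_circle_atlas continuous_map_rot])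
        (simp add: rot_alg_hom)
    show "continuous_map (prod_topology circle_top ?X) (topol (chart_algebra V)) (\<lambda>z. rep V (case z of (g, a) \<Rightarrow> beta g a))"
    proof (rule continuous_map_eq[OF continuous_map_compose[OF 1 2]])
      fix p assume "p \<in> topspace (prod_topology circle_top ?X)"
      then obtain t s where p: "p = (t, s)" "t \<in> circle" "s \<in> sections" by (auto simp: topol_section_alg)
      have "rep V (beta t s) = (\<lambda>x\<in>points (circle_atlas (circle_cover ` V)). rot t (rep V s x))"
        by (rule rep_eqI[OF V])
          (use p in \<open>auto simp: sections_presections beta_closed lift_beta points_circle_atlas[OF V] local_rep_lift V\<close>)
      then show "((\<lambda>(g, f). \<lambda>x\<in>points (circle_atlas (circle_cover ` V)). rot g (f x)) \<circ> (\<lambda>p. (fst p, rep V (snd p)))) p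
        = rep V (case p of (g, a) \<Rightarrow> beta g a)" by (simp add: p)
    qed
  qed
qed

section \<open>Smooth functions on the line\<close>

text \<open>Differentiability up to order \<open>n\<close> at the points of \<open>V\<close>;
  smoothness is this for all \<open>n\<close>. Recursion through \<open>deriv\<close> makes the
  closure properties provable by induction.\<close>

primrec times_diff :: "real set \<Rightarrow> nat \<Rightarrow> (real \<Rightarrow> real) \<Rightarrow> bool" where
  "times_diff V 0 f \<longleftrightarrow> True"
| "times_diff V (Suc n) f \<longleftrightarrow> (\<forall>x\<in>V. f field_differentiable at x) \<and> times_diff V n (deriv f)"

lemma deriv_cong_open:
  fixes f g :: "real \<Rightarrow> real"
  assumes "open V" "\<And>x. x \<in> V \<Longrightarrow> f x = g x" "x \<in> V"
  shows "deriv f x = deriv g x"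
proof (rule deriv_cong_ev)
  show "\<forall>\<^sub>F x in nhds x. f x = g x" using assms eventually_nhds by blast
qed simp

lemma times_diff_cong:
  assumes "open V" "\<And>x. x \<in> V \<Longrightarrow> f x = g x" "times_diff V n f"
  shows "times_diff V n g"
  using assms(2,3)
proof (induction n arbitrary: f g)
  case (Suc n)
  have "g field_differentiable at x" if "x \<in> V" for x
  proof -
    have "f field_differentiable at x" using Suc.prems(2) that by simp
    then obtain d where "(f has_field_derivative d) (at x)" unfolding field_differentiable_def ..
    then have "(g has_field_derivative d) (at x)"
      using has_field_derivative_transform_within_open[OF _ assms(1) that] Suc.prems(1) by blast
    then show ?thesis by (auto simp: field_differentiable_def)
  qed
  moreover have "times_diff V n (deriv g)"
    by (rule Suc.IH[of "deriv f"]) (use deriv_cong_open[OF assms(1) Suc.prems(1)] Suc.prems(2) in auto)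
  ultimately show ?case by simp
qed simp

lemma times_diff_SucI:
  assumes "open V" "\<And>x. x \<in> V \<Longrightarrow> (f has_field_derivative f' x) (at x)" "times_diff V n f'"
  shows "times_diff V (Suc n) f"
proof -
  have "times_diff V n (deriv f)"
    by (rule times_diff_cong[OF assms(1) _ assms(3)]) (use assms(2) DERIV_imp_deriv in metis)
  then show ?thesis using assms(2) by (auto simp: field_differentiable_def)
qed

lemma times_diff_deriv: "times_diff V (Suc n) f \<Longrightarrow> x \<in> V \<Longrightarrow> (f has_field_derivative deriv f x) (at x)"
  by (simp add: DERIV_deriv_iff_field_differentiable)

lemma times_diff_Suc_imp: "times_diff V (Suc n) f \<Longrightarrow> times_diff V n f"
  by (induction n arbitrary: f) auto

lemma times_diff_local:
  assumes "\<And>x. x \<in> V \<Longrightarrow> \<exists>U. x \<in> U \<and> times_diff U n f"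
  shows "times_diff V n f"
  using assms
proof (induction n arbitrary: f)
  case (Suc n)
  have "times_diff V n (deriv f)" by (rule Suc.IH) (use Suc.prems in fastforce)
  then show ?case using Suc.prems by fastforce
qed simp

lemma times_diff_const: "open V \<Longrightarrow> times_diff V n (\<lambda>x. c)"
proof (induction n arbitrary: c)
  case (Suc n)
  show ?case by (rule times_diff_SucI[where f' = "\<lambda>x. 0"]) (use Suc in auto)
qed simp

lemma times_diff_add: "open V \<Longrightarrow> times_diff V n f \<Longrightarrow> times_diff V n g \<Longrightarrow> times_diff V n (\<lambda>x. f x + g x)"
proof (induction n arbitrary: f g)
  case (Suc n)
  show ?case
    by (rule times_diff_SucI[where f' = "\<lambda>x. deriv f x + deriv g x"])
      (use Suc in \<open>auto intro!: DERIV_add simp: DERIV_deriv_iff_field_differentiable\<close>)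
qed simp

lemma times_diff_mult: "open V \<Longrightarrow> times_diff V n f \<Longrightarrow> times_diff V n g \<Longrightarrow> times_diff V n (\<lambda>x. f x * g x)"
proof (induction n arbitrary: f g)
  case (Suc n)
  show ?case
  proof (rule times_diff_SucI[where f' = "\<lambda>x. f x * deriv g x + deriv f x * g x"])
    show "((\<lambda>x. f x * g x) has_field_derivative f x * deriv g x + deriv f x * g x) (at x)" if "x \<in> V" for x
      using DERIV_mult'[OF times_diff_deriv[OF Suc.prems(2) that] times_diff_deriv[OF Suc.prems(3) that]] .
    show "times_diff V n (\<lambda>x. f x * deriv g x + deriv f x * g x)"
      by (intro times_diff_add Suc.IH) (use Suc.prems times_diff_Suc_imp in auto)
  qed (use Suc in auto)
qed simp

lemma times_diff_inverse:
  "open V \<Longrightarrow> times_diff V n f \<Longrightarrow> (\<And>x. x \<in> V \<Longrightarrow> f x \<noteq> 0) \<Longrightarrow> times_diff V n (\<lambda>x. inverse (f x))"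
proof (induction n)
  case (Suc n)
  have 1: "times_diff V n (\<lambda>x. inverse (f x))" using Suc times_diff_Suc_imp by blast
  show ?case
  \<comment> \<open>The derivative contains \<open>inverse (f x)\<close> itself, which is
    \<open>n\<close> times differentiable by induction.\<close>
  proof (rule times_diff_SucI[where f' = "\<lambda>x. (- 1) * ((inverse (f x) * deriv f x) * inverse (f x))"])
    show "((\<lambda>x. inverse (f x)) has_field_derivative (- 1) * ((inverse (f x) * deriv f x) * inverse (f x))) (at x)"
      if "x \<in> V" for x
      using DERIV_inverse'[OF times_diff_deriv[OF Suc.prems(2) that] Suc.prems(3)[OF that]] by simp
    show "times_diff V n (\<lambda>x. (- 1) * ((inverse (f x) * deriv f x) * inverse (f x)))"
      by (intro times_diff_mult times_diff_const 1) (use Suc.prems in auto)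
  qed (use Suc in auto)
qed simp

lemma times_diff_affine: "times_diff UNIV n f \<Longrightarrow> times_diff UNIV n (\<lambda>x. f (c + d * x))"
proof (induction n arbitrary: f)
  case (Suc n)
  show ?case
  proof (rule times_diff_SucI[where f' = "\<lambda>x. d * deriv f (c + d * x)"])
    show "((\<lambda>x. f (c + d * x)) has_field_derivative d * deriv f (c + d * x)) (at x)" for x
    proof -
      have "((\<lambda>x. c + d * x) has_field_derivative d) (at x)" by (auto intro!: derivative_eq_intros)
      from DERIV_chain2[OF times_diff_deriv[OF Suc.prems UNIV_I] this] show ?thesis by (simp add: mult.commute)
    qed
    show "times_diff UNIV n (\<lambda>x. d * deriv f (c + d * x))"
      using Suc by (intro times_diff_mult times_diff_const) auto
  qed auto
qed simp

lemma times_diff_funpow: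
  assumes "times_diff V (Suc n) f" "x \<in> V"
  shows "((deriv ^^ n) f has_field_derivative (deriv ^^ Suc n) f x) (at x)"
  using assms
proof (induction n arbitrary: f)
  case 0
  then show ?case using times_diff_deriv[of V 0 f x] by simp
next
  case (Suc n)
  have "times_diff V (Suc n) (deriv f)" using Suc.prems(1) by simp
  from Suc.IH[OF this Suc.prems(2)] show ?case by (simp only: funpow_Suc_right o_apply)
qed

text \<open>The iterated derivatives of \<open>f\<close> form a family closed under differentiation,
  so \<open>smooth_into_scalar\<close> applies.\<close>

lemma (in lc_alg) smooth_into_times_diff:
  assumes V: "open V" and f: "\<And>n. times_diff V n f" and a: "a \<in> carrier E"
  shows "smooth_into E V (\<lambda>x. complex_of_real (f x) \<odot> a)"
proof (rule smooth_into_scalar[OF V, where S = "range (\<lambda>n x. complex_of_real ((deriv ^^ n) f x))" and lf = complex_of_real])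
  show "linear complex_of_real" by (auto simp: linear_iff scaleR_conv_of_real)
  fix g assume "g \<in> range (\<lambda>n x. complex_of_real ((deriv ^^ n) f x))"
  then obtain n where n: "g = (\<lambda>x. complex_of_real ((deriv ^^ n) f x))" by blast
  have d: "((deriv ^^ n) f has_field_derivative (deriv ^^ Suc n) f x) (at x)" if "x \<in> V" for x
    using times_diff_funpow[OF f that] .
  then have "continuous_on V ((deriv ^^ n) f)"
    using DERIV_isCont continuous_at_imp_continuous_on by blast
  then show "continuous_on V g" unfolding n by (intro continuous_intros)
  have "((\<lambda>t. complex_of_real ((deriv ^^ n) f (x + t * v))) has_vector_derivative
      complex_of_real v * complex_of_real ((deriv ^^ Suc n) f x)) (at 0)" if x: "x \<in> V" for x v
  proof -
    have "((\<lambda>t. (deriv ^^ n) f (x + t * v)) has_field_derivative (deriv ^^ Suc n) f x * v) (at 0)"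
      by (rule DERIV_chain2[where g = "\<lambda>t. x + t * v"]) (use d[OF x] in \<open>auto intro!: derivative_eq_intros\<close>)
    from has_vector_derivative_of_real[OF this] show ?thesis by (simp add: mult.commute)
  qed
  then show "\<exists>g'\<in>range (\<lambda>n x. complex_of_real ((deriv ^^ n) f x)). \<forall>x\<in>V. \<forall>v.
      ((\<lambda>t. g (x + t *\<^sub>R v)) has_vector_derivative complex_of_real v * g' x) (at 0)"
    unfolding n
    by (intro bexI[of _ "\<lambda>x. complex_of_real ((deriv ^^ Suc n) f x)"] range_eqI[of _ _ "Suc n"]) auto
next
  show "(\<lambda>x. complex_of_real (f x)) \<in> range (\<lambda>n x. complex_of_real ((deriv ^^ n) f x))"
    by (rule range_eqI[of _ _ 0]) simp
qed (rule a)

text \<open>The classical flat function, with extra powers of \<open>inverse x\<close>: the powers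
  make the family closed under differentiation up to linear combinations, which the function with
  \<open>m = 0\<close> alone is not.\<close>

definition flat :: "nat \<Rightarrow> real \<Rightarrow> real" where
  "flat m x = (if x > 0 then exp (- inverse x) * inverse x ^ m else 0)"

lemma flat_tendsto_0: "(flat m \<longlongrightarrow> 0) (at 0)"
proof -
  have "((\<lambda>x::real. inverse x ^ m / exp (inverse x)) \<longlongrightarrow> 0) (at_right 0)"
    using filterlim_compose[OF tendsto_power_div_exp_0 filterlim_inverse_at_top_right] .
  then have "(flat m \<longlongrightarrow> 0) (at_right 0)"
    by (rule Lim_transform_eventually)
      (auto simp: eventually_at_filter flat_def exp_minus divide_inverse mult.commute)
  moreover have "(flat m \<longlongrightarrow> 0) (at_left 0)"
    by (rule Lim_transform_eventually[OF tendsto_const]) (auto simp: eventually_at_filter flat_def)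
  ultimately show ?thesis by (simp add: filterlim_split_at)
qed

lemma flat_deriv: "(flat m has_field_derivative (flat (m + 2) x + (- real m) * flat (m + 1) x)) (at x)"
proof -
  consider "x > 0" | "x < 0" | "x = 0" by linarith
  then show ?thesis
  proof cases
    case 1
    have "((\<lambda>x. exp (- inverse x) * inverse x ^ m) has_field_derivative
        (flat (m + 2) x + (- real m) * flat (m + 1) x)) (at x)"
      using 1 by (auto intro!: derivative_eq_intros simp: flat_def power2_eq_square)
        (cases m; simp add: field_simps)
    then show ?thesis
      by (rule has_field_derivative_transform_within_open[of _ _ _ "{0<..}"]) (use 1 in \<open>auto simp: flat_def\<close>)
  next
    case 2
    have "((\<lambda>x. 0) has_field_derivative (flat (m + 2) x + (- real m) * flat (m + 1) x)) (at x)"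
      using 2 by (auto simp: flat_def)
    then show ?thesis
      by (rule has_field_derivative_transform_within_open[of _ _ _ "{..<0}"]) (use 2 in \<open>auto simp: flat_def\<close>)
  next
    case 3
    \<comment> \<open>The difference quotient of \<open>flat m\<close> at 0 is
      \<open>flat (Suc m)\<close>, which tends to 0.\<close>
    have "((\<lambda>h. (flat m (0 + h) - flat m 0) / h) \<longlongrightarrow> 0) (at 0)"
      by (rule Lim_transform_eventually[OF flat_tendsto_0[of "Suc m"]])
        (auto simp: eventually_at_filter flat_def divide_inverse)
    moreover have "flat (m + 2) 0 + (- real m) * flat (m + 1) 0 = 0" by (simp add: flat_def)
    ultimately show ?thesis unfolding DERIV_def 3 by simp
  qed
qed

lemma times_diff_flat: "times_diff UNIV n (flat m)"
proof (induction n arbitrary: m)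
  case (Suc n)
  show ?case
    by (rule times_diff_SucI[OF open_UNIV flat_deriv])
      (intro times_diff_add times_diff_mult times_diff_const Suc open_UNIV)
qed simp

text \<open>Positive exactly on the open unit interval and flat at both ends. The argument
  \<open>1 + (- 1) * x\<close> has the shape that \<open>times_diff_affine\<close> matches.\<close>

definition bump :: "real \<Rightarrow> real" where
  "bump x = flat 0 x * flat 0 (1 + (- 1) * x)"

lemma bump_pos: "0 < x \<Longrightarrow> x < 1 \<Longrightarrow> bump x > 0"
  and bump_zero: "x \<le> 0 \<or> 1 \<le> x \<Longrightarrow> bump x = 0"
  and bump_nonneg: "bump x \<ge> 0"
  by (auto simp: bump_def flat_def)

lemma times_diff_bump: "times_diff UNIV n bump"
  unfolding bump_def by (intro times_diff_mult times_diff_affine times_diff_flat open_UNIV)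

text \<open>At a jump of \<open>frac\<close> the bump is flat on both sides. Over two neighbouring
  periods the function is the sum of two integer translates, at most one of which is nonzero at each
  point.\<close>

lemma times_diff_bump_frac: "times_diff UNIV n (\<lambda>x. bump (frac (x + c)))"
proof (rule times_diff_local)
  fix x :: real
  let ?m = "\<lfloor>x + c\<rfloor>"
  let ?U = "{real_of_int ?m - 1 - c <..< real_of_int ?m + 1 - c}"
  let ?g = "\<lambda>y. bump ((c - of_int ?m + 1) + 1 * y) + bump ((c - of_int ?m) + 1 * y)"
  have "times_diff UNIV n ?g"
    by (intro times_diff_add times_diff_affine times_diff_bump open_UNIV)
  then have gU: "times_diff ?U n ?g" by (intro times_diff_local) blast
  have eq: "?g y = bump (frac (y + c))" if "y \<in> ?U" for y
  proof (cases "y + c < of_int ?m")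
    case True
    then have "\<lfloor>y + c\<rfloor> = ?m - 1" using that by (intro floor_unique) auto
    then have "frac (y + c) = (c - of_int ?m + 1) + 1 * y" by (simp add: frac_def)
    then show ?thesis using True bump_zero[of "c - of_int ?m + y"] by simp
  next
    case False
    then have "\<lfloor>y + c\<rfloor> = ?m" using that by (intro floor_unique) auto
    then have "frac (y + c) = (c - of_int ?m) + 1 * y" by (simp add: frac_def)
    then show ?thesis using False bump_zero[of "c - of_int ?m + 1 + y"] by simp
  qed
  have "times_diff ?U n (\<lambda>y. bump (frac (y + c)))"
    by (rule times_diff_cong[OF _ eq gU]) simp
  moreover have "x \<in> ?U" by (simp, linarith)
  ultimately show "\<exists>U. x \<in> U \<and> times_diff U n (\<lambda>x. bump (frac (x + c)))" by blast
qed

section \<open>Local trivializations\<close>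

text \<open>The section \<open>z\<^sub>2\<^sup>k\<close> over the circle minus the point \<open>\<pi>(-c)\<close>, multiplied by a function vanishing
  to infinite order at that point.\<close>

definition weight_fun :: "real \<Rightarrow> int \<Rightarrow> real \<Rightarrow> complex \<times> complex \<Rightarrow> complex" where
  "weight_fun c k r = complex_of_real (bump (frac (r + c))) \<odot>\<^bsub>\<A>\<^esub> gamma (- \<lfloor>r + c\<rfloor>) (zeta k)"

definition weight_section :: "real \<Rightarrow> int \<Rightarrow> complex \<Rightarrow> (real \<times> (complex \<times> complex \<Rightarrow> complex)) set" where
  "weight_section c k = presection_of (weight_fun c k)"

text \<open>A shift by \<open>n\<close> leaves the fractional part alone and raises the floor by
  \<open>n\<close>; the exponent of \<open>gamma\<close> absorbs it.\<close>

lemma weight_fun_equivariant: "weight_fun c k (r + of_int n) = gamma (- n) (weight_fun c k r)"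
proof -
  have e: "r + of_int n + c = (r + c) + of_int n" by simp
  have "frac (r + of_int n + c) = frac (r + c)" "\<lfloor>r + of_int n + c\<rfloor> = \<lfloor>r + c\<rfloor> + n"
    unfolding e by (simp_all add: frac_def)
  then show ?thesis by (simp add: weight_fun_def gamma_hom gamma_gamma add.commute)
qed

text \<open>The power of \<open>gamma\<close> jumps where \<open>r + c\<close> is an integer, and
  there the bump is flat. Across such a point the function is the sum of the two neighbouring
  branches, each smooth on its own and zero where the other is active.\<close>

lemma smooth_weight_fun: "smooth_into \<A> UNIV (weight_fun c k)"
proof (rule torus.smooth_into_local[OF open_UNIV])
  fix x :: real
  let ?m = "\<lfloor>x + c\<rfloor>" and ?s = "\<lambda>t f. complex_of_real t \<odot>\<^bsub>\<A>\<^esub> f"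
  let ?U = "{real_of_int ?m - 1 - c <..< real_of_int ?m + 1 - c}"
  let ?g = "\<lambda>y. ?s (bump ((c - of_int ?m + 1) + 1 * y)) (gamma (- (?m - 1)) (zeta k))
     \<oplus>\<^bsub>\<A>\<^esub> ?s (bump ((c - of_int ?m) + 1 * y)) (gamma (- ?m) (zeta k))"
  have "smooth_into \<A> UNIV ?g"
    by (intro torus.smooth_into_add torus.smooth_into_times_diff times_diff_affine times_diff_bump open_UNIV gamma_closed zeta_closed)
  then have "smooth_into \<A> ?U ?g" by (rule torus.smooth_into_subset) auto
  then have "smooth_into \<A> ?U (weight_fun c k)"
  proof (rule torus.smooth_into_cong[rotated])
    fix y assume y: "y \<in> ?U"
    show "?g y = weight_fun c k y"
    proof (cases "y + c < of_int ?m")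
      case True
      then have "\<lfloor>y + c\<rfloor> = ?m - 1" using y by (intro floor_unique) auto
      moreover from this have "frac (y + c) = (c - of_int ?m + 1) + 1 * y" by (simp add: frac_def)
      ultimately show ?thesis using True bump_zero[of "c - of_int ?m + y"] by (simp add: weight_fun_def)
    next
      case False
      then have "\<lfloor>y + c\<rfloor> = ?m" using y by (intro floor_unique) auto
      moreover from this have "frac (y + c) = (c - of_int ?m) + 1 * y" by (simp add: frac_def)
      ultimately show ?thesis using False bump_zero[of "c - of_int ?m + 1 + y"] by (simp add: weight_fun_def)
    qed
  qed simp
  moreover have "x \<in> ?U" by (simp, linarith)
  ultimately show "\<exists>U. open U \<and> x \<in> U \<and> smooth_into \<A> U (weight_fun c k)"
    by (intro exI[of _ ?U]) auto
qed

lemma weight_section [simp]: "weight_section c k \<in> sections"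
  and lift_weight_section: "lift (weight_section c k) = weight_fun c k"
  using section_ofI[OF smooth_weight_fun weight_fun_equivariant] by (simp_all add: weight_section_def)

lemma weight_section_mult:
  "weight_section c k \<otimes>\<^bsub>\<S>\<^esub> weight_section c (- k) = weight_section c 0 \<otimes>\<^bsub>\<S>\<^esub> weight_section c 0"
proof (rule section_eqI)
  have "weight_fun c j r \<otimes>\<^bsub>\<A>\<^esub> weight_fun c l r =
    complex_of_real (bump (frac (r + c)) * bump (frac (r + c))) \<odot>\<^bsub>\<A>\<^esub> gamma (- \<lfloor>r + c\<rfloor>) (zeta (j + l))" for j l r
    by (simp add: weight_fun_def torus.smult_mult torus.smult_smult gamma_hom(2)[symmetric] zeta_mult)
  then show "lift (weight_section c k \<otimes>\<^bsub>\<S>\<^esub> weight_section c (- k)) = lift (weight_section c 0 \<otimes>\<^bsub>\<S>\<^esub> weight_section c 0)"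
    by (simp add: section_operations lift_weight_section)
qed (simp_all add: section_operations)

lemma beta_weight_section:
  assumes t: "t \<in> circle"
  shows "beta t (weight_section c k) = (t powi k) \<odot>\<^bsub>\<S>\<^esub> weight_section c k"
proof (rule section_eqI)
  have "rot t (weight_fun c k r) = (t powi k) \<odot>\<^bsub>\<A>\<^esub> weight_fun c k r" for r
    using t by (simp add: weight_fun_def rot_hom rot_gamma rot_zeta gamma_hom torus.smult_smult mult.commute)
  then show "lift (beta t (weight_section c k)) = lift ((t powi k) \<odot>\<^bsub>\<S>\<^esub> weight_section c k)"
    using t by (simp add: lift_beta section_operations(6)[OF weight_section weight_section] lift_weight_section)
qed (use t in \<open>simp_all add: beta_closed section_operations(5)[OF weight_section weight_section]\<close>)

lemma carrier_circle_group [simp]: "carrier circle_group = circle"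
  by (simp add: circle_group_def)

interpretation S: lc_alg \<S>
  by standard (rule lc_algebra_sections)

section \<open>The fixed point algebra and the triviality of the localizations\<close>

lemma center_sections: "center \<S> = sections"
proof -
  have "s \<otimes>\<^bsub>\<S>\<^esub> u = u \<otimes>\<^bsub>\<S>\<^esub> s" if "s \<in> sections" "u \<in> sections" for s u
    by (rule section_eqI) (use that torus_mult_commute in \<open>simp_all add: section_operations\<close>)
  then show ?thesis by (auto simp: center_def)
qed

abbreviation "fixed_alg \<equiv> fixed_center \<S> circle_group beta"

lemma fixed_alg_iff: "s \<in> carrier fixed_alg \<longleftrightarrow> s \<in> sections \<and> (\<forall>t\<in>circle. beta t s = s)"
  by (simp add: fixed_center_def center_sections)

lemma fixed_alg_ops:
  "add fixed_alg = add \<S>" "mult fixed_alg = mult \<S>" "smult fixed_alg = smult \<S>"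
  by (simp_all add: fixed_center_def)

lemma weight_section_fixed: "weight_section c 0 \<in> carrier fixed_alg"
  by (simp add: fixed_alg_iff beta_weight_section)

lemma (in ring) one_minus_square: "y \<in> carrier R \<Longrightarrow> (\<one> \<ominus> y) \<otimes> (\<one> \<oplus> y) = \<one> \<ominus> y \<otimes> y"
  by (simp add: a_minus_def r_distr l_distr l_minus a_assoc r_neg1)

lemma trivial_localization:
  "trivial_nc_principal_bundle (localization \<S> (weight_section c 0)) (loc_action \<S> (weight_section c 0) beta)"
proof -
  let ?z = "weight_section c 0"
  have "localized_system \<S> circle_group circle_top beta ?z"
    by standard (use dynamical_system_beta weight_section_fixed[of c] in \<open>auto simp: fixed_alg_iff\<close>)
  then interpret L: localized_system \<S> circle_group circle_top beta ?z .
  let ?B = "smooth_algebra real_line \<S>" and ?I = "loc_ideal \<S> ?z"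
  let ?L = "localization \<S> ?z"
  note ops = L.B.quotient_operations[OF L.ideal_I, folded localization_def]
  have C: "carrier ?L = (\<lambda>f. ?I +>\<^bsub>?B\<^esub> f) ` carrier ?B" by (simp add: localization_def L.B.carrier_quotient)
  define f where "f k = (\<lambda>t::real. complex_of_real t \<odot>\<^bsub>\<S>\<^esub> weight_section c k)" for k
  have fB: "f k \<in> carrier ?B" for k
    unfolding L.carrier_B f_def by (rule S.smooth_into_line) simp
  have z: "?z \<in> carrier \<S>" by simp
  have unit: "(?I +>\<^bsub>?B\<^esub> f k) \<otimes>\<^bsub>?L\<^esub> (?I +>\<^bsub>?B\<^esub> f (- k)) = \<one>\<^bsub>?L\<^esub>" for k
  proof -
    \<comment> \<open>The cofactor in the factorization of one minus a square: the difference is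
      \<open>L.p\<close> times \<open>h\<close>, hence in the ideal.\<close>
    define h where "h = (\<lambda>t::real. \<one>\<^bsub>\<S>\<^esub> \<oplus>\<^bsub>\<S>\<^esub> (complex_of_real t \<odot>\<^bsub>\<S>\<^esub> ?z))"
    have hB: "h \<in> carrier ?B"
      unfolding L.carrier_B h_def
      by (intro S.smooth_into_add S.smooth_into_const S.smooth_into_line open_UNIV S.one_closed z)
    have pw: "f k t \<otimes>\<^bsub>\<S>\<^esub> f (- k) t = f 0 t \<otimes>\<^bsub>\<S>\<^esub> f 0 t" for t
    proof -
      have w: "weight_section c j \<in> carrier \<S>" for j by simp
      have "f j t \<otimes>\<^bsub>\<S>\<^esub> f l t =
          (complex_of_real t * complex_of_real t) \<odot>\<^bsub>\<S>\<^esub> (weight_section c j \<otimes>\<^bsub>\<S>\<^esub> weight_section c l)" for j l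
        unfolding f_def S.smult_mult(1)[OF w S.smult_closed[OF w]] S.smult_mult(2)[OF w w]
          S.smult_smult[OF S.m_closed[OF w w]] ..
      then show ?thesis by (simp only: weight_section_mult)
    qed
    have "\<one>\<^bsub>\<S>\<^esub> \<ominus>\<^bsub>\<S>\<^esub> (y \<otimes>\<^bsub>\<S>\<^esub> y)
       = (\<one>\<^bsub>\<S>\<^esub> \<ominus>\<^bsub>\<S>\<^esub> y) \<otimes>\<^bsub>\<S>\<^esub> (\<one>\<^bsub>\<S>\<^esub> \<oplus>\<^bsub>\<S>\<^esub> y)"
      if y: "y \<in> carrier \<S>" for y
      using ring.one_minus_square[OF S.ring_axioms y] by simp
    then have "\<one>\<^bsub>?B\<^esub> \<ominus>\<^bsub>?B\<^esub> (f k \<otimes>\<^bsub>?B\<^esub> f (- k)) = L.p \<otimes>\<^bsub>?B\<^esub> h"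
      unfolding L.B_minus[OF L.B.one_closed L.B.m_closed[OF fB fB]]
      unfolding L.B_operations pw
      by (simp add: f_def h_def S.smult_closed[OF z] del: carrier_section_alg)
    also have "\<dots> \<in> ?I" using ideal.I_r_closed[OF L.ideal_I L.p_in_I hB] .
    finally have "?I +>\<^bsub>?B\<^esub> \<one>\<^bsub>?B\<^esub> = ?I +>\<^bsub>?B\<^esub> (f k \<otimes>\<^bsub>?B\<^esub> f (- k))"
      by (rule L.B.coset_eqI[OF L.ideal_I L.B.one_closed L.B.m_closed[OF fB fB]])
    then show ?thesis using ops(2)[OF fB fB] ops(5) by simp
  qed
  have "?I +>\<^bsub>?B\<^esub> f k \<in> isotypic ?L (loc_action \<S> ?z beta) k \<inter> Units ?L" for k
  proof
    have mem: "?I +>\<^bsub>?B\<^esub> f k \<in> carrier ?L" for k unfolding C using fB by blast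
    have "loc_action \<S> ?z beta t (?I +>\<^bsub>?B\<^esub> f k) = (t powi k) \<odot>\<^bsub>?L\<^esub> (?I +>\<^bsub>?B\<^esub> f k)" if t: "t \<in> circle" for t
    proof -
      have tG: "t \<in> carrier circle_group" using t by simp
      have "beta t (x \<odot>\<^bsub>\<S>\<^esub> weight_section c k) = (t powi k) \<odot>\<^bsub>\<S>\<^esub> (x \<odot>\<^bsub>\<S>\<^esub> weight_section c k)" for x
        using dynamical_systemD(4)[OF dynamical_system_beta tG] beta_weight_section[OF t, of c k]
        by (simp add: alg_hom_def S.smult_smult mult.commute)
      then have "L.act t (f k) = (t powi k) \<odot>\<^bsub>?B\<^esub> f k" by (simp add: L.act_def f_def L.B_operations)
      then show ?thesis using L.loc_action_coset[OF tG fB] ops(3)[OF fB] by simp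
    qed
    then show "?I +>\<^bsub>?B\<^esub> f k \<in> isotypic ?L (loc_action \<S> ?z beta) k" using mem by (simp add: isotypic_def)
    \<comment> \<open>The relation for \<open>- k\<close> is the one with the factors exchanged, so
      the inverse is two-sided.\<close>
    show "?I +>\<^bsub>?B\<^esub> f k \<in> Units ?L"
      unfolding Units_def using mem unit[of k] unit[of "- k"] by auto
  qed
  then show ?thesis
    unfolding trivial_nc_principal_bundle_def using L.dynamical_system_localization by blast
qed

text \<open>The first bump vanishes only at integers, and there the shift by 1/2 puts the second at
  the midpoint of its interval.\<close>

lemma bump_sum_pos: "bump (frac r) + bump (frac (r + 1/2)) > 0"
proof (cases "frac r = 0")
  case True
  then have "frac (r + 1/2) = frac (1/2)" by (intro frac_add_int_left) simp
  also have "\<dots> = 1/2" by (simp add: frac_eq)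
  finally have half: "frac (r + 1/2) = 1/2" .
  have "bump (frac (r + 1/2)) > 0" unfolding half using bump_pos[of "1/2"] by simp
  then show ?thesis by (intro add_nonneg_pos bump_nonneg)
next
  case False
  then have "0 < frac r" "frac r < 1" using frac_ge_0[of r] frac_lt_1[of r] by (auto simp: less_le)
  then show ?thesis using bump_pos bump_nonneg[of "frac (r + 1/2)"] by (simp add: add_pos_nonneg)
qed

text \<open>The sum of the two cutoffs is a positive periodic function and \<open>v\<close> is its
  reciprocal. In every fibre it is a multiple of the unit, hence compatible with
  \<open>gamma\<close> and fixed by rotations.\<close>

lemma weight_section_partition:
  "\<exists>v\<in>carrier fixed_alg. (weight_section 0 0 \<oplus>\<^bsub>\<S>\<^esub> weight_section (1/2) 0) \<otimes>\<^bsub>\<S>\<^esub> v = \<one>\<^bsub>\<S>\<^esub>"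
proof -
  let ?\<rho> = "\<lambda>r. bump (frac (r + 0)) + bump (frac (r + 1/2))"
  define F where "F r = complex_of_real (inverse (?\<rho> r)) \<odot>\<^bsub>\<A>\<^esub> \<one>\<^bsub>\<A>\<^esub>" for r
  have pos: "?\<rho> r \<noteq> 0" for r using bump_sum_pos[of r] by simp
  have "smooth_into \<A> UNIV F"
    unfolding F_def
    by (intro torus.smooth_into_times_diff times_diff_inverse times_diff_add times_diff_bump_frac open_UNIV pos torus.one_closed)
  moreover have "F (r + of_int n) = gamma (- n) (F r)" for r n
  proof -
    have "frac (r + of_int n + d) = frac (r + d)" for d
    proof -
      have "r + of_int n + d = (r + d) + of_int n" by simp
      then show ?thesis by (simp only: frac_add_of_int_right)
    qed
    then show ?thesis unfolding F_def by (simp only: gamma_hom)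
  qed
  ultimately have v: "presection_of F \<in> sections" "lift (presection_of F) = F" using section_ofI by blast+
  have "beta t (presection_of F) = presection_of F" if "t \<in> circle" for t
  proof -
    have "rot t (F r) = F r" for r unfolding F_def rot_hom(3,4)[OF that] ..
    then show ?thesis by (intro section_eqI) (use that v in \<open>simp_all add: beta_closed lift_beta\<close>)
  qed
  then have vf: "presection_of F \<in> carrier fixed_alg" using v by (simp add: fixed_alg_iff)
  have "(weight_fun 0 0 r \<oplus>\<^bsub>\<A>\<^esub> weight_fun (1/2) 0 r) \<otimes>\<^bsub>\<A>\<^esub> F r = \<one>\<^bsub>\<A>\<^esub>" for r
  proof -
    have "weight_fun d 0 r = complex_of_real (bump (frac (r + d))) \<odot>\<^bsub>\<A>\<^esub> \<one>\<^bsub>\<A>\<^esub>" for d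
      by (simp add: weight_fun_def zeta_0 gamma_hom)
    then have "weight_fun 0 0 r \<oplus>\<^bsub>\<A>\<^esub> weight_fun (1/2) 0 r = complex_of_real (?\<rho> r) \<odot>\<^bsub>\<A>\<^esub> \<one>\<^bsub>\<A>\<^esub>"
      by (simp add: torus.smult_l_distr)
    then show ?thesis
      using pos[of r] by (simp add: F_def torus.smult_mult torus.smult_smult del: of_real_add flip: of_real_mult)
  qed
  then have "(weight_section 0 0 \<oplus>\<^bsub>\<S>\<^esub> weight_section (1/2) 0) \<otimes>\<^bsub>\<S>\<^esub> presection_of F = \<one>\<^bsub>\<S>\<^esub>"
    by (intro section_eqI) (simp_all add: section_operations section_constants v lift_weight_section)
  then show ?thesis using vf by blast
qed

lemma nc_principal_bundle_sections: "nc_principal_bundle \<S> beta"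
  unfolding nc_principal_bundle_def
proof (intro conjI dynamical_system_beta ballI)
  fix h assume "h \<in> characters fixed_alg"
  then have add: "\<And>x y. x \<in> carrier fixed_alg \<Longrightarrow> y \<in> carrier fixed_alg \<Longrightarrow> h (x \<oplus>\<^bsub>\<S>\<^esub> y) = h x + h y"
    and mult: "\<And>x y. x \<in> carrier fixed_alg \<Longrightarrow> y \<in> carrier fixed_alg \<Longrightarrow> h (x \<otimes>\<^bsub>\<S>\<^esub> y) = h x * h y"
    and ex: "\<exists>a\<in>carrier fixed_alg. h a \<noteq> 0"
    by (auto simp: characters_def alg_hom_def fixed_alg_ops)
  obtain a where a: "a \<in> carrier fixed_alg" "h a \<noteq> 0" using ex by blast
  have one: "\<one>\<^bsub>\<S>\<^esub> \<in> carrier fixed_alg"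
    using dynamical_systemD(5)[OF dynamical_system_beta] by (simp add: fixed_alg_iff section_constants)
  \<comment> \<open>Characters are only assumed to be nonzero somewhere; multiplicativity at such an
    \<open>a\<close> gives the value 1 at the unit.\<close>
  have "a \<otimes>\<^bsub>\<S>\<^esub> \<one>\<^bsub>\<S>\<^esub> = a" using S.r_one[of a] a by (simp add: fixed_alg_iff)
  then have h1: "h \<one>\<^bsub>\<S>\<^esub> = 1" using mult[OF a(1) one] a(2) by simp
  obtain v where v: "v \<in> carrier fixed_alg"
    "(weight_section 0 0 \<oplus>\<^bsub>\<S>\<^esub> weight_section (1/2) 0) \<otimes>\<^bsub>\<S>\<^esub> v = \<one>\<^bsub>\<S>\<^esub>"
    using weight_section_partition by blast
  have "weight_section 0 0 \<oplus>\<^bsub>\<S>\<^esub> weight_section (1/2) 0 \<in> carrier fixed_alg"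
    using dynamical_systemD(4)[OF dynamical_system_beta] weight_section_fixed[of 0] weight_section_fixed[of "1/2"]
    by (auto simp: fixed_alg_iff section_operations alg_hom_def)
  then have "(h (weight_section 0 0) + h (weight_section (1/2) 0)) * h v = 1"
    using mult[OF _ v(1)] add weight_section_fixed v(2) h1 by metis
  then have "h (weight_section 0 0) \<noteq> 0 \<or> h (weight_section (1/2) 0) \<noteq> 0" by auto
  then show "\<exists>z\<in>carrier fixed_alg. h z \<noteq> 0 \<and>
      trivial_nc_principal_bundle (localization \<S> z) (loc_action \<S> z beta)"
    using weight_section_fixed trivial_localization by blast
qed

section \<open>Non-triviality\<close>

text \<open>The values of \<open>g\<close> lie in the discrete set of integer multiples of 2 pi i,
  and the plane is connected.\<close>

lemma exp_eq_1_constant: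
  fixes g :: "real \<times> real \<Rightarrow> complex"
  assumes g: "continuous_on UNIV g" and e: "\<And>x. exp (g x) = 1"
  shows "g x = g y"
proof -
  have "g constant_on UNIV"
  proof (rule continuous_discrete_range_constant[OF connected_UNIV g])
    fix x :: "real \<times> real"
    show "\<exists>e>0. \<forall>y. y \<in> UNIV \<and> g y \<noteq> g x \<longrightarrow> e \<le> norm (g y - g x)"
    proof (intro exI[of _ "2 * pi"] conjI allI impI)
      fix y assume y: "y \<in> UNIV \<and> g y \<noteq> g x"
      have "exp (g y) = exp (g x)" using e by simp
      then obtain n :: int where n: "g y = g x + (of_int (2 * n) * pi) * \<i>" unfolding exp_eq by blast
      then have "n \<noteq> 0" using y by auto
      then have "1 \<le> \<bar>real_of_int n\<bar>" by linarith
      then have "2 * pi \<le> 2 * pi * \<bar>real_of_int n\<bar>" by simp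
      also have "\<dots> = norm (g y - g x)" by (simp add: n norm_mult abs_mult)
      finally show "2 * pi \<le> norm (g y - g x)" .
    qed simp
  qed
  then show ?thesis unfolding constant_on_def by (metis UNIV_I)
qed

text \<open>Such an \<open>H\<close> would be a nowhere vanishing section of the line bundle of degree \<open>-1\<close> over the
  torus. A logarithm of \<open>H\<close> changes by \<open>2 \<pi> i \<theta>\<close> along \<open>r\<close>, up to a constant, which is
  incompatible with its increment along \<open>\<theta>\<close> being a constant.\<close>

lemma no_nonvanishing_section:
  fixes H :: "real \<times> real \<Rightarrow> complex"
  assumes H: "continuous_on UNIV H" "\<And>x. H x \<noteq> 0"
    and per: "\<And>r \<theta>. H (r, \<theta> + 1) = H (r, \<theta>)"
    and twist: "\<And>r \<theta>. H (r + 1, \<theta>) = inverse (circle_cover \<theta>) * H (r, \<theta>)"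
  shows False
proof -
  obtain g where g: "continuous_on UNIV g" "\<And>x. H x = exp (g x)"
    using continuous_logarithm_on_contractible[OF H(1) convex_imp_contractible[OF convex_UNIV]] H(2) by (metis UNIV_I)
  \<comment> \<open>Increments of the logarithm along the two periods. In \<open>b\<close> the
    summand with \<open>snd p\<close> compensates the factor
    \<open>inverse (circle_cover \<theta>)\<close>, so that both exponentials are 1.\<close>
  define a where "a = (\<lambda>p. g (fst p, snd p + 1) - g p)"
  define b where "b = (\<lambda>p. g (fst p + 1, snd p) - g p + 2 * complex_of_real pi * \<i> * complex_of_real (snd p))"
  have shift: "continuous_on UNIV (\<lambda>p. g (q p))" if "continuous_on UNIV q" for q :: "real \<times> real \<Rightarrow> real \<times> real"
    using continuous_on_compose2[OF g(1) that] by simp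
  have "exp (a p) = 1" for p
    using g(2)[of p] g(2)[of "(fst p, snd p + 1)"] per[of "fst p" "snd p"] H(2)[of p] by (simp add: a_def exp_diff)
  moreover have "continuous_on UNIV a" unfolding a_def by (intro continuous_intros shift g(1))
  ultimately have a: "a p = a q" for p q using exp_eq_1_constant by blast
  have "exp (b p) = 1" for p
  proof -
    have "exp (g (fst p + 1, snd p)) = inverse (circle_cover (snd p)) * exp (g p)"
      using g(2)[of p] g(2)[of "(fst p + 1, snd p)"] twist[of "fst p" "snd p"] by simp
    then show ?thesis by (simp add: b_def exp_diff exp_add circle_cover_def)
  qed
  moreover have "continuous_on UNIV b" unfolding b_def by (intro continuous_intros shift g(1))
  ultimately have b: "b p = b q" for p q using exp_eq_1_constant by blast
  \<comment> \<open>Around the unit square: opposite increments of \<open>g\<close> in the second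
    variable agree, whereas opposite increments in the first variable differ by 2 pi i.\<close>
  have "2 * complex_of_real pi * \<i> = 0"
    using a[of "(0, 0)" "(1, 0)"] b[of "(0, 0)" "(0, 1)"] by (simp add: a_def b_def algebra_simps)
  then show False by simp
qed

text \<open>Weight 1 makes the value at \<open>(z1, z2)\<close> equal to \<open>z2\<close> times the
  value at \<open>(z1, 1)\<close>, so such a section is determined by a function \<open>H\<close> of
  \<open>r\<close> and \<open>z1\<close>. Equivariance under \<open>gamma\<close> becomes the twist
  by the inverse of \<open>z1\<close>, and invertibility keeps \<open>H\<close> from
  vanishing.\<close>

lemma no_unit_of_weight_1: "isotypic \<S> beta 1 \<inter> Units \<S> = {}"
proof (rule ccontr)
  assume "isotypic \<S> beta 1 \<inter> Units \<S> \<noteq> {}"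
  then obtain s where s: "s \<in> isotypic \<S> beta 1" "s \<in> Units \<S>" by blast
  then have sS: "s \<in> sections" and iso: "\<And>t. t \<in> circle \<Longrightarrow> beta t s = t \<odot>\<^bsub>\<S>\<^esub> s"
    by (auto simp: isotypic_def)
  obtain u where u: "u \<in> sections" "s \<otimes>\<^bsub>\<S>\<^esub> u = \<one>\<^bsub>\<S>\<^esub>" using s(2) by (auto simp: Units_def)
  have nz: "lift s r p \<noteq> 0" if p: "p \<in> torus" for r p
  proof -
    have "lift s r \<otimes>\<^bsub>\<A>\<^esub> lift u r = \<one>\<^bsub>\<A>\<^esub>"
      using fun_cong[OF section_operations(4)[OF sS u(1)], of r] by (simp add: u(2) section_constants(2))
    from fun_cong[OF this, of p] have "lift s r p * lift u r p = 1"
      using p by (simp add: torus_algebra_operations)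
    then show ?thesis by auto
  qed
  have rt: "lift s r (z1, t * z2) = t * lift s r (z1, z2)" if "t \<in> circle" "z1 \<in> circle" "z2 \<in> circle" for r t z1 z2
  proof -
    have "rot t (lift s r) = t \<odot>\<^bsub>\<A>\<^esub> lift s r"
      using fun_cong[OF lift_beta[OF that(1) sS], of r] by (simp add: iso[OF that(1)] section_operations(6)[OF sS sS])
    then have "rot t (lift s r) (z1, z2) = (t \<odot>\<^bsub>\<A>\<^esub> lift s r) (z1, z2)" by simp
    then show ?thesis using that by (simp add: rot_apply torus_algebra_operations)
  qed
  define H where "H = (\<lambda>(r, \<theta>). lift s r (torus_cover (\<theta>, 0)))"
  have cl: "continuous_map euclidean (topol \<A>) (lift s)"
  proof -
    have sm: "smooth_into \<A> UNIV (lift s)" using sS by (simp add: sections_iff)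
    have c: "continuous_map (tangent_dom 0 UNIV) (topol \<A>) (\<lambda>w. tangent_map \<A> 0 (lift s) w 0)"
      by (rule torus.smooth_into_cont[OF sm]) simp
    have "continuous_map euclidean (tangent_dom 0 UNIV) (\<lambda>r. \<lambda>j\<in>{..<(2::nat) ^ 0}. r :: real)"
      by (rule continuous_map_into_tangent_dom) auto
    from continuous_map_compose[OF this c] show ?thesis by (simp add: o_def)
  qed
  have "continuous_on UNIV H"
    using continuous_on_compose2[OF continuous_torus_evaluation[OF cl], of UNIV "\<lambda>p. (fst p, (snd p, 0))"]
    by (simp add: H_def case_prod_unfold continuous_intros)
  moreover have "H x \<noteq> 0" for x using nz by (cases x) (simp add: H_def circle_closed)
  moreover have "H (r, \<theta> + 1) = H (r, \<theta>)" for r \<theta>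
    using circle_cover_of_int[of 1] by (simp add: H_def circle_cover_add)
  moreover have "H (r + 1, \<theta>) = inverse (circle_cover \<theta>) * H (r, \<theta>)" for r \<theta>
  proof -
    \<comment> \<open>A full turn shears by \<open>gamma (- 1)\<close>. At second coordinate 1 this
      moves that coordinate to the inverse of the first one, which weight 1 pulls out as a
      factor.\<close>
    have "lift s (r + 1) = gamma (- 1) (lift s r)" using lift_add_int[OF sections_presections[OF sS], of r 1] by simp
    then have "H (r + 1, \<theta>) = lift s r (circle_cover \<theta>, inverse (circle_cover \<theta>) * 1)"
      by (simp add: H_def gamma_apply circle_closed power_int_minus)
    also have "\<dots> = inverse (circle_cover \<theta>) * lift s r (circle_cover \<theta>, 1)"
      by (rule rt) (simp_all add: circle_closed)
    finally show ?thesis by (simp add: H_def)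
  qed
  ultimately show False by (rule no_nonvanishing_section)
qed

theorem proposition8p32:
  shows "\<exists>\<beta>. dynamical_system (section_algebra torus_algebra gamma) circle_group circle_top \<beta> \<and>
             nc_principal_bundle (section_algebra torus_algebra gamma) \<beta> \<and>
             \<not> trivial_nc_principal_bundle (section_algebra torus_algebra gamma) \<beta>"
  using dynamical_system_beta nc_principal_bundle_sections no_unit_of_weight_1
  unfolding trivial_nc_principal_bundle_def by blast

end
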